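(* Let $n\in\{2,3\}$, let $\Omega\subset\mathbb R^n$ be a bounded domain with $\partial\Omega\in C^3$, and let $\gamma$ be the inward unit normal to $\partial\Omega$. Let $M_0,L_1,L_3$ be positive constants, and let $f=f(x,z)$ and $\psi=\psi(x,z)$ be $C^1$ functions on $\overline\Omega\times[-M_0,M_0]$ such that $$f_z(x,z)\ge 0\ \text{ and }\ |f(x,z)|+|f_x(x,z)|\le L_1\quad\text{in }\overline\Omega\times[-M_0,M_0],\qquad |\psi|_{C^1(\overline\Omega\times[-M_0,M_0])}\le L_3 .$$ Suppose $u\in C^2(\overline\Omega)\cap C^3(\Omega)$ satisfies $|u|\le M_0$ in $\overline\Omega$ and solves the Neumann problem $$\operatorname{div}\Big(\frac{Du}{\sqrt{1+|Du|^2}}\Big)=f(x,u)\ \text{ in }\Omega,\qquad \frac{\partial u}{\partial\gamma}+\psi(x,u)=0\ \text{ on }\partial\Omega.$$ Then there exists a small positive constant $\mu_0$ (determined by the data and not depending on $u$) such that $$\sup_{\overline\Omega_{\mu_0}}|Du|\le\max\{M_1,M_2\},$$ where $M_1$ is a positive constant depending only on $n,\mu_0,M_0,L_1$ (the constant coming from the interior gradient estimate), and $M_2$ is a positive constant depending only on $n,\Omega,\mu_0,M_0,L_1,L_3$.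
   Context: Notation: $d(x)=\operatorname{dist}(x,\partial\Omega)$ and, for $\mu>0$, $\Omega_\mu=\{x\in\Omega: d(x)<\mu\}$. $f_x$ denotes the gradient of $f$ in the $x$ variable and $f_z$ the partial derivative in $z$. The interior gradient estimate referred to is the standard one: if $u\in C^3(\Omega)$ solves $\operatorname{div}(Du/\sqrt{1+|Du|^2})=f(x,u)$ in $\Omega$ with $|u|\le M_0$, and $f\in C^1(\overline\Omega\times[-M_0,M_0])$ satisfies $f_z\ge0$ and $|f|+|f_x|\le L_1$, then for every subdomain $\Omega'\subset\subset\Omega$ one has $\sup_{\Omega'}|Du|\le M_1$ with $M_1$ depending only on $n,M_0,\operatorname{dist}(\Omega',\partial\Omega),L_1$. *)

theory Defs
  imports "HOL-Analysis.Analysis"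
begin

section \<open>Derivatives up to the boundary\<close>

text \<open>The derivative of \<open>u\<close> in direction \<open>b\<close> on the open set \<open>U\<close>, extended by its limit from
  inside \<open>U\<close> to boundary points of \<open>U\<close> (where the value is meaningful only if that limit exists;
  \<open>Ck\<close> below guarantees this on \<open>S\<close>).\<close>

definition dir_deriv ::
    "'a::euclidean_space set \<Rightarrow> 'a \<Rightarrow> ('a \<Rightarrow> real) \<Rightarrow> 'a \<Rightarrow> real" where
  "dir_deriv U b u x =
     (if x \<in> U then frechet_derivative u (at x) b
      else Lim (at x within U) (\<lambda>y. frechet_derivative u (at y) b))"

definition grad :: "'a::euclidean_space set \<Rightarrow> ('a \<Rightarrow> real) \<Rightarrow> 'a \<Rightarrow> 'a" where
  "grad U u x = (\<Sum>b\<in>Basis. dir_deriv U b u x *\<^sub>R b)"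

text \<open>For \<open>U\<close> open and \<open>U \<subseteq> S \<subseteq> closure U\<close>: all derivatives of \<open>u\<close> of order at most \<open>k\<close> exist in
  \<open>U\<close> and extend continuously to \<open>S\<close>. Thus \<open>Ck k U U\<close> is the space usually written
  \<open>C^k(U)\<close>, and \<open>Ck k U (closure U)\<close> is \<open>C^k\<close> of the closure of \<open>U\<close>.\<close>

fun Ck :: "nat \<Rightarrow> 'a::euclidean_space set \<Rightarrow> 'a set \<Rightarrow> ('a \<Rightarrow> real) \<Rightarrow> bool" where
  "Ck 0 U S u \<longleftrightarrow> continuous_on S u"
| "Ck (Suc k) U S u \<longleftrightarrow>
     continuous_on S u \<and> (\<forall>x\<in>U. u differentiable (at x)) \<and>
     (\<forall>b\<in>Basis. Ck k U S (dir_deriv U b u))"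

text \<open>The norm sup |u| + sup |Du| on \<open>S\<close>, for \<open>u\<close> with \<open>Ck 1 U S u\<close> and \<open>S\<close> compact.\<close>

definition C1_norm :: "'a::euclidean_space set \<Rightarrow> 'a set \<Rightarrow> ('a \<Rightarrow> real) \<Rightarrow> real" where
  "C1_norm U S u = (SUP x\<in>S. \<bar>u x\<bar>) + (SUP x\<in>S. norm (grad U u x))"

definition divergence :: "('a::euclidean_space \<Rightarrow> 'a) \<Rightarrow> 'a \<Rightarrow> real" where
  "divergence F x = (\<Sum>b\<in>Basis. frechet_derivative F (at x) b \<bullet> b)"

section \<open>Domains\<close>

definition bounded_domain :: "'a::euclidean_space set \<Rightarrow> bool" where
  "bounded_domain \<Omega> \<longleftrightarrow> open \<Omega> \<and> connected \<Omega> \<and> \<Omega> \<noteq> {} \<and> bounded \<Omega>"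

text \<open>In the ball of radius \<open>r\<close> about \<open>p\<close>, the set \<open>\<Omega>\<close> is the region above a \<open>C^3\<close> graph, with
  \<open>e\<close> as the vertical direction. A function on the hyperplane orthogonal to \<open>e\<close> is represented by
  a function \<open>g\<close> on the whole space that is constant along \<open>e\<close>.\<close>

definition C3_graph_at ::
    "'a::euclidean_space set \<Rightarrow> 'a \<Rightarrow> real \<Rightarrow> 'a \<Rightarrow> ('a \<Rightarrow> real) \<Rightarrow> bool" where
  "C3_graph_at \<Omega> p r e g \<longleftrightarrow>
     0 < r \<and> norm e = 1 \<and> Ck 3 UNIV UNIV g \<and> (\<forall>x t. g (x + t *\<^sub>R e) = g x) \<and>
     \<Omega> \<inter> ball p r = {x \<in> ball p r. g x < x \<bullet> e}"

definition C3_boundary :: "'a::euclidean_space set \<Rightarrow> bool" where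
  "C3_boundary \<Omega> \<longleftrightarrow> (\<forall>p\<in>frontier \<Omega>. \<exists>r e g. C3_graph_at \<Omega> p r e g)"

definition inward_unit_normal :: "'a::euclidean_space set \<Rightarrow> 'a \<Rightarrow> 'a \<Rightarrow> bool" where
  "inward_unit_normal \<Omega> p v \<longleftrightarrow>
     (\<exists>r e g. C3_graph_at \<Omega> p r e g \<and> v = sgn (e - grad UNIV g p))"

definition boundary_strip :: "'a::euclidean_space set \<Rightarrow> real \<Rightarrow> 'a set" where
  "boundary_strip \<Omega> \<mu> = {x \<in> \<Omega>. infdist x (frontier \<Omega>) < \<mu>}"

section \<open>The prescribed mean curvature equation\<close>

definition mean_curvature_op ::
    "'a::euclidean_space set \<Rightarrow> ('a \<Rightarrow> real) \<Rightarrow> 'a \<Rightarrow> real" where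
  "mean_curvature_op \<Omega> u x =
     divergence (\<lambda>y. (1 / sqrt (1 + (norm (grad \<Omega> u y))\<^sup>2)) *\<^sub>R grad \<Omega> u y) x"

text \<open>The data \<open>f(x,z)\<close> are functions of the pair \<open>(x,z)\<close>; these are the open and the closed
  cylinder over \<open>\<Omega>\<close>.\<close>

abbreviation open_cyl :: "'a::euclidean_space set \<Rightarrow> real \<Rightarrow> ('a \<times> real) set" where
  "open_cyl \<Omega> M \<equiv> \<Omega> \<times> {-M<..<M}"

abbreviation closed_cyl :: "'a::euclidean_space set \<Rightarrow> real \<Rightarrow> ('a \<times> real) set" where
  "closed_cyl \<Omega> M \<equiv> closure \<Omega> \<times> {-M..M}"

definition grad_x ::
    "('a::euclidean_space \<times> real) set \<Rightarrow> ('a \<times> real \<Rightarrow> real) \<Rightarrow> 'a \<times> real \<Rightarrow> 'a" where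
  "grad_x U f p = (\<Sum>b\<in>Basis. dir_deriv U (b, 0) f p *\<^sub>R b)"

definition deriv_z ::
    "('a::euclidean_space \<times> real) set \<Rightarrow> ('a \<times> real \<Rightarrow> real) \<Rightarrow> 'a \<times> real \<Rightarrow> real" where
  "deriv_z U f p = dir_deriv U (0, 1) f p"

definition rhs_conditions ::
    "'a::euclidean_space set \<Rightarrow> real \<Rightarrow> real \<Rightarrow> ('a \<times> real \<Rightarrow> real) \<Rightarrow> bool" where
  "rhs_conditions \<Omega> M0 L1 f \<longleftrightarrow>
     Ck 1 (open_cyl \<Omega> M0) (closed_cyl \<Omega> M0) f \<and>
     (\<forall>p\<in>closed_cyl \<Omega> M0.
        0 \<le> deriv_z (open_cyl \<Omega> M0) f p \<and>
        \<bar>f p\<bar> + norm (grad_x (open_cyl \<Omega> M0) f p) \<le> L1)"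

text \<open>\<open>M1 \<delta> M0 L1\<close> is an admissible constant in the interior gradient estimate in dimension
  \<open>CARD('n)\<close>, for subdomains \<open>\<Omega>'\<close> at distance \<open>\<delta>\<close> from the boundary; it is independent of the
  domain, of \<open>f\<close> and of \<open>u\<close>.\<close>

definition interior_gradient_constant ::
    "'n::finite itself \<Rightarrow> (real \<Rightarrow> real \<Rightarrow> real \<Rightarrow> real) \<Rightarrow> bool" where
  "interior_gradient_constant N M1 \<longleftrightarrow>
     (\<forall>\<delta>>0. \<forall>M0>0. \<forall>L1>0.
        0 < M1 \<delta> M0 L1 \<and>
        (\<forall>(\<Omega> :: (real^'n) set) \<Omega>' f u.
           bounded_domain \<Omega> \<and> rhs_conditions \<Omega> M0 L1 f \<and>
           Ck 3 \<Omega> \<Omega> u \<and> (\<forall>x\<in>\<Omega>. \<bar>u x\<bar> \<le> M0) \<and>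
           (\<forall>x\<in>\<Omega>. mean_curvature_op \<Omega> u x = f (x, u x)) \<and>
           bounded_domain \<Omega>' \<and> compact (closure \<Omega>') \<and> closure \<Omega>' \<subseteq> \<Omega> \<and>
           setdist \<Omega>' (frontier \<Omega>) = \<delta>
           \<longrightarrow> (\<forall>x\<in>\<Omega>'. norm (grad \<Omega> u x) \<le> M1 \<delta> M0 L1)))"

end

theory Submission
  imports Defs
begin

text \<open>The Neumann estimate is global and holds in every dimension; it comes from doubling the variables.
  With a profile \<open>A(s) = ln (1 + C K s) / C\<close>, one shows that for a suitable large \<open>K\<close> the function
  \<open>u(x) - u(y) - A(|x - y|) (E(x) + E(y)) + \<Psi>(\<xi>, z) \<bullet> (x - y) - |x - \<xi>|\<^sup>2 - (u(x) - z)\<^sup>2\<close> is nowhere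
  positive. Here \<open>\<Psi> = \<psi> \<gamma>\<close>, with \<open>\<gamma>\<close> extended inside, corrects the boundary slope, and its
  argument is frozen in the additional variables \<open>(\<xi>, z)\<close>, so that \<open>\<psi>\<close> need only be Lipschitz.
  The weight \<open>E\<close> decreases steeply along the inward normal, which rules out a positive maximum at the boundary.
  At an interior maximum the two Hessians are compared along a coupling of square roots of the
  coefficient matrices which reflects the direction of \<open>x - y\<close> and is almost synchronous
  orthogonally to it; the concavity \<open>A'' = - C A'\<^sup>2\<close> then contributes a term of order \<open>- C\<close> that beats
  all others. The scale \<open>K\<close> is lowered from infinity to its final value by halving, since the bound
  for \<open>2 K\<close> controls \<open>u(x) - u(y)\<close> by \<open>A\<close> at a maximum for \<open>K\<close>.

  The interior estimate is Korevaar's: maximize \<open>\<zeta> |Du|\<close>, where the cutoff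
  \<open>\<zeta> = exp (C \<phi>) - 1\<close> depends on \<open>u\<close> as well as on \<open>x\<close>.\<close>

section \<open>Linear algebra of the coupling\<close>

text \<open>The logarithmic profile is dictated by the degeneracy of the operator. Where the
  gradient is close to \<open>k e\<close> with \<open>k = A' (E(x) + E(y))\<close>, the coefficient
  matrix has weight of order \<open>1 / k^2\<close> in direction \<open>e\<close>, so concavity
  survives there as a term of order \<open>C\<close> exactly when \<open>A''\<close> is of order
  \<open>- C A'^2\<close>. With synchronous roots the \<open>e\<close>-components would nearly
  cancel and the term would be lost. Every other term is bounded independently of \<open>C\<close>,
  or carries a negative power of the slope and becomes small once the slope is taken large after
  \<open>C\<close> is fixed. A positive maximum bounds that difference only from below; the upper
  bound is what scale \<open>2 K\<close> supplies. In the interior estimate the operator degenerates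
  along \<open>Du\<close> in the same way. The part of the cutoff that is linear in \<open>u\<close>
  adds a multiple of \<open>Du\<close> to its gradient, which is long precisely in the degenerate
  direction.\<close>

lemma sum_Basis_inner_mult:
  fixes a c :: "'a::euclidean_space"
  shows "(\<Sum>b\<in>Basis. (a \<bullet> b) * (c \<bullet> b)) = a \<bullet> c"
  by (simp add: euclidean_inner[of a c])

definition trace_form :: "('a::euclidean_space \<Rightarrow> 'a) \<Rightarrow> real" where
  "trace_form H = (\<Sum>b\<in>Basis. H b \<bullet> b)"

lemma sum_Basis_linear_left:
  fixes H :: "'a::euclidean_space \<Rightarrow> 'a"
  assumes "linear H"
  shows "(\<Sum>b\<in>Basis. (c \<bullet> b) * (H b \<bullet> d)) = H c \<bullet> d"
proof -
  have "H c = H (\<Sum>b\<in>Basis. (c \<bullet> b) *\<^sub>R b)" by (simp add: euclidean_representation)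
  also have "\<dots> = (\<Sum>b\<in>Basis. (c \<bullet> b) *\<^sub>R H b)"
    using assms by (simp add: linear_sum linear_cmul)
  finally show ?thesis by (simp add: inner_sum_left)
qed

lemma sum_Basis_linear_right:
  fixes H :: "'a::euclidean_space \<Rightarrow> 'a"
  shows "(\<Sum>b\<in>Basis. (c \<bullet> b) * (H d \<bullet> b)) = H d \<bullet> c"
  using sum_Basis_inner_mult[of c "H d"] by (simp add: inner_commute)

text \<open>The left side is the trace of \<open>H\<close> against \<open>L L^T\<close>, where
  \<open>L\<close> is the identity plus two rank-one parts. Orthogonality of \<open>a\<close> and
  \<open>e\<close> removes the mixed products of these parts, so only the values of \<open>H\<close>
  on the plane of \<open>a\<close> and \<open>e\<close> correct the trace.\<close>

lemma trace_rank_two_perturbation: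
  fixes H :: "'a::euclidean_space \<Rightarrow> 'a" and m1 m2 n1 :: real
  assumes H: "linear H" and e: "norm e = 1" and orth: "a \<bullet> e = 0"
  defines "L \<equiv> \<lambda>b. b + (a \<bullet> b) *\<^sub>R (m1 *\<^sub>R a + m2 *\<^sub>R e) + (e \<bullet> b) *\<^sub>R (n1 *\<^sub>R e)"
  shows "(\<Sum>b\<in>Basis. H (L b) \<bullet> L b) = trace_form H
    + (2 * m1 + (norm a)\<^sup>2 * m1\<^sup>2) * (H a \<bullet> a)
    + (m2 + (norm a)\<^sup>2 * m1 * m2) * (H a \<bullet> e + H e \<bullet> a)
    + ((norm a)\<^sup>2 * m2\<^sup>2 + 2 * n1 + n1\<^sup>2) * (H e \<bullet> e)"
proof -
  define m where "m = m1 *\<^sub>R a + m2 *\<^sub>R e"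
  define n where "n = n1 *\<^sub>R e"
  have ee: "e \<bullet> e = 1" using e by (simp add: dot_square_norm)
  have L: "L b = b + (a \<bullet> b) *\<^sub>R m + (e \<bullet> b) *\<^sub>R n" for b
    by (simp add: L_def m_def n_def)
  have HL: "H (L b) = H b + (a \<bullet> b) *\<^sub>R H m + (e \<bullet> b) *\<^sub>R H n" for b
    using H by (simp add: L linear_add linear_cmul)
  have "(\<Sum>b\<in>Basis. H (L b) \<bullet> L b) = (\<Sum>b\<in>Basis. H b \<bullet> b
      + (a \<bullet> b) * (H b \<bullet> m) + (e \<bullet> b) * (H b \<bullet> n)
      + (a \<bullet> b) * (H m \<bullet> b) + (e \<bullet> b) * (H n \<bullet> b)
      + ((a \<bullet> b) * (a \<bullet> b)) * (H m \<bullet> m) + ((e \<bullet> b) * (e \<bullet> b)) * (H n \<bullet> n)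
      + ((a \<bullet> b) * (e \<bullet> b)) * (H m \<bullet> n + H n \<bullet> m))"
    unfolding HL by (intro sum.cong refl) (simp add: L inner_add_left inner_add_right algebra_simps)
  also have "\<dots> = trace_form H + H a \<bullet> m + H e \<bullet> n + H m \<bullet> a + H n \<bullet> e
      + (a \<bullet> a) * (H m \<bullet> m) + (e \<bullet> e) * (H n \<bullet> n) + (a \<bullet> e) * (H m \<bullet> n + H n \<bullet> m)"
    by (simp add: sum.distrib sum_Basis_linear_left[OF H] sum_Basis_linear_right
        sum_Basis_inner_mult sum_distrib_right[symmetric] trace_form_def)
  also have "\<dots> = trace_form H
    + (2 * m1 + (norm a)\<^sup>2 * m1\<^sup>2) * (H a \<bullet> a)
    + (m2 + (norm a)\<^sup>2 * m1 * m2) * (H a \<bullet> e + H e \<bullet> a)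
    + ((norm a)\<^sup>2 * m2\<^sup>2 + 2 * n1 + n1\<^sup>2) * (H e \<bullet> e)"
    using H unfolding m_def n_def power2_norm_eq_inner
    by (simp add: ee orth linear_add linear_cmul inner_add_left inner_add_right
        algebra_simps power2_eq_square)
  finally show ?thesis .
qed

text \<open>The trace of \<open>H\<close> against \<open>I - p p^T / (1 + |p|^2)\<close>: with
  \<open>p\<close> the gradient and \<open>H\<close> the Hessian this is the mean curvature operator
  in nondivergence form, multiplied by \<open>mc_speed p\<close>.\<close>

definition mc_trace :: "'a::euclidean_space \<Rightarrow> ('a \<Rightarrow> 'a) \<Rightarrow> real" where
  "mc_trace p H = trace_form H - (H p \<bullet> p) / (1 + (norm p)\<^sup>2)"

definition perp :: "'a::euclidean_space \<Rightarrow> 'a \<Rightarrow> 'a" where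
  "perp e p = p - (p \<bullet> e) *\<^sub>R e"

definition mc_speed :: "'a::euclidean_space \<Rightarrow> real" where
  "mc_speed p = sqrt (1 + (norm p)\<^sup>2)"

text \<open>The triangular square root of \<open>I - p p\<^sup>T / (1 + |p|\<^sup>2)\<close> in which \<open>e\<close> comes last; the
  sign of \<open>r\<close> is free and \<open>r = \<plusminus>1 / sqrt (1 + (p \<bullet> e)\<^sup>2)\<close>.\<close>

definition mc_root :: "'a::euclidean_space \<Rightarrow> 'a \<Rightarrow> real \<Rightarrow> 'a \<Rightarrow> 'a" where
  "mc_root e p r b = b
     + (perp e p \<bullet> b) *\<^sub>R ((- (1 / ((mc_speed p)\<^sup>2 + mc_speed p * sqrt (1 + (p \<bullet> e)\<^sup>2)))) *\<^sub>R perp e p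
         + (- ((p \<bullet> e) / (mc_speed p * sqrt (1 + (p \<bullet> e)\<^sup>2)))) *\<^sub>R e)
     + (e \<bullet> b) *\<^sub>R ((r - 1) *\<^sub>R e)"

lemma norm_perp_decomp:
  assumes "norm e = 1"
  shows "(norm p)\<^sup>2 = (p \<bullet> e)\<^sup>2 + (norm (perp e p))\<^sup>2" and "perp e p \<bullet> e = 0"
proof -
  have ee: "e \<bullet> e = 1" using assms by (simp add: dot_square_norm)
  show "perp e p \<bullet> e = 0" by (simp add: perp_def inner_diff_left ee)
  show "(norm p)\<^sup>2 = (p \<bullet> e)\<^sup>2 + (norm (perp e p))\<^sup>2"
    unfolding power2_norm_eq_inner
    by (simp add: perp_def inner_diff_left inner_diff_right ee
        inner_commute algebra_simps power2_eq_square)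
qed

lemma mc_speed_pos [simp]: "mc_speed p > 0" and mc_speed_ge_1 [simp]: "mc_speed p \<ge> 1"
  and mc_speed_sq [simp]: "(mc_speed p)\<^sup>2 = 1 + (norm p)\<^sup>2"
  by (auto simp: mc_speed_def add_pos_nonneg)

lemma mc_speed_ge_norm: "norm p \<le> mc_speed p"
  unfolding mc_speed_def by (rule real_le_rsqrt) simp

lemma mc_speed_le: "mc_speed p \<le> 1 + norm p"
  unfolding mc_speed_def by (rule real_le_lsqrt) (auto simp: power2_eq_square algebra_simps)

text \<open>\<open>sqrt (1 + x^2)\<close> is the modulus of \<open>1 + i x\<close>, so this is the
  reverse triangle inequality in the complex plane.\<close>

lemma sqrt_1_plus_sq_diff: "\<bar>sqrt (1 + x\<^sup>2) - sqrt (1 + y\<^sup>2)\<bar> \<le> \<bar>x - y\<bar>" for x y :: real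
proof -
  have "norm (Complex 1 x) \<le> norm (Complex 1 y) + norm (Complex 0 (x - y))"
    using norm_triangle_ineq[of "Complex 1 y" "Complex 0 (x - y)"] by (simp add: complex_add)
  moreover have "norm (Complex 1 y) \<le> norm (Complex 1 x) + norm (Complex 0 (y - x))"
    using norm_triangle_ineq[of "Complex 1 x" "Complex 0 (y - x)"] by (simp add: complex_add)
  ultimately show ?thesis by (simp add: cmod_def)
qed

lemma mc_speed_diff: "\<bar>mc_speed p - mc_speed q\<bar> \<le> norm (p - q)"
  using sqrt_1_plus_sq_diff[of "norm p" "norm q"] norm_triangle_ineq3[of p q]
  unfolding mc_speed_def by linarith

text \<open>With \<open>p = a + \<alpha> e\<close> and \<open>a\<close> orthogonal to
  \<open>e\<close>, the coefficients given by \<open>trace_rank_two_perturbation\<close> have to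
  equal \<open>- 1 / v^2\<close>, \<open>- \<alpha> / v^2\<close> and
  \<open>- \<alpha>^2 / v^2\<close>, the expansion of \<open>- (H p \<bullet> p) / v^2\<close>. All
  three rest on \<open>|a|^2 = v^2 - w^2\<close>. Only the square of \<open>r\<close> enters, so
  both signs are admissible; the coupling uses one at each point.\<close>

lemma mc_root_trace:
  fixes H :: "'a::euclidean_space \<Rightarrow> 'a"
  assumes H: "linear H" and e: "norm e = 1" and r: "r\<^sup>2 = 1 / (1 + (p \<bullet> e)\<^sup>2)"
  shows "(\<Sum>b\<in>Basis. H (mc_root e p r b) \<bullet> mc_root e p r b) = mc_trace p H"
proof -
  define a where "a = perp e p"
  define \<alpha> where "\<alpha> = p \<bullet> e"
  define v where "v = mc_speed p"
  define w where "w = sqrt (1 + \<alpha>\<^sup>2)"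
  define m1 where "m1 = - (1 / (v\<^sup>2 + v * w))"
  define m2 where "m2 = - (\<alpha> / (v * w))"
  have v: "v > 0" and w: "w > 0" by (auto simp: v_def w_def add_pos_nonneg)
  have w2: "w\<^sup>2 = 1 + \<alpha>\<^sup>2" by (simp add: w_def)
  have v2: "v\<^sup>2 = 1 + (norm p)\<^sup>2" by (simp add: v_def)
  have a2: "(norm a)\<^sup>2 = v\<^sup>2 - w\<^sup>2"
    using norm_perp_decomp(1)[OF e, of p] by (simp add: v2 w2 a_def \<alpha>_def)
  have orth: "a \<bullet> e = 0" using norm_perp_decomp(2)[OF e] by (simp add: a_def)
  have p: "p = a + \<alpha> *\<^sub>R e" by (simp add: a_def perp_def \<alpha>_def)
  have Hp: "H p \<bullet> p = H a \<bullet> a + \<alpha> * (H a \<bullet> e + H e \<bullet> a) + \<alpha>\<^sup>2 * (H e \<bullet> e)"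
    using H unfolding p by (simp add: linear_add linear_cmul inner_add_left inner_add_right
        algebra_simps power2_eq_square)
  have vw: "v\<^sup>2 + v * w = v * (v + w)" by (simp add: power2_eq_square algebra_simps)
  \<comment> \<open>This is the purpose of \<open>m1\<close>: the root scales the component along
    \<open>a\<close> by \<open>w / v\<close>. The coefficients \<open>c1\<close> and
    \<open>c2\<close> follow by factoring it out.\<close>
  have one: "1 + (norm a)\<^sup>2 * m1 = w / v"
  proof -
    have "v + w > 0" using v w by simp
    moreover have "v\<^sup>2 - w\<^sup>2 = (v - w) * (v + w)" by (simp add: power2_eq_square algebra_simps)
    moreover have "1 + x * y * - (1 / (v * y)) = (v - x) / v" if "y > 0" for x y
      using v that by (simp add: field_simps)
    ultimately show ?thesis unfolding a2 m1_def vw using v by simp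
  qed
  have c1: "2 * m1 + (norm a)\<^sup>2 * m1\<^sup>2 = - 1 / v\<^sup>2"
  proof -
    have "2 * m1 + (norm a)\<^sup>2 * m1\<^sup>2 = m1 * (1 + (1 + (norm a)\<^sup>2 * m1))"
      by (simp add: algebra_simps power2_eq_square)
    also have "\<dots> = m1 * (1 + w / v)" by (simp add: one)
    also have "\<dots> = - 1 / v\<^sup>2" 
    proof -
      have "v + w > 0" using v w by simp
      then show ?thesis unfolding m1_def vw using v by (simp add: divide_simps power2_eq_square)
    qed
    finally show ?thesis .
  qed
  have c2: "m2 + (norm a)\<^sup>2 * m1 * m2 = - \<alpha> / v\<^sup>2"
  proof -
    have "m2 + (norm a)\<^sup>2 * m1 * m2 = m2 * (1 + (norm a)\<^sup>2 * m1)" by (simp add: algebra_simps)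
    also have "\<dots> = m2 * (w / v)" by (simp only: one)
    finally show ?thesis unfolding m2_def using v w by (simp add: power2_eq_square)
  qed
  have c3: "(norm a)\<^sup>2 * m2\<^sup>2 + 2 * (r - 1) + (r - 1)\<^sup>2 = - \<alpha>\<^sup>2 / v\<^sup>2"
  proof -
    have "2 * (r - 1) + (r - 1)\<^sup>2 = r\<^sup>2 - 1" by (simp add: power2_eq_square algebra_simps)
    moreover have "r\<^sup>2 = 1 / w\<^sup>2" using r by (simp add: w2 \<alpha>_def)
    moreover have "(norm a)\<^sup>2 * m2\<^sup>2 = (v\<^sup>2 - w\<^sup>2) * \<alpha>\<^sup>2 / (v\<^sup>2 * w\<^sup>2)"
      by (simp add: a2 m2_def power_divide power_mult_distrib)
    moreover have "(v\<^sup>2 - w\<^sup>2) * \<alpha>\<^sup>2 / (v\<^sup>2 * w\<^sup>2) = \<alpha>\<^sup>2 / w\<^sup>2 - \<alpha>\<^sup>2 / v\<^sup>2"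
      using v w by (simp add: field_simps)
    moreover have "1 / w\<^sup>2 - 1 = - \<alpha>\<^sup>2 / w\<^sup>2" 
    proof -
      have "\<alpha>\<^sup>2 = w\<^sup>2 - 1" using w2 by simp
      then show ?thesis using w by (simp only: minus_diff_eq diff_divide_distrib) simp
    qed
    ultimately show ?thesis by simp
  qed
  have root: "mc_root e p r b = b + (a \<bullet> b) *\<^sub>R (m1 *\<^sub>R a + m2 *\<^sub>R e) + (e \<bullet> b) *\<^sub>R ((r - 1) *\<^sub>R e)" for b
    by (simp add: mc_root_def a_def m1_def m2_def v_def w_def \<alpha>_def)
  have "(\<Sum>b\<in>Basis. H (mc_root e p r b) \<bullet> mc_root e p r b)
      = trace_form H + - 1 / v\<^sup>2 * (H a \<bullet> a) + - \<alpha> / v\<^sup>2 * (H a \<bullet> e + H e \<bullet> a) + - \<alpha>\<^sup>2 / v\<^sup>2 * (H e \<bullet> e)"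
    unfolding root trace_rank_two_perturbation[OF H e orth] c1 c2 c3 ..
  also have "\<dots> = trace_form H - (H p \<bullet> p) / v\<^sup>2"
    unfolding Hp by (simp add: field_simps add_divide_distrib)
  finally show ?thesis by (simp add: mc_trace_def v2)
qed

lemma mc_speed_ge_inner:
  assumes "norm e = 1" shows "sqrt (1 + (p \<bullet> e)\<^sup>2) \<le> mc_speed p" "\<bar>p \<bullet> e\<bar> \<le> mc_speed p"
proof -
  have le: "(p \<bullet> e)\<^sup>2 \<le> (norm p)\<^sup>2" using norm_perp_decomp(1)[OF assms, of p] by simp
  then show "sqrt (1 + (p \<bullet> e)\<^sup>2) \<le> mc_speed p" by (simp add: mc_speed_def)
  have "\<bar>p \<bullet> e\<bar> \<le> norm p" using le by (simp add: abs_le_square_iff[symmetric])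
  then show "\<bar>p \<bullet> e\<bar> \<le> mc_speed p" using mc_speed_ge_norm[of p] by simp
qed

lemma norm_perp_le:
  assumes "norm e = 1" shows "norm (perp e p) \<le> norm (p - k *\<^sub>R e)"
proof -
  have "perp e p = perp e (p - k *\<^sub>R e)"
    using assms by (simp add: perp_def inner_diff_left dot_square_norm scaleR_left_diff_distrib)
  moreover have "(norm (perp e (p - k *\<^sub>R e)))\<^sup>2 \<le> (norm (p - k *\<^sub>R e))\<^sup>2"
    using norm_perp_decomp(1)[OF assms, of "p - k *\<^sub>R e"] by simp
  ultimately show ?thesis by (simp add: abs_le_square_iff[symmetric])
qed

lemma perp_diff: "perp e p - perp e q = perp e (p - q)"
  by (simp add: perp_def inner_diff_left scaleR_left_diff_distrib algebra_simps)

text \<open>The components orthogonal to \<open>e\<close> are coupled synchronously up to an error quadratic in the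
  deviation \<open>\<beta>\<close> of the gradients from \<open>k e\<close>; only the \<open>e\<close>-components are reflected.\<close>

lemma mc_root_coupling:
  fixes p q e :: "'a::euclidean_space" and k \<beta> :: real
  assumes e: "norm e = 1" and k: "k \<ge> 1" and \<beta>: "0 \<le> \<beta>" "2 * \<beta> \<le> k"
    and p: "norm (p - k *\<^sub>R e) \<le> \<beta>" and q: "norm (q - k *\<^sub>R e) \<le> \<beta>"
  obtains a b :: "'a \<Rightarrow> 'a" where
    "\<And>H. linear H \<Longrightarrow> (\<Sum>i\<in>Basis. H (a i) \<bullet> a i) = mc_trace p H"
    "\<And>H. linear H \<Longrightarrow> (\<Sum>i\<in>Basis. H (b i) \<bullet> b i) = mc_trace q H"
    "(\<Sum>i\<in>Basis. ((a i - b i) \<bullet> e)\<^sup>2) \<ge> 1 / k\<^sup>2"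
    "\<And>i. i \<in> Basis \<Longrightarrow> \<bar>(a i - b i) \<bullet> e\<bar> \<le> (4 * \<beta> + 4) / k"
    "\<And>i. i \<in> Basis \<Longrightarrow> norm (perp e (a i - b i)) \<le> 200 * \<beta> * norm (p - q) / k\<^sup>2"
proof -
  have ee: "e \<bullet> e = 1" using e by (simp add: dot_square_norm)
  define w :: "'a \<Rightarrow> real" where "w x = sqrt (1 + (x \<bullet> e)\<^sup>2)" for x
  define s where "s x = 1 / ((mc_speed x)\<^sup>2 + mc_speed x * w x)" for x
  define c where "c x = (x \<bullet> e) / (mc_speed x * w x)" for x
  \<comment> \<open>Opposite signs of the root in direction \<open>e\<close> produce the reflection:
    \<open>1 / w p\<close> and \<open>- (1 / w q)\<close> add up to \<open>R\<close> in
    \<open>a i - b i\<close> instead of cancelling.\<close>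
  define a where "a = mc_root e p (1 / w p)"
  define b where "b = mc_root e q (- (1 / w q))"
  have wpos: "w x > 0" "w x \<ge> 1" "w x \<ge> \<bar>x \<bullet> e\<bar>" for x
  proof -
    show "w x > 0" by (simp add: w_def add_pos_nonneg)
    show "w x \<ge> 1" by (simp add: w_def)
    show "w x \<ge> \<bar>x \<bullet> e\<bar>" unfolding w_def by (rule real_le_rsqrt) simp
  qed
  have r: "(1 / w p)\<^sup>2 = 1 / (1 + (p \<bullet> e)\<^sup>2)" "(- (1 / w q))\<^sup>2 = 1 / (1 + (q \<bullet> e)\<^sup>2)"
    by (auto simp: w_def power_divide)
  have a: "a i = i - (s p * (perp e p \<bullet> i)) *\<^sub>R perp e p - (c p * (perp e p \<bullet> i)) *\<^sub>R e + ((e \<bullet> i) * (1 / w p - 1)) *\<^sub>R e" for i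
    by (simp add: a_def mc_root_def s_def c_def w_def algebra_simps)
  have b: "b i = i - (s q * (perp e q \<bullet> i)) *\<^sub>R perp e q - (c q * (perp e q \<bullet> i)) *\<^sub>R e + ((e \<bullet> i) * (- (1 / w q) - 1)) *\<^sub>R e" for i
    by (simp add: b_def mc_root_def s_def c_def w_def algebra_simps)
  define l where "l = c q *\<^sub>R perp e q - c p *\<^sub>R perp e p"
  define R where "R = 1 / w p + 1 / w q"
  have pe: "perp e x \<bullet> e = 0" "e \<bullet> perp e x = 0" for x
    using norm_perp_decomp(2)[OF e, of x] by (simp_all add: inner_commute)
  have ne: "(a i - b i) \<bullet> e = (l + R *\<^sub>R e) \<bullet> i" for i
    by (simp add: a b pe ee l_def R_def inner_add_left inner_diff_left algebra_simps)
  have nperp: "perp e (a i - b i) = (s q * (perp e q \<bullet> i)) *\<^sub>R perp e q - (s p * (perp e p \<bullet> i)) *\<^sub>R perp e p" for i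
    unfolding perp_def[of e "a i - b i"] ne 
    by (simp add: a b l_def R_def inner_add_left inner_diff_left algebra_simps)
  have near: "\<bar>x \<bullet> e - k\<bar> \<le> \<beta>" "norm x \<le> k + \<beta>" "norm (perp e x) \<le> \<beta>" if "norm (x - k *\<^sub>R e) \<le> \<beta>" for x
  proof -
    have "\<bar>(x - k *\<^sub>R e) \<bullet> e\<bar> \<le> \<beta>" using Cauchy_Schwarz_ineq2[of "x - k *\<^sub>R e" e] that e by simp
    then show "\<bar>x \<bullet> e - k\<bar> \<le> \<beta>" by (simp add: inner_diff_left ee)
    show "norm x \<le> k + \<beta>" using norm_triangle_sub[of x "k *\<^sub>R e"] that e k by simp
    show "norm (perp e x) \<le> \<beta>" using norm_perp_le[OF e, of x k] that by simp
  qed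
  have bounds: "w x \<ge> k / 2" "mc_speed x \<ge> k / 2" "w x \<le> 2 * k" "w x \<le> 3 * k" "mc_speed x \<le> 3 * k"
    if "norm (x - k *\<^sub>R e) \<le> \<beta>" for x
  proof -
    note n = near[OF that]
    show 1: "w x \<ge> k / 2" using wpos(3)[of x] n(1) \<beta> by linarith
    show "mc_speed x \<ge> k / 2" using 1 mc_speed_ge_inner(1)[OF e, of x] unfolding w_def by linarith
    have 2: "\<bar>x \<bullet> e\<bar> \<le> 3 / 2 * k" using n(1) \<beta> k by linarith
    show 3: "w x \<le> 2 * k" unfolding w_def
    proof (rule real_le_lsqrt)
      have "(x \<bullet> e)\<^sup>2 \<le> (3 / 2 * k)\<^sup>2" using 2 k by (simp add: abs_le_square_iff[symmetric])
      moreover have "1 \<le> k\<^sup>2" using k by simp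
      ultimately show "1 + (x \<bullet> e)\<^sup>2 \<le> (2 * k)\<^sup>2" by (simp add: power_mult_distrib power2_eq_square)
    qed (use k in simp)
    show "w x \<le> 3 * k" using 3 k by linarith
    show "mc_speed x \<le> 3 * k" using mc_speed_le[of x] n(2) \<beta> k by linarith
  qed
  have spos: "s x > 0" for x unfolding s_def using wpos(1)[of x]
    by (intro divide_pos_pos add_pos_pos mult_pos_pos) (auto simp: add_pos_nonneg)
  have sbound: "s x \<le> 4 / k\<^sup>2" if "norm (x - k *\<^sub>R e) \<le> \<beta>" for x
  proof -
    have "(k / 2)\<^sup>2 \<le> (mc_speed x)\<^sup>2" using bounds(2)[OF that] k by (intro power_mono) auto
    moreover have "0 \<le> mc_speed x * w x" using wpos(1)[of x] less_imp_le[OF mc_speed_pos[of x]] by simp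
    ultimately have *: "(k / 2)\<^sup>2 \<le> (mc_speed x)\<^sup>2 + mc_speed x * w x" by linarith
    have "0 < (k / 2)\<^sup>2" using k by simp
    then have "s x \<le> 1 / (k / 2)\<^sup>2" unfolding s_def using *
      by (intro divide_left_mono * mult_pos_pos) linarith+
    then show ?thesis by (simp add: power_divide)
  qed
  have cbound: "\<bar>c x\<bar> \<le> 2 / k" if "norm (x - k *\<^sub>R e) \<le> \<beta>" for x
  proof -
    have "\<bar>c x\<bar> = \<bar>x \<bullet> e\<bar> / w x * (1 / mc_speed x)"
      unfolding c_def using wpos(1)[of x] less_imp_le[OF mc_speed_pos[of x]] by (simp add: abs_mult)
    also have "\<dots> \<le> 1 * (1 / (k / 2))"
      using wpos[of x] bounds(2)[OF that] k mc_speed_pos[of x]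
      by (intro mult_mono divide_left_mono) (auto simp del: mc_speed_pos)
    finally show ?thesis by simp
  qed
  have rb: "1 / w x \<le> 2 / k" "1 / w x \<ge> 1 / (2 * k)" if "norm (x - k *\<^sub>R e) \<le> \<beta>" for x
  proof -
    have "1 / w x \<le> 1 / (k / 2)" using bounds(1)[OF that] k wpos(1)[of x] by (intro divide_left_mono) auto
    then show "1 / w x \<le> 2 / k" by simp
    show "1 / w x \<ge> 1 / (2 * k)" using bounds(3)[OF that] k wpos(1)[of x] by (intro divide_left_mono) auto
  qed
  have le: "l \<bullet> e = 0" by (simp add: l_def inner_diff_left pe)
  have nl: "norm l \<le> 4 * \<beta> / k"
  proof -
    have "norm l \<le> \<bar>c q\<bar> * norm (perp e q) + \<bar>c p\<bar> * norm (perp e p)"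
      unfolding l_def using norm_triangle_ineq4[of "c q *\<^sub>R perp e q" "c p *\<^sub>R perp e p"] by simp
    also have "\<dots> \<le> 2 / k * \<beta> + 2 / k * \<beta>"
      using cbound[OF p] cbound[OF q] near(3)[OF p] near(3)[OF q] k
      by (intro add_mono mult_mono) auto
    finally show ?thesis by simp
  qed
  have R: "1 / k \<le> R" "R \<le> 4 / k"
  proof -
    have "1 / (2 * k) + 1 / (2 * k) = 1 / k" using k by (simp add: field_simps)
    then show "1 / k \<le> R" using rb[OF p] rb[OF q] unfolding R_def by linarith
    show "R \<le> 4 / k" using rb[OF p] rb[OF q] unfolding R_def by simp
  qed
  show thesis
  proof (rule that[of a b])
    show "(\<Sum>i\<in>Basis. H (a i) \<bullet> a i) = mc_trace p H" if "linear H" for H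
      unfolding a_def using mc_root_trace[OF that e r(1)] .
    show "(\<Sum>i\<in>Basis. H (b i) \<bullet> b i) = mc_trace q H" if "linear H" for H
      unfolding b_def using mc_root_trace[OF that e r(2)] .
    \<comment> \<open>Since \<open>l\<close> is orthogonal to \<open>e\<close>, it can only enlarge
      the sum, and \<open>R\<close> alone gives the lower bound.\<close>
    have "(\<Sum>i\<in>Basis. ((a i - b i) \<bullet> e)\<^sup>2) = (norm (l + R *\<^sub>R e))\<^sup>2"
      unfolding ne power2_norm_eq_inner using sum_Basis_inner_mult[of "l + R *\<^sub>R e" "l + R *\<^sub>R e"]
      by (simp add: power2_eq_square)
    also have "\<dots> = (norm l)\<^sup>2 + R\<^sup>2"
      unfolding power2_norm_eq_inner 
      by (simp add: inner_add_left inner_add_right le ee inner_commute[of e l] power2_eq_square)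
    finally have "(\<Sum>i\<in>Basis. ((a i - b i) \<bullet> e)\<^sup>2) \<ge> R\<^sup>2" by simp
    moreover have "R\<^sup>2 \<ge> (1 / k)\<^sup>2" using R k by (intro power_mono) auto
    ultimately show "(\<Sum>i\<in>Basis. ((a i - b i) \<bullet> e)\<^sup>2) \<ge> 1 / k\<^sup>2" by (simp add: power_divide)
    fix i :: 'a assume i: "i \<in> Basis"
    have "\<bar>(a i - b i) \<bullet> e\<bar> \<le> norm (l + R *\<^sub>R e)"
      unfolding ne using Cauchy_Schwarz_ineq2[of "l + R *\<^sub>R e" i] i by simp
    also have "\<dots> \<le> norm l + R" using norm_triangle_ineq[of l "R *\<^sub>R e"] e R k by (simp add: order_trans)
    also have "\<dots> \<le> (4 * \<beta> + 4) / k" using nl R by (simp add: add_divide_distrib)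
    finally show "\<bar>(a i - b i) \<bullet> e\<bar> \<le> (4 * \<beta> + 4) / k" .
    define P Q where "P = perp e p" and "Q = perp e q"
    have PQ: "norm P \<le> \<beta>" "norm Q \<le> \<beta>" "norm (Q - P) \<le> norm (p - q)"
      using near(3)[OF p] near(3)[OF q] norm_perp_le[OF e, of "q - p" 0]
      by (auto simp: P_def Q_def perp_diff norm_minus_commute)
    have Pi: "\<bar>P \<bullet> i\<bar> \<le> \<beta>" "\<bar>Q \<bullet> i\<bar> \<le> \<beta>" "\<bar>(Q - P) \<bullet> i\<bar> \<le> norm (p - q)"
      using Cauchy_Schwarz_ineq2[of P i] Cauchy_Schwarz_ineq2[of Q i] Cauchy_Schwarz_ineq2[of "Q - P" i] PQ i by auto
    \<comment> \<open>The difference of reciprocals is \<open>(Dp - Dq) s p s q\<close>. The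
      denominators differ by at most \<open>12 k |p - q|\<close> and \<open>s\<close> is at most
      \<open>4 / k^2\<close>, which gives 192 = 12 * 4 * 4.\<close>
    have sd: "\<bar>s q - s p\<bar> \<le> 192 * norm (p - q) / k ^ 3"
    proof -
      define Dp Dq where "Dp = (mc_speed p)\<^sup>2 + mc_speed p * w p" and "Dq = (mc_speed q)\<^sup>2 + mc_speed q * w q"
      have D: "Dp > 0" "Dq > 0" using spos[of p] spos[of q]
        unfolding Dp_def Dq_def s_def by (simp_all only: zero_less_divide_1_iff)
      have vd: "\<bar>mc_speed p - mc_speed q\<bar> \<le> norm (p - q)" by (rule mc_speed_diff)
      have wd: "\<bar>w p - w q\<bar> \<le> norm (p - q)"
      proof -
        have "\<bar>w p - w q\<bar> \<le> \<bar>p \<bullet> e - q \<bullet> e\<bar>" unfolding w_def by (rule sqrt_1_plus_sq_diff)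
        also have "\<dots> = \<bar>(p - q) \<bullet> e\<bar>" by (simp add: inner_diff_left)
        also have "\<dots> \<le> norm (p - q)" using Cauchy_Schwarz_ineq2[of "p - q" e] e by simp
        finally show ?thesis .
      qed
      have "Dp - Dq = (mc_speed p - mc_speed q) * (mc_speed p + mc_speed q + w p) + (w p - w q) * mc_speed q"
        unfolding Dp_def Dq_def by (simp add: power2_eq_square algebra_simps del: mc_speed_sq)
      then have "\<bar>Dp - Dq\<bar> \<le> \<bar>mc_speed p - mc_speed q\<bar> * (mc_speed p + mc_speed q + w p) + \<bar>w p - w q\<bar> * mc_speed q"
        using abs_triangle_ineq[of "(mc_speed p - mc_speed q) * (mc_speed p + mc_speed q + w p)" "(w p - w q) * mc_speed q"]
          less_imp_le[OF mc_speed_pos[of p]] less_imp_le[OF mc_speed_pos[of q]] wpos(1)[of p]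
        by (simp add: abs_mult)
      also have "\<dots> \<le> norm (p - q) * (9 * k) + norm (p - q) * (3 * k)"
        using vd wd bounds(4,5)[OF p] bounds(5)[OF q] less_imp_le[OF mc_speed_pos[of p]] less_imp_le[OF mc_speed_pos[of q]] wpos(1)[of p]
        by (intro add_mono mult_mono) auto
      finally have DD: "\<bar>Dp - Dq\<bar> \<le> 12 * k * norm (p - q)" by (simp add: algebra_simps)
      have "s q - s p = (Dp - Dq) * (s p * s q)"
        unfolding s_def Dp_def[symmetric] Dq_def[symmetric] using D by (simp add: field_simps)
      then have "\<bar>s q - s p\<bar> = \<bar>Dp - Dq\<bar> * (s p * s q)" using spos[of p] spos[of q] by (simp add: abs_mult)
      also have "\<dots> \<le> (12 * k * norm (p - q)) * (4 / k\<^sup>2 * (4 / k\<^sup>2))"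
        using DD sbound[OF p] sbound[OF q] spos[of p] spos[of q] k by (intro mult_mono) (auto intro: less_imp_le)
      also have "\<dots> = 192 * norm (p - q) / k ^ 3" using k by (simp add: field_simps power2_eq_square power3_eq_cube)
      finally show ?thesis .
    qed
    \<comment> \<open>Telescoping, so that each summand contains a difference between
      \<open>p\<close> and \<open>q\<close>. The three bounds 4, 4 and 192 add up to 200.\<close>
    have "perp e (a i - b i) = (s q * (Q \<bullet> i)) *\<^sub>R (Q - P) + (s q * ((Q - P) \<bullet> i)) *\<^sub>R P + ((s q - s p) * (P \<bullet> i)) *\<^sub>R P"
      unfolding nperp P_def[symmetric] Q_def[symmetric] by (simp add: inner_diff_left algebra_simps)
    then have "norm (perp e (a i - b i)) \<le> s q * \<bar>Q \<bullet> i\<bar> * norm (Q - P) + s q * \<bar>(Q - P) \<bullet> i\<bar> * norm P + \<bar>s q - s p\<bar> * \<bar>P \<bullet> i\<bar> * norm P"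
      using norm_triangle_ineq[of "(s q * (Q \<bullet> i)) *\<^sub>R (Q - P) + (s q * ((Q - P) \<bullet> i)) *\<^sub>R P" "((s q - s p) * (P \<bullet> i)) *\<^sub>R P"]
        norm_triangle_ineq[of "(s q * (Q \<bullet> i)) *\<^sub>R (Q - P)" "(s q * ((Q - P) \<bullet> i)) *\<^sub>R P"] spos[of q]
      by (simp add: abs_mult)
    also have "\<dots> \<le> 4 / k\<^sup>2 * \<beta> * norm (p - q) + 4 / k\<^sup>2 * norm (p - q) * \<beta> + (192 * norm (p - q) / k ^ 3) * \<beta> * \<beta>"
      using sbound[OF q] spos[of q] Pi PQ sd \<beta> by (intro add_mono mult_mono) (auto intro!: mult_nonneg_nonneg less_imp_le[OF spos])
    also have "(192 * norm (p - q) / k ^ 3) * \<beta> * \<beta> \<le> 192 * \<beta> * norm (p - q) / k\<^sup>2"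
    proof -
      have "(192 * norm (p - q) / k ^ 3) * \<beta> * \<beta> = (192 * \<beta> * norm (p - q) / k\<^sup>2) * (\<beta> / k)"
        using k by (simp add: field_simps power2_eq_square power3_eq_cube)
      also have "\<dots> \<le> (192 * \<beta> * norm (p - q) / k\<^sup>2) * 1"
        using \<beta> k by (intro mult_left_mono) auto
      finally show ?thesis by simp
    qed
    also have "4 / k\<^sup>2 * \<beta> * norm (p - q) + 4 / k\<^sup>2 * norm (p - q) * \<beta> + 192 * \<beta> * norm (p - q) / k\<^sup>2 = 200 * \<beta> * norm (p - q) / k\<^sup>2"
      by (simp add: field_simps)
    finally show "norm (perp e (a i - b i)) \<le> 200 * \<beta> * norm (p - q) / k\<^sup>2" by simp
  qed
qed

section \<open>Conditions at a maximum\<close>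

text \<open>\<open>f'\<close> is assumed differentiable only at 0, so the argument avoids Taylor
  expansion: if \<open>D > 0\<close>, then \<open>f'\<close> is positive just to the right of 0 and
  the mean value theorem makes \<open>f\<close> exceed its maximum there.\<close>

lemma second_derivative_at_max:
  fixes f f' :: "real \<Rightarrow> real"
  assumes d: "d > 0" and f: "\<And>t. \<bar>t\<bar> < d \<Longrightarrow> (f has_real_derivative f' t) (at t)"
    and f': "(f' has_real_derivative D) (at 0)" and max: "\<And>t. \<bar>t\<bar> < d \<Longrightarrow> f t \<le> f 0"
  shows "f' 0 = 0" "D \<le> 0"
proof -
  show z: "f' 0 = 0" using DERIV_local_max[OF f[of 0] d] max d by auto
  show "D \<le> 0"
  proof (rule ccontr)
    assume "\<not> D \<le> 0"
    then obtain d' where d': "d' > 0" "\<And>h. 0 < h \<Longrightarrow> h < d' \<Longrightarrow> f' 0 < f' (0 + h)"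
      using DERIV_pos_inc_right[OF f'] by auto
    define h where "h = min d d' / 2"
    have h: "0 < h" "h < d" "h < d'" using d d' by (auto simp: h_def)
    obtain x where x: "0 < x" "x < h" "f h - f 0 = (h - 0) * f' x"
      using MVT2[of 0 h f f'] f h by force
    have "f' x > 0" using d'(2)[of x] x h z by auto
    then have "f h > f 0" using x h by (smt (verit) mult_pos_pos)
    then show False using max[of h] h by auto
  qed
qed

text \<open>A pointwise notion: the gradient \<open>g\<close> exists in a neighbourhood, but only
  its derivative at \<open>x\<close> is required. This is exactly what the second derivative test
  along lines consumes, and it passes to composite functions without any discussion of continuity of
  second derivatives.\<close>

definition twice_diff_at ::
    "('a::euclidean_space \<Rightarrow> real) \<Rightarrow> ('a \<Rightarrow> 'a) \<Rightarrow> ('a \<Rightarrow> 'a) \<Rightarrow> 'a \<Rightarrow> bool" where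
  "twice_diff_at u g H x \<longleftrightarrow>
     (\<exists>d>0. \<forall>y\<in>ball x d. (u has_derivative (\<lambda>h. g y \<bullet> h)) (at y)) \<and> (g has_derivative H) (at x)"

lemma has_derivative_line:
  assumes "(u has_derivative (\<lambda>h. g \<bullet> h)) (at (x + t *\<^sub>R a))"
  shows "((\<lambda>t. u (x + t *\<^sub>R a)) has_real_derivative g \<bullet> a) (at t)"
proof -
  have 1: "((\<lambda>t. x + t *\<^sub>R a) has_derivative (\<lambda>h. h *\<^sub>R a)) (at t)"
    by (auto intro!: derivative_eq_intros)
  have "((\<lambda>t. u (x + t *\<^sub>R a)) has_derivative (\<lambda>h. g \<bullet> (h *\<^sub>R a))) (at t)"
    using has_derivative_compose[OF 1 assms] .
  moreover have "(\<lambda>h. g \<bullet> (h *\<^sub>R a)) = (*) (g \<bullet> a)" by (auto simp: mult.commute)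
  ultimately show ?thesis by (simp only: has_field_derivative_def)
qed

lemma twice_diff_at_line:
  assumes "twice_diff_at u g H x"
  obtains d where "d > 0"
    "\<And>t. \<bar>t\<bar> < d \<Longrightarrow> ((\<lambda>t. u (x + t *\<^sub>R a)) has_real_derivative g (x + t *\<^sub>R a) \<bullet> a) (at t)"
    "((\<lambda>t. g (x + t *\<^sub>R a) \<bullet> c) has_real_derivative H a \<bullet> c) (at 0)"
proof -
  obtain d where d: "d > 0" "\<And>y. y \<in> ball x d \<Longrightarrow> (u has_derivative (\<lambda>h. g y \<bullet> h)) (at y)"
    and g: "(g has_derivative H) (at x)"
    using assms by (auto simp: twice_diff_at_def)
  define d' where "d' = d / (norm a + 1)"
  have na: "norm a + 1 > 0" by (simp add: add_nonneg_pos)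
  have "d' > 0" using d na by (simp add: d'_def)
  moreover have "((\<lambda>t. u (x + t *\<^sub>R a)) has_real_derivative g (x + t *\<^sub>R a) \<bullet> a) (at t)" if "\<bar>t\<bar> < d'" for t
  proof (rule has_derivative_line, rule d)
    have "\<bar>t\<bar> * norm a \<le> \<bar>t\<bar> * (norm a + 1)" by (intro mult_left_mono) auto
    also have "\<dots> < d" using that na by (simp add: d'_def field_simps)
    finally show "x + t *\<^sub>R a \<in> ball x d" by (simp add: dist_norm)
  qed
  moreover have "((\<lambda>t. g (x + t *\<^sub>R a) \<bullet> c) has_real_derivative H a \<bullet> c) (at 0)"
  proof -
    have 1: "((\<lambda>t. x + t *\<^sub>R a) has_derivative (\<lambda>h. h *\<^sub>R a)) (at 0)"
      by (auto intro!: derivative_eq_intros)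
    have "((\<lambda>t. g (x + t *\<^sub>R a)) has_derivative (\<lambda>h. H (h *\<^sub>R a))) (at 0)"
      using has_derivative_compose[OF 1, of g H] g by simp
    then have "((\<lambda>t. g (x + t *\<^sub>R a) \<bullet> c) has_derivative (\<lambda>h. H (h *\<^sub>R a) \<bullet> c)) (at 0)"
      by (rule has_derivative_inner_left)
    moreover have "H (h *\<^sub>R a) \<bullet> c = H a \<bullet> c * h" for h
      using has_derivative_linear[OF g] by (simp add: linear_cmul)
    ultimately show ?thesis by (simp add: has_field_derivative_def)
  qed
  ultimately show thesis by (rule that)
qed

text \<open>The distance is linear along its own direction, so only the part of \<open>n\<close>
  orthogonal to \<open>e\<close> bends it, with curvature \<open>1 / s\<close>.\<close>

lemma norm_line_derivative:
  fixes w n :: "'a::euclidean_space"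
  assumes w: "w \<noteq> 0"
  defines "s \<equiv> norm w"
  defines "e \<equiv> w /\<^sub>R s"
  obtains d where "d > 0"
    "\<And>t. \<bar>t\<bar> < d \<Longrightarrow> norm (w + t *\<^sub>R n) > 0"
    "\<And>t. \<bar>t\<bar> < d \<Longrightarrow> ((\<lambda>t. norm (w + t *\<^sub>R n)) has_real_derivative ((w + t *\<^sub>R n) \<bullet> n / norm (w + t *\<^sub>R n))) (at t)"
    "((\<lambda>t. (w + t *\<^sub>R n) \<bullet> n / norm (w + t *\<^sub>R n)) has_real_derivative ((norm (perp e n))\<^sup>2 / s)) (at 0)"
proof -
  define N where "N t = norm (w + t *\<^sub>R n)" for t
  define d where "d = s / (norm n + 1)"
  have s: "s > 0" using w by (simp add: s_def)
  have nn: "norm n + 1 > 0" by (simp add: add_nonneg_pos)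
  have d: "d > 0" using s nn by (simp add: d_def)
  have pos: "N t > 0" if "\<bar>t\<bar> < d" for t
  proof -
    have "\<bar>t\<bar> * norm n \<le> \<bar>t\<bar> * (norm n + 1)" by (intro mult_left_mono) auto
    also have "\<dots> < s" using that nn by (simp add: d_def field_simps)
    finally have "norm (t *\<^sub>R n) < norm w" by (simp add: s_def)
    then have "w + t *\<^sub>R n \<noteq> 0" by (metis add_eq_0_iff norm_minus_cancel order_less_irrefl)
    then show ?thesis by (simp add: N_def)
  qed
  have Neq: "N = (\<lambda>t. sqrt (w \<bullet> w + 2 * t * (w \<bullet> n) + t\<^sup>2 * (n \<bullet> n)))"
    unfolding N_def norm_eq_sqrt_inner
    by (simp add: inner_add_left inner_add_right inner_commute power2_eq_square algebra_simps)
  have inn: "(w + t *\<^sub>R n) \<bullet> n = w \<bullet> n + t * (n \<bullet> n)" for t by (simp add: inner_add_left)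
  have D1: "(N has_real_derivative (w \<bullet> n + t * (n \<bullet> n)) / N t) (at t)" if "\<bar>t\<bar> < d" for t
  proof -
    have p: "w \<bullet> w + 2 * t * (w \<bullet> n) + t\<^sup>2 * (n \<bullet> n) > 0"
      using pos[OF that] unfolding Neq by simp
    show ?thesis unfolding Neq
      using p by (auto intro!: derivative_eq_intros simp: field_simps)
  qed
  have N0: "N 0 = s" by (simp add: N_def s_def)
  have ee: "norm e = 1" using s by (simp add: e_def s_def)
  have "((\<lambda>t. (w \<bullet> n + t * (n \<bullet> n)) / N t) has_real_derivative
      ((n \<bullet> n) * s - (w \<bullet> n) * ((w \<bullet> n) / s)) / (s * s)) (at 0)"
    using D1[of 0] d s N0 by (auto intro!: derivative_eq_intros)
  moreover have "((n \<bullet> n) * s - (w \<bullet> n) * ((w \<bullet> n) / s)) / (s * s) = (norm (perp e n))\<^sup>2 / s"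
  proof -
    have "w \<bullet> n = s * (n \<bullet> e)" using s by (simp add: e_def inner_commute)
    moreover have "(norm (perp e n))\<^sup>2 = n \<bullet> n - (n \<bullet> e)\<^sup>2"
      using norm_perp_decomp(1)[OF ee, of n] by (simp add: power2_norm_eq_inner)
    moreover have "(X * s - s * Y * (s * Y / s)) / (s * s) = (X - Y\<^sup>2) / s" for X Y
      using s by (simp add: field_simps power2_eq_square)
    ultimately show ?thesis by simp
  qed
  ultimately show thesis
    using that[OF d] pos D1 unfolding N_def inn by simp
qed

text \<open>The maximum is tested along the line on which \<open>x\<close> moves with velocity
  \<open>a\<close> and \<open>y\<close> with velocity \<open>b\<close>. Keeping the two velocities
  independent is the point: the second order inequality is later summed over the images of the basis
  under two different matrix roots, and the profile sees only \<open>a - b\<close>.\<close>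

lemma doubling_first_second_order:
  fixes x y :: "'a::euclidean_space" and A A' :: "real \<Rightarrow> real"
  assumes P: "twice_diff_at P gP HP x" and V: "twice_diff_at V gV HV y"
    and Ex: "twice_diff_at E gE KX x" and Ey: "twice_diff_at F gF KY y"
    and xy: "x \<noteq> y"
    and A: "\<And>r. r > 0 \<Longrightarrow> (A has_real_derivative A' r) (at r)"
    and A': "(A' has_real_derivative A2) (at (norm (x - y)))"
    and max: "\<exists>d>0. \<forall>x'\<in>ball x d. \<forall>y'\<in>ball y d. P x' - V y' - A (norm (x' - y')) * (E x' + F y')
        \<le> P x - V y - A (norm (x - y)) * (E x + F y)"
  defines "s \<equiv> norm (x - y)"
  defines "e \<equiv> (x - y) /\<^sub>R s"
  shows "gP x = (A' s * (E x + F y)) *\<^sub>R e + A s *\<^sub>R gE x"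
    and "gV y = (A' s * (E x + F y)) *\<^sub>R e - A s *\<^sub>R gF y"
    and "HP a \<bullet> a - HV b \<bullet> b \<le> (E x + F y) * (A2 * ((a - b) \<bullet> e)\<^sup>2 + A' s / s * (norm (perp e (a - b)))\<^sup>2)
       + 2 * A' s * ((a - b) \<bullet> e) * (gE x \<bullet> a + gF y \<bullet> b) + A s * (KX a \<bullet> a + KY b \<bullet> b)"
proof -
  have w: "x - y \<noteq> 0" using xy by simp
  have s: "s > 0" using w by (simp add: s_def)
  have main: "gP x \<bullet> a - gV y \<bullet> b - (A' s * ((a - b) \<bullet> e) * (E x + F y) + A s * (gE x \<bullet> a + gF y \<bullet> b)) = 0 \<and>
     HP a \<bullet> a - HV b \<bullet> b - ((E x + F y) * (A2 * ((a - b) \<bullet> e)\<^sup>2 + A' s / s * (norm (perp e (a - b)))\<^sup>2)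
       + 2 * A' s * ((a - b) \<bullet> e) * (gE x \<bullet> a + gF y \<bullet> b) + A s * (KX a \<bullet> a + KY b \<bullet> b)) \<le> 0" for a b
  proof -
    obtain d1 where d1: "d1 > 0"
      "\<And>t. \<bar>t\<bar> < d1 \<Longrightarrow> ((\<lambda>t. P (x + t *\<^sub>R a)) has_real_derivative gP (x + t *\<^sub>R a) \<bullet> a) (at t)"
      "((\<lambda>t. gP (x + t *\<^sub>R a) \<bullet> a) has_real_derivative HP a \<bullet> a) (at 0)"
      using twice_diff_at_line[OF P] by blast
    obtain d2 where d2: "d2 > 0"
      "\<And>t. \<bar>t\<bar> < d2 \<Longrightarrow> ((\<lambda>t. V (y + t *\<^sub>R b)) has_real_derivative gV (y + t *\<^sub>R b) \<bullet> b) (at t)"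
      "((\<lambda>t. gV (y + t *\<^sub>R b) \<bullet> b) has_real_derivative HV b \<bullet> b) (at 0)"
      using twice_diff_at_line[OF V] by blast
    obtain d3 where d3: "d3 > 0"
      "\<And>t. \<bar>t\<bar> < d3 \<Longrightarrow> ((\<lambda>t. E (x + t *\<^sub>R a)) has_real_derivative gE (x + t *\<^sub>R a) \<bullet> a) (at t)"
      "((\<lambda>t. gE (x + t *\<^sub>R a) \<bullet> a) has_real_derivative KX a \<bullet> a) (at 0)"
      using twice_diff_at_line[OF Ex] by blast
    obtain d4 where d4: "d4 > 0"
      "\<And>t. \<bar>t\<bar> < d4 \<Longrightarrow> ((\<lambda>t. F (y + t *\<^sub>R b)) has_real_derivative gF (y + t *\<^sub>R b) \<bullet> b) (at t)"
      "((\<lambda>t. gF (y + t *\<^sub>R b) \<bullet> b) has_real_derivative KY b \<bullet> b) (at 0)"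
      using twice_diff_at_line[OF Ey] by blast
    define n where "n = a - b"
    define N where "N t = norm (x - y + t *\<^sub>R n)" for t
    define N' where "N' t = (x - y + t *\<^sub>R n) \<bullet> n / norm (x - y + t *\<^sub>R n)" for t
    obtain d5 where d5: "d5 > 0" "\<And>t. \<bar>t\<bar> < d5 \<Longrightarrow> N t > 0"
      "\<And>t. \<bar>t\<bar> < d5 \<Longrightarrow> (N has_real_derivative N' t) (at t)"
      "(N' has_real_derivative (norm (perp e n))\<^sup>2 / s) (at 0)"
      using norm_line_derivative[OF w, of n] unfolding N_def N'_def e_def s_def by blast
    obtain d6 where d6: "d6 > 0" "\<And>x' y'. x' \<in> ball x d6 \<Longrightarrow> y' \<in> ball y d6 \<Longrightarrow>
        P x' - V y' - A (norm (x' - y')) * (E x' + F y') \<le> P x - V y - A (norm (x - y)) * (E x + F y)"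
      using max by blast
    define d7 where "d7 = d6 / (norm a + norm b + 1)"
    have ab: "norm a + norm b + 1 > 0" by (simp add: add_nonneg_pos)
    have d7: "d7 > 0" using d6 ab by (simp add: d7_def)
    define d where "d = Min {d1,d2,d3,d4,d5,d7}"
    have d: "d > 0" "d \<le> d1" "d \<le> d2" "d \<le> d3" "d \<le> d4" "d \<le> d5" "d \<le> d7"
      using d1 d2 d3 d4 d5 d7 by (auto simp: d_def)
    define f where "f t = P (x + t *\<^sub>R a) - V (y + t *\<^sub>R b) - A (N t) * (E (x + t *\<^sub>R a) + F (y + t *\<^sub>R b))" for t
    define f' where "f' t = gP (x + t *\<^sub>R a) \<bullet> a - gV (y + t *\<^sub>R b) \<bullet> b
       - (A' (N t) * N' t * (E (x + t *\<^sub>R a) + F (y + t *\<^sub>R b)) + (gE (x + t *\<^sub>R a) \<bullet> a + gF (y + t *\<^sub>R b) \<bullet> b) * A (N t))" for t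
    have N0: "N 0 = s" by (simp add: N_def s_def)
    have N'0: "N' 0 = n \<bullet> e" by (simp add: N'_def e_def s_def inner_commute divide_inverse mult.commute)
    define D where "D = HP a \<bullet> a - HV b \<bullet> b - ((E x + F y) * (A2 * (n \<bullet> e)\<^sup>2 + A' s / s * (norm (perp e n))\<^sup>2)
       + 2 * A' s * (n \<bullet> e) * (gE x \<bullet> a + gF y \<bullet> b) + A s * (KX a \<bullet> a + KY b \<bullet> b))"
    have AN: "((\<lambda>t. A (N t)) has_real_derivative A' (N t) * N' t) (at t)" if "\<bar>t\<bar> < d" for t
      using DERIV_chain2[OF A d5(3)] d5(2) that d by auto
    have A'N: "((\<lambda>t. A' (N t)) has_real_derivative A2 * N' 0) (at 0)"
      using DERIV_chain2[of A' A2 "N" 0 "N' 0"] A' d5(1) d5(3)[of 0] N0 unfolding s_def by auto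
    have h: "(f has_real_derivative f' t) (at t)" "f t \<le> f 0" if t: "\<bar>t\<bar> < d" for t
    proof -
      have t': "\<bar>t\<bar> < d1" "\<bar>t\<bar> < d2" "\<bar>t\<bar> < d3" "\<bar>t\<bar> < d4" "\<bar>t\<bar> < d5" using t d by auto
      show "(f has_real_derivative f' t) (at t)" unfolding f_def f'_def
        by (intro DERIV_diff DERIV_mult DERIV_add d1(2) d2(2) d3(2) d4(2) AN t' t)
      have td: "\<bar>t\<bar> * (norm a + norm b + 1) < d6"
      proof -
        have "\<bar>t\<bar> < d6 / (norm a + norm b + 1)" using t d unfolding d7_def by simp
        then show ?thesis using ab by (simp add: pos_less_divide_eq)
      qed
      have "\<bar>t\<bar> * norm a \<le> \<bar>t\<bar> * (norm a + norm b + 1)" "\<bar>t\<bar> * norm b \<le> \<bar>t\<bar> * (norm a + norm b + 1)"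
        by (intro mult_left_mono; simp)+
      then have "x + t *\<^sub>R a \<in> ball x d6" "y + t *\<^sub>R b \<in> ball y d6" using td by (auto simp: dist_norm)
      from d6(2)[OF this] show "f t \<le> f 0"
        unfolding f_def N_def n_def by (simp add: algebra_simps)
    qed
    have h': "(f' has_real_derivative D) (at 0)"
    proof -
      have *: "(f' has_real_derivative (HP a \<bullet> a - HV b \<bullet> b
          - ((A2 * N' 0 * N' 0 + (norm (perp e n))\<^sup>2 / s * A' (N 0)) * (E (x + 0 *\<^sub>R a) + F (y + 0 *\<^sub>R b))
               + (gE (x + 0 *\<^sub>R a) \<bullet> a + gF (y + 0 *\<^sub>R b) \<bullet> b) * (A' (N 0) * N' 0)
             + ((KX a \<bullet> a + KY b \<bullet> b) * A (N 0) + A' (N 0) * N' 0 * (gE (x + 0 *\<^sub>R a) \<bullet> a + gF (y + 0 *\<^sub>R b) \<bullet> b))))) (at 0)"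
        unfolding f'_def
        by (intro DERIV_diff DERIV_mult DERIV_add d1(3) d2(3) d3(3) d4(3) d3(2) d4(2) d5(4) A'N AN) (use d in auto)
      have "(HP a \<bullet> a - HV b \<bullet> b
          - ((A2 * N' 0 * N' 0 + (norm (perp e n))\<^sup>2 / s * A' (N 0)) * (E (x + 0 *\<^sub>R a) + F (y + 0 *\<^sub>R b))
               + (gE (x + 0 *\<^sub>R a) \<bullet> a + gF (y + 0 *\<^sub>R b) \<bullet> b) * (A' (N 0) * N' 0)
             + ((KX a \<bullet> a + KY b \<bullet> b) * A (N 0) + A' (N 0) * N' 0 * (gE (x + 0 *\<^sub>R a) \<bullet> a + gF (y + 0 *\<^sub>R b) \<bullet> b)))) = D"
        unfolding D_def N0 N'0 by (simp add: algebra_simps power2_eq_square)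
      with * show ?thesis by auto
    qed
    have "f' 0 = 0" "D \<le> 0" using second_derivative_at_max[OF d(1) h(1) h' h(2)] by auto
    then show ?thesis unfolding f'_def D_def N0 N'0 n_def by (simp add: algebra_simps)
  qed
  show "HP a \<bullet> a - HV b \<bullet> b \<le> (E x + F y) * (A2 * ((a - b) \<bullet> e)\<^sup>2 + A' s / s * (norm (perp e (a - b)))\<^sup>2)
       + 2 * A' s * ((a - b) \<bullet> e) * (gE x \<bullet> a + gF y \<bullet> b) + A s * (KX a \<bullet> a + KY b \<bullet> b)"
    using conjunct2[OF main[of a b]] by linarith
  \<comment> \<open>Moving one of the two points alone separates the two gradient
    identities.\<close>
  show "gP x = (A' s * (E x + F y)) *\<^sub>R e + A s *\<^sub>R gE x"
  proof (rule vector_eq_rdot[THEN iffD1], rule allI)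
    fix a show "gP x \<bullet> a = ((A' s * (E x + F y)) *\<^sub>R e + A s *\<^sub>R gE x) \<bullet> a"
      using conjunct1[OF main[of a 0]] by (simp add: inner_add_left inner_commute[of a e] algebra_simps)
  qed
  show "gV y = (A' s * (E x + F y)) *\<^sub>R e - A s *\<^sub>R gF y"
  proof (rule vector_eq_rdot[THEN iffD1], rule allI)
    fix b show "gV y \<bullet> b = ((A' s * (E x + F y)) *\<^sub>R e - A s *\<^sub>R gF y) \<bullet> b"
      using conjunct1[OF main[of 0 b]] by (simp add: inner_add_left inner_diff_left inner_commute[of b e] algebra_simps)
  qed
qed

text \<open>The hypotheses are what the first and second order conditions at a maximum of the doubled
  function yield; the conclusion bounds the concavity constant \<open>C\<close> of the profile.\<close>

lemma concavity_bound:
  fixes p q e Ex Ey :: "'a::euclidean_space" and X Y KX KY :: "'a \<Rightarrow> 'a"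
    and \<theta> \<eta> C A A1 s a0 ME \<beta> c1 f1 f2 L \<Lambda> :: real
  assumes e: "norm e = 1" and lin: "linear X" "linear Y"
    and sec: "\<And>a b. \<theta> * (X a \<bullet> a) - 2 * (p \<bullet> a)\<^sup>2 - 2 * (norm a)\<^sup>2 - Y b \<bullet> b
        \<le> \<eta> * (- C * A1\<^sup>2 * ((a - b) \<bullet> e)\<^sup>2 + A1 / s * (norm (perp e (a - b)))\<^sup>2)
           + 2 * A1 * ((a - b) \<bullet> e) * (Ex \<bullet> a + Ey \<bullet> b) + A * (KX a \<bullet> a + KY b \<bullet> b)"
    and \<eta>: "1 \<le> \<eta>" "\<eta> \<le> 3" and A1: "A1 \<ge> 1" and s: "0 < s" "s \<le> 1" "A1 * s \<le> 1"
    and A: "0 < A" "A \<le> a0" and C: "C \<ge> 1"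
    and E: "norm Ex \<le> ME" "norm Ey \<le> ME" "\<And>a. \<bar>KX a \<bullet> a\<bar> \<le> ME * (norm a)\<^sup>2" "\<And>a. \<bar>KY a \<bullet> a\<bar> \<le> ME * (norm a)\<^sup>2"
    and \<beta>: "0 \<le> \<beta>" "2 * \<beta> \<le> A1"
    and p: "norm (p - (A1 * \<eta>) *\<^sub>R e) \<le> \<beta>" and q: "norm (q - (A1 * \<eta>) *\<^sub>R e) \<le> \<beta>"
    and pq: "norm (p - q) \<le> c1 * A" and c1: "c1 \<ge> 0"
    and f: "\<bar>f1\<bar> \<le> L" "\<bar>f2\<bar> \<le> L" "f1 - f2 \<ge> - \<Lambda> * s" and \<theta>: "\<bar>\<theta> - 1\<bar> \<le> 2 * \<Lambda> * s" and \<Lambda>: "\<Lambda> \<ge> 0"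
    and eqs: "mc_trace p X = f1 * mc_speed p" "mc_trace q Y = f2 * mc_speed q"
    and As: "A \<le> (1 + C * a0) * (s * A1)"
    and A1big: "120000 * real DIM('a) * \<beta>\<^sup>2 * c1\<^sup>2 * a0 * (1 + C * a0) \<le> A1\<^sup>2"
  shows "C \<le> 3 * ((\<Lambda> + 2 * \<Lambda> * L) * (4 + \<beta>) + L * c1 * a0 + 3 + 2 * real DIM('a)
      + 4 * real DIM('a) * real DIM('a) * (4 * \<beta> + 4) * ME + 2 * a0 * ME * DIM('a))"
proof -
  define k where "k = A1 * \<eta>"
  define n where "n = real DIM('a)"
  have n1: "n \<ge> 1" using DIM_positive[where 'a='a] by (simp add: n_def Suc_le_eq)
  have kA: "k \<ge> A1" using \<eta> A1 by (simp add: k_def)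
  have k3: "k \<le> 3 * A1" using \<eta> A1 by (simp add: k_def)
  have k1: "k \<ge> 1" and k2: "2 * \<beta> \<le> k" using kA A1 \<beta> by auto
  \<comment> \<open>The inequality \<open>sec\<close> is quadratic in the pair of velocities; summed
    over the coupled pairs it produces \<open>mc_trace\<close> at \<open>p\<close> and at
    \<open>q\<close>, where the equations can be inserted.\<close>
  obtain a b :: "'a \<Rightarrow> 'a" where
    ta: "\<And>H. linear H \<Longrightarrow> (\<Sum>i\<in>Basis. H (a i) \<bullet> a i) = mc_trace p H" and
    tb: "\<And>H. linear H \<Longrightarrow> (\<Sum>i\<in>Basis. H (b i) \<bullet> b i) = mc_trace q H" and
    ne: "(\<Sum>i\<in>Basis. ((a i - b i) \<bullet> e)\<^sup>2) \<ge> 1 / k\<^sup>2" and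
    ne_le: "\<And>i. i \<in> Basis \<Longrightarrow> \<bar>(a i - b i) \<bullet> e\<bar> \<le> (4 * \<beta> + 4) / k" and
    np: "\<And>i. i \<in> Basis \<Longrightarrow> norm (perp e (a i - b i)) \<le> 200 * \<beta> * norm (p - q) / k\<^sup>2"
    using mc_root_coupling[OF e k1 \<beta>(1) k2 p[folded k_def] q[folded k_def]] by blast
  have sumsq: "(\<Sum>i\<in>Basis. (norm (c i))\<^sup>2) \<le> n"
    if "\<And>H. linear H \<Longrightarrow> (\<Sum>i\<in>Basis. H (c i) \<bullet> c i) = mc_trace r H" for c :: "'a \<Rightarrow> 'a" and r
  proof -
    have "(\<Sum>i\<in>Basis. (norm (c i))\<^sup>2) = mc_trace r (\<lambda>h. h)"
      using that[OF linear_id[unfolded id_def]] by (simp add: power2_norm_eq_inner)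
    also have "\<dots> \<le> n" by (simp add: mc_trace_def trace_form_def inner_Basis n_def)
    finally show ?thesis .
  qed
  have norm_le: "norm (c i) \<le> n" if "(\<Sum>i\<in>Basis. (norm (c i))\<^sup>2) \<le> n" "i \<in> Basis" for c :: "'a \<Rightarrow> 'a" and i
  proof -
    have "(norm (c i))\<^sup>2 \<le> (\<Sum>i\<in>Basis. (norm (c i))\<^sup>2)" using that(2) by (intro member_le_sum) auto
    also note that(1)
    also have "n \<le> n\<^sup>2" using n1 by (rule self_le_power) simp
    finally show ?thesis using n1 by (simp add: abs_le_square_iff[symmetric])
  qed
  note sa = sumsq[OF ta] and sb = sumsq[OF tb]
  \<comment> \<open>The term \<open>2 (p \<bullet> a)^2\<close> stems from the penalty on
    \<open>u\<close>. It is quadratic in the gradient, but the root contracts the direction of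
    \<open>p\<close> so strongly that the sum is \<open>|p|^2 / (1 + |p|^2)\<close>.\<close>
  have pa: "(\<Sum>i\<in>Basis. (p \<bullet> a i)\<^sup>2) \<le> 1"
  proof -
    have "linear (\<lambda>h. (p \<bullet> h) *\<^sub>R p)" by (auto intro!: linearI simp: inner_add_right algebra_simps)
    from ta[OF this] have "(\<Sum>i\<in>Basis. (p \<bullet> a i)\<^sup>2) = mc_trace p (\<lambda>h. (p \<bullet> h) *\<^sub>R p)"
      by (simp add: power2_eq_square)
    also have "\<dots> = (norm p)\<^sup>2 - (norm p)\<^sup>2 * (norm p)\<^sup>2 / (1 + (norm p)\<^sup>2)"
      by (simp add: mc_trace_def trace_form_def power2_norm_eq_inner sum_Basis_inner_mult)
    also have "\<dots> = (norm p)\<^sup>2 / (1 + (norm p)\<^sup>2)"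
    proof -
      have "1 + (norm p)\<^sup>2 > 0" by (simp add: add_pos_nonneg)
      then show ?thesis by (simp add: field_simps)
    qed
    also have "\<dots> \<le> 1" by (simp add: divide_le_eq add_pos_nonneg)
    finally show ?thesis .
  qed
  have ME: "ME \<ge> 0" using E(1) norm_ge_zero[of Ex] by linarith
  have a0: "a0 > 0" using A by linarith
  have L0: "L \<ge> 0" using f(1) by linarith
  have "\<theta> * (f1 * mc_speed p) - f2 * mc_speed q - 2 - 2 * n
      \<le> (\<Sum>i\<in>Basis. \<theta> * (X (a i) \<bullet> a i) - 2 * (p \<bullet> a i)\<^sup>2 - 2 * (norm (a i))\<^sup>2 - Y (b i) \<bullet> b i)"
    using ta[OF lin(1)] tb[OF lin(2)] eqs pa sa
    by (simp add: sum_subtractf sum_distrib_left[symmetric])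
  also have "\<dots> \<le> (\<Sum>i\<in>Basis. \<eta> * (- C * A1\<^sup>2 * ((a i - b i) \<bullet> e)\<^sup>2 + A1 / s * (norm (perp e (a i - b i)))\<^sup>2)
           + 2 * A1 * ((a i - b i) \<bullet> e) * (Ex \<bullet> a i + Ey \<bullet> b i) + A * (KX (a i) \<bullet> a i + KY (b i) \<bullet> b i))"
    by (intro sum_mono sec)
  also have "\<dots> = - C * A1\<^sup>2 * \<eta> * (\<Sum>i\<in>Basis. ((a i - b i) \<bullet> e)\<^sup>2)
      + (\<Sum>i\<in>Basis. \<eta> * (A1 / s * (norm (perp e (a i - b i)))\<^sup>2))
      + (\<Sum>i\<in>Basis. 2 * A1 * ((a i - b i) \<bullet> e) * (Ex \<bullet> a i + Ey \<bullet> b i))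
      + A * (\<Sum>i\<in>Basis. KX (a i) \<bullet> a i + KY (b i) \<bullet> b i)"
    unfolding sum_distrib_left sum.distrib[symmetric] by (intro sum.cong refl) (simp add: algebra_simps)
  also have "\<dots> \<le> - C / 3 + 1 + 4 * n * n * (4 * \<beta> + 4) * ME + 2 * a0 * ME * n"
  proof (intro add_mono)
    \<comment> \<open>The gain: the weight \<open>1 / k^2\<close> with \<open>k = A1 \<eta>\<close>
      cancels the factor \<open>A1^2\<close> of the concavity term exactly and leaves
      \<open>C / \<eta> \<ge> C / 3\<close>.\<close>
    have "C * A1\<^sup>2 * \<eta> * (\<Sum>i\<in>Basis. ((a i - b i) \<bullet> e)\<^sup>2) \<ge> C * A1\<^sup>2 * \<eta> * (1 / k\<^sup>2)"
      using C \<eta> by (intro mult_left_mono ne) auto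
    also have "C * A1\<^sup>2 * \<eta> * (1 / k\<^sup>2) = C / \<eta>"
      using \<eta> A1 by (simp add: k_def power_mult_distrib power2_eq_square)
    also have "C / \<eta> \<ge> C / 3" using C \<eta> by (intro divide_left_mono) auto
    finally show "- C * A1\<^sup>2 * \<eta> * (\<Sum>i\<in>Basis. ((a i - b i) \<bullet> e)\<^sup>2) \<le> - C / 3" by simp
  next
    have A1p: "A1 > 0" using A1 by simp
    \<comment> \<open>The coupling error enters squared, \<open>p - q\<close> is of size
      \<open>A\<close>, and \<open>A\<close> is at most \<open>(1 + C a0) s A1\<close>; together
      these absorb the singular factor \<open>A1 / s\<close>. The number 120000 is
      \<open>3 * 200^2\<close>, and \<open>A1big\<close> leaves at most \<open>1 / n\<close> for
      each basis vector.\<close>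
    have 1: "\<eta> * (A1 / s * (norm (perp e (a i - b i)))\<^sup>2) \<le> 1 / n" if i: "i \<in> Basis" for i
    proof -
      have "norm (perp e (a i - b i)) \<le> 200 * \<beta> * (c1 * A) / A1\<^sup>2"
      proof -
        have "norm (perp e (a i - b i)) \<le> 200 * \<beta> * norm (p - q) / k\<^sup>2" by (rule np[OF i])
        also have "\<dots> \<le> 200 * \<beta> * (c1 * A) / A1\<^sup>2"
          using pq \<beta> A1 kA by (intro frac_le mult_left_mono power_mono) (auto intro: mult_nonneg_nonneg c1 less_imp_le[OF A(1)])
        finally show ?thesis .
      qed
      then have "(norm (perp e (a i - b i)))\<^sup>2 \<le> (200 * \<beta> * (c1 * A) / A1\<^sup>2)\<^sup>2" by (intro power_mono) auto
      then have "\<eta> * (A1 / s * (norm (perp e (a i - b i)))\<^sup>2) \<le> 3 * (A1 / s * (200 * \<beta> * (c1 * A) / A1\<^sup>2)\<^sup>2)"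
        using \<eta> A1 s by (intro mult_mono mult_left_mono) auto
      also have "\<dots> = 120000 * \<beta>\<^sup>2 * c1\<^sup>2 * A * (A / (s * A1)) / A1\<^sup>2"
        using A1p s by (simp add: field_simps power2_eq_square)
      also have "\<dots> \<le> 120000 * \<beta>\<^sup>2 * c1\<^sup>2 * a0 * (1 + C * a0) / A1\<^sup>2"
        using As A A1p s C a0 by (intro divide_right_mono mult_mono) (auto simp: divide_le_eq intro!: mult_nonneg_nonneg add_nonneg_nonneg)
      also have "\<dots> \<le> 1 / n"
      proof -
        have "120000 * \<beta>\<^sup>2 * c1\<^sup>2 * a0 * (1 + C * a0) * n \<le> A1\<^sup>2" using A1big by (simp add: n_def mult_ac)
        then show ?thesis using n1 A1p by (simp add: divide_le_eq pos_le_divide_eq)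
      qed
      finally show ?thesis .
    qed
    have "(\<Sum>i\<in>Basis. \<eta> * (A1 / s * (norm (perp e (a i - b i)))\<^sup>2)) \<le> (\<Sum>i\<in>(Basis::'a set). 1 / n)"
      by (intro sum_mono 1)
    then show "(\<Sum>i\<in>Basis. \<eta> * (A1 / s * (norm (perp e (a i - b i)))\<^sup>2)) \<le> 1" using n1 by (simp add: n_def)
  next
    \<comment> \<open>The \<open>e\<close>-component of \<open>a i - b i\<close> is of order
      \<open>1 / A1\<close>, which offsets the factor \<open>A1\<close>.\<close>
    have "2 * A1 * ((a i - b i) \<bullet> e) * (Ex \<bullet> a i + Ey \<bullet> b i) \<le> 4 * n * (4 * \<beta> + 4) * ME" if i: "i \<in> Basis" for i
    proof -
      have "\<bar>Ex \<bullet> a i + Ey \<bullet> b i\<bar> \<le> ME * n + ME * n"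
      proof -
        have "\<bar>Ex \<bullet> a i\<bar> \<le> ME * n" using Cauchy_Schwarz_ineq2[of Ex "a i"] mult_mono[OF E(1) norm_le[OF sa i]] ME by force
        moreover have "\<bar>Ey \<bullet> b i\<bar> \<le> ME * n" using Cauchy_Schwarz_ineq2[of Ey "b i"] mult_mono[OF E(2) norm_le[OF sb i]] ME by force
        ultimately show ?thesis by linarith
      qed
      then have "\<bar>(a i - b i) \<bullet> e\<bar> * \<bar>Ex \<bullet> a i + Ey \<bullet> b i\<bar> \<le> (4 * \<beta> + 4) / A1 * (2 * ME * n)"
      proof (intro mult_mono)
        have "(4 * \<beta> + 4) / k \<le> (4 * \<beta> + 4) / A1" using \<beta> A1 kA by (intro divide_left_mono) auto
        then show "\<bar>(a i - b i) \<bullet> e\<bar> \<le> (4 * \<beta> + 4) / A1" using ne_le[OF i] by linarith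
      qed (use \<beta> A1 in auto)
      then have "2 * A1 * (\<bar>(a i - b i) \<bullet> e\<bar> * \<bar>Ex \<bullet> a i + Ey \<bullet> b i\<bar>) \<le> 2 * A1 * ((4 * \<beta> + 4) / A1 * (2 * ME * n))"
        using A1 by (intro mult_left_mono) auto
      also have "\<dots> = 4 * n * (4 * \<beta> + 4) * ME" using A1 by (simp add: field_simps)
      finally have "2 * A1 * (\<bar>(a i - b i) \<bullet> e\<bar> * \<bar>Ex \<bullet> a i + Ey \<bullet> b i\<bar>) \<le> 4 * n * (4 * \<beta> + 4) * ME" .
      moreover have "2 * A1 * (\<bar>(a i - b i) \<bullet> e\<bar> * \<bar>Ex \<bullet> a i + Ey \<bullet> b i\<bar>) = \<bar>2 * A1 * ((a i - b i) \<bullet> e) * (Ex \<bullet> a i + Ey \<bullet> b i)\<bar>"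
        using A1 by (simp add: abs_mult)
      ultimately show ?thesis by linarith
    qed
    then have "(\<Sum>i\<in>Basis. 2 * A1 * ((a i - b i) \<bullet> e) * (Ex \<bullet> a i + Ey \<bullet> b i)) \<le> (\<Sum>i\<in>(Basis::'a set). 4 * n * (4 * \<beta> + 4) * ME)"
      by (intro sum_mono)
    then show "(\<Sum>i\<in>Basis. 2 * A1 * ((a i - b i) \<bullet> e) * (Ex \<bullet> a i + Ey \<bullet> b i)) \<le> 4 * n * n * (4 * \<beta> + 4) * ME"
      by (simp add: n_def algebra_simps)
  next
    have "(\<Sum>i\<in>Basis. KX (a i) \<bullet> a i + KY (b i) \<bullet> b i) \<le> (\<Sum>i\<in>Basis. ME * (norm (a i))\<^sup>2 + ME * (norm (b i))\<^sup>2)"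
      using E(3,4) by (intro sum_mono add_mono) (auto simp: abs_le_iff)
    also have "\<dots> \<le> ME * n + ME * n"
      unfolding sum.distrib sum_distrib_left[symmetric] using sa sb ME by (intro add_mono mult_left_mono) auto
    finally have "A * (\<Sum>i\<in>Basis. KX (a i) \<bullet> a i + KY (b i) \<bullet> b i) \<le> A * (2 * ME * n)" using A by (intro mult_left_mono) auto
    also have "\<dots> \<le> a0 * (2 * ME * n)" using A ME n1 by (intro mult_right_mono) auto
    finally show "A * (\<Sum>i\<in>Basis. KX (a i) \<bullet> a i + KY (b i) \<bullet> b i) \<le> 2 * a0 * ME * n" by (simp add: algebra_simps)
  qed
  finally have main: "\<theta> * (f1 * mc_speed p) - f2 * mc_speed q - 2 - 2 * n
     \<le> - C / 3 + 1 + 4 * n * n * (4 * \<beta> + 4) * ME + 2 * a0 * ME * n" .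
  \<comment> \<open>Multiplication by \<open>mc_speed\<close> is affordable only for quantities with
    a factor \<open>s\<close>: the bound \<open>A1 s \<le> 1\<close> keeps
    \<open>s * mc_speed p\<close> under control.\<close>
  have sv: "s * mc_speed p \<le> 4 + \<beta>"
  proof -
    have "norm p \<le> k + \<beta>" using norm_triangle_sub[of p "k *\<^sub>R e"] p e k1 by (simp add: k_def)
    then have "mc_speed p \<le> 1 + 3 * A1 + \<beta>" using mc_speed_le[of p] k3 by linarith
    then have "s * mc_speed p \<le> s * (1 + 3 * A1 + \<beta>)" using s by (intro mult_left_mono) auto
    also have "\<dots> = s + 3 * (A1 * s) + s * \<beta>" by (simp add: algebra_simps)
    also have "\<dots> \<le> 1 + 3 * 1 + 1 * \<beta>" using s \<beta> by (intro add_mono mult_left_mono mult_right_mono) auto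
    finally show ?thesis by simp
  qed
  \<comment> \<open>A splitting in which nothing of order \<open>A1\<close> remains:
    \<open>f1 - f2\<close> is bounded below by a multiple of \<open>s\<close>,
    \<open>\<theta> - 1\<close> is of order \<open>s\<close>, and the last difference is controlled
    by \<open>|p - q|\<close>.\<close>
  have "\<theta> * (f1 * mc_speed p) - f2 * mc_speed q
      = (f1 - f2) * mc_speed p + (\<theta> - 1) * f1 * mc_speed p + f2 * (mc_speed p - mc_speed q)"
    by (simp add: algebra_simps)
  moreover have "(f1 - f2) * mc_speed p \<ge> - (\<Lambda> * (4 + \<beta>))"
  proof -
    have "(f1 - f2) * mc_speed p \<ge> (- \<Lambda> * s) * mc_speed p" using f(3) less_imp_le[OF mc_speed_pos[of p]] by (intro mult_right_mono)
    moreover have "\<Lambda> * (s * mc_speed p) \<le> \<Lambda> * (4 + \<beta>)" using sv \<Lambda> by (intro mult_left_mono)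
    ultimately show ?thesis by (simp add: algebra_simps)
  qed
  moreover have "(\<theta> - 1) * f1 * mc_speed p \<ge> - (2 * \<Lambda> * L * (4 + \<beta>))"
  proof -
    have "\<bar>(\<theta> - 1) * f1 * mc_speed p\<bar> = \<bar>\<theta> - 1\<bar> * \<bar>f1\<bar> * mc_speed p" using less_imp_le[OF mc_speed_pos[of p]] by (simp add: abs_mult)
    also have "\<dots> \<le> (2 * \<Lambda> * s) * L * mc_speed p"
      using \<theta> f(1) \<Lambda> s less_imp_le[OF mc_speed_pos[of p]] by (intro mult_mono) auto
    also have "\<dots> = 2 * \<Lambda> * L * (s * mc_speed p)" by simp
    also have "\<dots> \<le> 2 * \<Lambda> * L * (4 + \<beta>)" using sv \<Lambda> L0 by (intro mult_left_mono) auto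
    finally show ?thesis by linarith
  qed
  moreover have "f2 * (mc_speed p - mc_speed q) \<ge> - (L * c1 * a0)"
  proof -
    have "\<bar>f2 * (mc_speed p - mc_speed q)\<bar> \<le> L * (c1 * a0)" unfolding abs_mult
    proof (intro mult_mono)
      have "\<bar>mc_speed p - mc_speed q\<bar> \<le> c1 * A" using mc_speed_diff[of p q] pq by linarith
      also have "\<dots> \<le> c1 * a0" using A c1 by (intro mult_left_mono)
      finally show "\<bar>mc_speed p - mc_speed q\<bar> \<le> c1 * a0" .
    qed (use f L0 in auto)
    then show ?thesis by (simp add: abs_le_iff)
  qed
  ultimately have "\<theta> * (f1 * mc_speed p) - f2 * mc_speed q \<ge> - ((\<Lambda> + 2 * \<Lambda> * L) * (4 + \<beta>)) - L * c1 * a0"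
    by (simp add: algebra_simps)
  moreover have "C \<le> 3 * (T + U + 3 + 2 * n + W + Z)"
    if "- T - U \<le> F" "F - 2 - 2 * n \<le> - C / 3 + 1 + W + Z" for T U W Z F
    using that by simp
  ultimately show ?thesis using main unfolding n_def[symmetric] by blast
qed

section \<open>Gradients and twice differentiable functions\<close>

lemma Ck_continuous_on: "Ck k U S u \<Longrightarrow> continuous_on S u"
  by (cases k) auto

lemma Ck_Suc_differentiable: "Ck (Suc k) U S u \<Longrightarrow> x \<in> U \<Longrightarrow> u differentiable (at x)"
  by simp

lemma Ck_dir_deriv: "Ck (Suc k) U S u \<Longrightarrow> b \<in> Basis \<Longrightarrow> Ck k U S (dir_deriv U b u)"
  by simp

lemma has_derivative_grad:
  assumes "u differentiable (at x)" "x \<in> U"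
  shows "(u has_derivative (\<lambda>h. grad U u x \<bullet> h)) (at x)"
proof -
  have D: "(u has_derivative frechet_derivative u (at x)) (at x)"
    using assms(1) by (simp add: frechet_derivative_works)
  have "frechet_derivative u (at x) h = grad U u x \<bullet> h" for h
  proof -
    have "frechet_derivative u (at x) h = frechet_derivative u (at x) (\<Sum>b\<in>Basis. (h \<bullet> b) *\<^sub>R b)"
      by (simp add: euclidean_representation)
    also have "\<dots> = (\<Sum>b\<in>Basis. (h \<bullet> b) * frechet_derivative u (at x) b)"
      using has_derivative_linear[OF D] by (simp add: linear_sum linear_cmul)
    also have "\<dots> = grad U u x \<bullet> h"
      using assms(2) by (simp add: grad_def dir_deriv_def inner_sum_left inner_sum_right inner_commute mult.commute)
    finally show ?thesis .
  qed
  with D show ?thesis by (metis (no_types, lifting) ext)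
qed

lemma Ck_grad_continuous_on: "Ck (Suc k) U S u \<Longrightarrow> continuous_on S (grad U u)"
  unfolding grad_def[abs_def]
  by (intro continuous_on_sum continuous_on_scaleR continuous_on_const)
     (auto intro: Ck_continuous_on)

lemma Ck_grad_has_derivative:
  assumes "Ck (Suc (Suc k)) U S u" "x \<in> U"
  shows "(grad U u has_derivative (\<lambda>h. \<Sum>b\<in>Basis. (grad U (dir_deriv U b u) x \<bullet> h) *\<^sub>R b)) (at x)"
  unfolding grad_def[of U u, abs_def]
proof (intro has_derivative_sum has_derivative_scaleR_left has_derivative_grad assms(2))
  show "dir_deriv U b u differentiable at x" if "b \<in> Basis" for b
    using Ck_Suc_differentiable[OF Ck_dir_deriv[OF assms(1) that] assms(2)] .
qed

lemma Ck_twice_diff_at: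
  assumes "Ck (Suc (Suc k)) U S u" "open U" "x \<in> U"
  obtains H where "twice_diff_at u (grad U u) H x"
proof -
  obtain d where "d > 0" "ball x d \<subseteq> U" using assms(2,3) open_contains_ball by blast
  then have "\<forall>y\<in>ball x d. (u has_derivative (\<lambda>h. grad U u y \<bullet> h)) (at y)"
    using Ck_Suc_differentiable[OF assms(1)] has_derivative_grad by blast
  then have "twice_diff_at u (grad U u) (\<lambda>h. \<Sum>b\<in>Basis. (grad U (dir_deriv U b u) x \<bullet> h) *\<^sub>R b) x"
    unfolding twice_diff_at_def using Ck_grad_has_derivative[OF assms(1,3)] \<open>d > 0\<close> by blast
  then show thesis by (rule that)
qed

text \<open>Carrying out the divergence links the operator of the equation to
  \<open>mc_trace\<close>, the form to which the coupling applies. Only the derivative of the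
  gradient at the one point \<open>x\<close> is involved.\<close>

lemma mean_curvature_op_eq:
  assumes H: "(grad U u has_derivative H) (at x)"
  shows "mean_curvature_op U u x = mc_trace (grad U u x) H / mc_speed (grad U u x)"
proof -
  define g where "g = grad U u"
  define v where "v = mc_speed (g x)"
  have v: "v > 0" by (simp add: v_def)
  have lin: "linear H" using has_derivative_linear[OF H] .
  have vx: "sqrt (1 + (norm (g x))\<^sup>2) = v" by (simp add: v_def mc_speed_def)
  have g: "(g has_derivative H) (at x)" using H by (simp add: g_def)
  have "((\<lambda>y. 1 + g y \<bullet> g y) has_derivative (\<lambda>h. 2 * (g x \<bullet> H h))) (at x)"
    by (auto intro!: derivative_eq_intros g simp: inner_commute)
  then have "((\<lambda>y. sqrt (1 + g y \<bullet> g y)) has_derivative (\<lambda>h. (g x \<bullet> H h) / v)) (at x)"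
    using has_derivative_real_sqrt[of "\<lambda>y. 1 + g y \<bullet> g y" x "\<lambda>h. 2 * (g x \<bullet> H h)" UNIV]
    by (simp add: add_pos_nonneg vx[unfolded power2_norm_eq_inner] inverse_eq_divide)
  then have S: "((\<lambda>y. sqrt (1 + (norm (g y))\<^sup>2)) has_derivative (\<lambda>h. (g x \<bullet> H h) / v)) (at x)"
    by (simp add: power2_norm_eq_inner)
  have "((\<lambda>y. 1 / sqrt (1 + (norm (g y))\<^sup>2)) has_derivative (\<lambda>h. - ((g x \<bullet> H h) / v ^ 3))) (at x)"
  proof -
    have "((\<lambda>t. 1 / t) has_real_derivative (- 1 / v\<^sup>2)) (at v)"
      using v by (auto intro!: derivative_eq_intros simp: power2_eq_square)
    then have "((\<lambda>t. 1 / t) has_derivative (\<lambda>h. (- 1 / v\<^sup>2) * h)) (at (sqrt (1 + (norm (g x))\<^sup>2)))"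
      unfolding vx by (rule has_field_derivative_imp_has_derivative)
    from has_derivative_compose[OF S this] show ?thesis
      by (simp add: power3_eq_cube power2_eq_square mult.assoc)
  qed
  from has_derivative_scaleR[OF this g]
  have F: "((\<lambda>y. (1 / sqrt (1 + (norm (g y))\<^sup>2)) *\<^sub>R g y) has_derivative
      (\<lambda>h. (1 / v) *\<^sub>R H h + (- ((g x \<bullet> H h) / v ^ 3)) *\<^sub>R g x)) (at x)"
    by (simp add: vx)
  have "mean_curvature_op U u x = (\<Sum>b\<in>Basis. ((1 / v) *\<^sub>R H b + (- ((g x \<bullet> H b) / v ^ 3)) *\<^sub>R g x) \<bullet> b)"
    unfolding mean_curvature_op_def divergence_def g_def[symmetric] frechet_derivative_at[OF F, symmetric] ..
  also have "\<dots> = trace_form H / v - (\<Sum>b\<in>Basis. (g x \<bullet> b) * (H b \<bullet> g x)) / v ^ 3"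
    unfolding trace_form_def sum_divide_distrib sum_subtractf[symmetric]
    by (intro sum.cong refl) (simp add: inner_add_left inner_diff_left inner_diff_right inner_commute mult.commute)
  also have "\<dots> = trace_form H / v - (H (g x) \<bullet> g x) / v ^ 3"
    by (simp only: sum_Basis_linear_left[OF lin])
  also have "\<dots> = mc_trace (g x) H / v"
    unfolding mc_trace_def mc_speed_sq[symmetric] v_def[symmetric]
    using v by (simp add: field_simps power2_eq_square power3_eq_cube)
  finally show ?thesis by (simp add: g_def v_def)
qed

section \<open>Twice differentiable functions on the whole space\<close>

text \<open>The second derivative is required to be bounded on balls rather than continuous; this is
  stable under the operations below and yields all uniform constants on the compact closure of the
  domain. The gradient is an explicit argument so that sums, products and compositions come with
  their gradient formulas.\<close>

definition C2_with :: "('a::euclidean_space \<Rightarrow> real) \<Rightarrow> ('a \<Rightarrow> 'a) \<Rightarrow> bool" where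
  "C2_with f G \<longleftrightarrow> (\<forall>x. (f has_derivative (\<lambda>h. G x \<bullet> h)) (at x)) \<and>
     (\<exists>H. (\<forall>x. (G has_derivative H x) (at x)) \<and>
        (\<forall>R. \<exists>M. \<forall>x. norm x \<le> R \<longrightarrow> (\<forall>h. norm (H x h) \<le> M * norm h)))"

lemma C2_withD: "C2_with f G \<Longrightarrow> (f has_derivative (\<lambda>h. G x \<bullet> h)) (at x)"
  by (simp add: C2_with_def)

lemma C2_with_continuous:
  assumes "C2_with f G" shows "continuous_on S f" "continuous_on S G"
  using assms unfolding C2_with_def
  by (meson continuous_at_imp_continuous_on has_derivative_continuous)+

lemma bounded_on_cball:
  fixes f :: "'a::euclidean_space \<Rightarrow> 'b::real_normed_vector"
  assumes "continuous_on UNIV f"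
  obtains M where "M \<ge> 0" "\<And>x. norm x \<le> R \<Longrightarrow> norm (f x) \<le> M"
proof -
  have "bounded (f ` cball 0 R)"
    by (intro compact_imp_bounded compact_continuous_image continuous_on_subset[OF assms]) auto
  then obtain M where "M > 0" "\<forall>y\<in>f ` cball 0 R. norm y \<le> M" by (auto simp: bounded_pos)
  then show thesis by (intro that[of M]) auto
qed

lemma C2_with_bounds:
  fixes f :: "'a::euclidean_space \<Rightarrow> real"
  assumes "C2_with f G"
  obtains M H where "M \<ge> 0" "\<And>x. (G has_derivative H x) (at x)"
    "\<And>x. norm x \<le> R \<Longrightarrow> \<bar>f x\<bar> \<le> M" "\<And>x. norm x \<le> R \<Longrightarrow> norm (G x) \<le> M"
    "\<And>x h. norm x \<le> R \<Longrightarrow> norm (H x h) \<le> M * norm h"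
proof -
  obtain H M1 where H: "\<And>x. (G has_derivative H x) (at x)"
    "\<And>x h. norm x \<le> R \<Longrightarrow> norm (H x h) \<le> M1 * norm h"
    using assms unfolding C2_with_def by meson
  obtain M2 where M2: "M2 \<ge> 0" "\<And>x. norm x \<le> R \<Longrightarrow> norm (f x) \<le> M2"
    using bounded_on_cball[OF C2_with_continuous(1)[OF assms]] by blast
  obtain M3 where M3: "M3 \<ge> 0" "\<And>x. norm x \<le> R \<Longrightarrow> norm (G x) \<le> M3"
    using bounded_on_cball[OF C2_with_continuous(2)[OF assms]] by blast
  define M where "M = max 0 M1 + M2 + M3"
  show thesis
  proof (rule that[of M H])
    fix x h :: 'a assume x: "norm x \<le> R"
    have "M1 * norm h \<le> M * norm h" using M2 M3 by (intro mult_right_mono) (auto simp: M_def)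
    then show "norm (H x h) \<le> M * norm h" using H(2)[OF x, of h] by linarith
  next
    fix x :: 'a assume "norm x \<le> R"
    then show "\<bar>f x\<bar> \<le> M" "norm (G x) \<le> M" using M2 M3 by (fastforce simp: M_def)+
  qed (use H M2 M3 in \<open>auto simp: M_def\<close>)
qed

lemma C2_withI:
  assumes "\<And>x. (f has_derivative (\<lambda>h. G x \<bullet> h)) (at x)" "\<And>x. (G has_derivative H x) (at x)"
    "\<And>R. \<exists>M. \<forall>x. norm x \<le> R \<longrightarrow> (\<forall>h. norm (H x h) \<le> M * norm h)"
  shows "C2_with f G"
  using assms unfolding C2_with_def by blast

lemma Ck_C2_with:
  fixes g :: "'a::euclidean_space \<Rightarrow> real"
  assumes "Ck (Suc (Suc k)) UNIV UNIV g"
  shows "C2_with g (grad UNIV g)"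
proof (rule C2_withI)
  show "(g has_derivative (\<lambda>h. grad UNIV g x \<bullet> h)) (at x)" for x
    using has_derivative_grad[OF Ck_Suc_differentiable[OF assms], of x] by simp
  show "(grad UNIV g has_derivative (\<lambda>h. \<Sum>b\<in>Basis. (grad UNIV (dir_deriv UNIV b g) x \<bullet> h) *\<^sub>R b)) (at x)" for x
    using Ck_grad_has_derivative[OF assms, of x] by simp
  fix R
  have "\<exists>M\<ge>0. \<forall>x. norm x \<le> R \<longrightarrow> norm (grad UNIV (dir_deriv UNIV b g) x) \<le> M" if "b \<in> Basis" for b
    using bounded_on_cball[OF Ck_grad_continuous_on[OF Ck_dir_deriv[OF assms that]]] by metis
  then obtain M where M: "\<And>b. b \<in> Basis \<Longrightarrow> M b \<ge> 0"
    "\<And>b x. b \<in> Basis \<Longrightarrow> norm x \<le> R \<Longrightarrow> norm (grad UNIV (dir_deriv UNIV b g) x) \<le> M b" by metis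
  show "\<exists>M. \<forall>x. norm x \<le> R \<longrightarrow> (\<forall>h. norm (\<Sum>b\<in>Basis. (grad UNIV (dir_deriv UNIV b g) x \<bullet> h) *\<^sub>R b) \<le> M * norm h)"
  proof (intro exI allI impI)
    fix x :: 'a and h :: 'a assume x: "norm x \<le> R"
    have "norm (\<Sum>b\<in>Basis. (grad UNIV (dir_deriv UNIV b g) x \<bullet> h) *\<^sub>R b) \<le> (\<Sum>b\<in>Basis. M b * norm h)"
    proof (rule sum_norm_le)
      fix b :: 'a assume b: "b \<in> Basis"
      have "\<bar>grad UNIV (dir_deriv UNIV b g) x \<bullet> h\<bar> \<le> norm (grad UNIV (dir_deriv UNIV b g) x) * norm h"
        by (rule Cauchy_Schwarz_ineq2)
      also have "\<dots> \<le> M b * norm h" using M(2)[OF b x] by (intro mult_right_mono) auto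
      finally show "norm ((grad UNIV (dir_deriv UNIV b g) x \<bullet> h) *\<^sub>R b) \<le> M b * norm h" using b by simp
    qed
    then show "norm (\<Sum>b\<in>Basis. (grad UNIV (dir_deriv UNIV b g) x \<bullet> h) *\<^sub>R b) \<le> (\<Sum>b\<in>Basis. M b) * norm h"
      by (simp add: sum_distrib_right)
  qed
qed

lemma C2_with_add:
  fixes f1 f2 :: "'a::euclidean_space \<Rightarrow> real"
  assumes f: "C2_with f1 G1" and g: "C2_with f2 G2"
  shows "C2_with (\<lambda>x. f1 x + f2 x) (\<lambda>x. G1 x + G2 x)"
proof -
  obtain H1 where H1: "\<And>x. (G1 has_derivative H1 x) (at x)"
     "\<And>R. \<exists>M. \<forall>x. norm x \<le> R \<longrightarrow> (\<forall>h. norm (H1 x h) \<le> M * norm h)" using f unfolding C2_with_def by blast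
  obtain H2 where H2: "\<And>x. (G2 has_derivative H2 x) (at x)"
     "\<And>R. \<exists>M. \<forall>x. norm x \<le> R \<longrightarrow> (\<forall>h. norm (H2 x h) \<le> M * norm h)" using g unfolding C2_with_def by blast
  show ?thesis
  proof (rule C2_withI[where H="\<lambda>x h. H1 x h + H2 x h"])
    show "((\<lambda>x. f1 x + f2 x) has_derivative (\<lambda>h. (G1 x + G2 x) \<bullet> h)) (at x)" for x
      unfolding inner_add_left by (intro has_derivative_add C2_withD[OF f] C2_withD[OF g])
    show "((\<lambda>x. G1 x + G2 x) has_derivative (\<lambda>h. H1 x h + H2 x h)) (at x)" for x
      by (intro has_derivative_add H1 H2)
    fix R
    obtain M1 M2 where "\<forall>x. norm x \<le> R \<longrightarrow> (\<forall>h. norm (H1 x h) \<le> M1 * norm h)"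
      "\<forall>x. norm x \<le> R \<longrightarrow> (\<forall>h. norm (H2 x h) \<le> M2 * norm h)" using H1(2) H2(2) by metis
    then have "\<forall>x. norm x \<le> R \<longrightarrow> (\<forall>h. norm (H1 x h + H2 x h) \<le> (M1 + M2) * norm h)"
      unfolding distrib_right using norm_triangle_mono by blast
    then show "\<exists>M. \<forall>x. norm x \<le> R \<longrightarrow> (\<forall>h. norm (H1 x h + H2 x h) \<le> M * norm h)" by blast
  qed
qed

lemma C2_with_const: "C2_with (\<lambda>x. c) (\<lambda>x. 0)"
  by (rule C2_withI[where H="\<lambda>x h. 0"]) (auto intro!: exI[of _ 0])

lemma C2_with_inner: "C2_with (\<lambda>x. x \<bullet> e) (\<lambda>x. e)"
  by (rule C2_withI[where H="\<lambda>x h. 0"])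
     (auto intro!: exI[of _ 0] derivative_eq_intros simp: inner_commute)

lemma C2_with_mult:
  fixes f1 f2 :: "'a::euclidean_space \<Rightarrow> real"
  assumes f: "C2_with f1 G1" and g: "C2_with f2 G2"
  shows "C2_with (\<lambda>x. f1 x * f2 x) (\<lambda>x. f1 x *\<^sub>R G2 x + f2 x *\<^sub>R G1 x)"
proof -
  obtain H1 where H1: "\<And>x. (G1 has_derivative H1 x) (at x)" using f unfolding C2_with_def by blast
  obtain H2 where H2: "\<And>x. (G2 has_derivative H2 x) (at x)" using g unfolding C2_with_def by blast
  show ?thesis
  proof (rule C2_withI[where H="\<lambda>x h. (f1 x *\<^sub>R H2 x h + (G1 x \<bullet> h) *\<^sub>R G2 x) + (f2 x *\<^sub>R H1 x h + (G2 x \<bullet> h) *\<^sub>R G1 x)"])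
    show "((\<lambda>x. f1 x * f2 x) has_derivative (\<lambda>h. (f1 x *\<^sub>R G2 x + f2 x *\<^sub>R G1 x) \<bullet> h)) (at x)" for x
      using has_derivative_mult[OF C2_withD[OF f, of x] C2_withD[OF g, of x]]
      by (simp add: inner_add_left mult.commute)
    show "((\<lambda>x. f1 x *\<^sub>R G2 x + f2 x *\<^sub>R G1 x) has_derivative
       (\<lambda>h. (f1 x *\<^sub>R H2 x h + (G1 x \<bullet> h) *\<^sub>R G2 x) + (f2 x *\<^sub>R H1 x h + (G2 x \<bullet> h) *\<^sub>R G1 x))) (at x)" for x
      by (intro has_derivative_add has_derivative_scaleR H1 H2 C2_withD[OF f] C2_withD[OF g])
    fix R
    obtain M1 H1' where M1: "M1 \<ge> 0" "\<And>x. (G1 has_derivative H1' x) (at x)"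
      "\<And>x. norm x \<le> R \<Longrightarrow> \<bar>f1 x\<bar> \<le> M1" "\<And>x. norm x \<le> R \<Longrightarrow> norm (G1 x) \<le> M1"
      "\<And>x h. norm x \<le> R \<Longrightarrow> norm (H1' x h) \<le> M1 * norm h" using C2_with_bounds[OF f, of R] by metis
    obtain M2 H2' where M2: "M2 \<ge> 0" "\<And>x. (G2 has_derivative H2' x) (at x)"
      "\<And>x. norm x \<le> R \<Longrightarrow> \<bar>f2 x\<bar> \<le> M2" "\<And>x. norm x \<le> R \<Longrightarrow> norm (G2 x) \<le> M2"
      "\<And>x h. norm x \<le> R \<Longrightarrow> norm (H2' x h) \<le> M2 * norm h" using C2_with_bounds[OF g, of R] by metis
    have eq: "H1' x = H1 x" "H2' x = H2 x" for x
      using has_derivative_unique[OF M1(2) H1] has_derivative_unique[OF M2(2) H2] by auto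
    show "\<exists>M. \<forall>x. norm x \<le> R \<longrightarrow> (\<forall>h. norm ((f1 x *\<^sub>R H2 x h + (G1 x \<bullet> h) *\<^sub>R G2 x) + (f2 x *\<^sub>R H1 x h + (G2 x \<bullet> h) *\<^sub>R G1 x)) \<le> M * norm h)"
    proof (intro exI[of _ "4 * M1 * M2"] allI impI)
      fix x h :: 'a assume x: "norm x \<le> R"
      have i: "\<bar>G1 x \<bullet> h\<bar> \<le> M1 * norm h" "\<bar>G2 x \<bullet> h\<bar> \<le> M2 * norm h"
        using Cauchy_Schwarz_ineq2[of "G1 x" h] Cauchy_Schwarz_ineq2[of "G2 x" h]
          mult_right_mono[OF M1(4)[OF x], of "norm h"] mult_right_mono[OF M2(4)[OF x], of "norm h"] by auto
      have "norm (f1 x *\<^sub>R H2 x h) \<le> M1 * (M2 * norm h)"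
        unfolding norm_scaleR using M1 M2 x eq by (intro mult_mono) auto
      moreover have "norm (f2 x *\<^sub>R H1 x h) \<le> M2 * (M1 * norm h)"
        unfolding norm_scaleR using M1 M2 x eq by (intro mult_mono) auto
      moreover have "norm ((G1 x \<bullet> h) *\<^sub>R G2 x) \<le> (M1 * norm h) * M2"
        unfolding norm_scaleR using M1 M2 x i by (intro mult_mono) auto
      moreover have "norm ((G2 x \<bullet> h) *\<^sub>R G1 x) \<le> (M2 * norm h) * M1"
        unfolding norm_scaleR using M1 M2 x i by (intro mult_mono) auto
      ultimately show "norm ((f1 x *\<^sub>R H2 x h + (G1 x \<bullet> h) *\<^sub>R G2 x) + (f2 x *\<^sub>R H1 x h + (G2 x \<bullet> h) *\<^sub>R G1 x)) \<le> 4 * M1 * M2 * norm h"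
        using norm_triangle_ineq[of "f1 x *\<^sub>R H2 x h + (G1 x \<bullet> h) *\<^sub>R G2 x" "f2 x *\<^sub>R H1 x h + (G2 x \<bullet> h) *\<^sub>R G1 x"]
          norm_triangle_ineq[of "f1 x *\<^sub>R H2 x h" "(G1 x \<bullet> h) *\<^sub>R G2 x"]
          norm_triangle_ineq[of "f2 x *\<^sub>R H1 x h" "(G2 x \<bullet> h) *\<^sub>R G1 x"]
        by (simp add: algebra_simps)
    qed
  qed
qed

lemma C2_with_compose:
  fixes \<phi> \<phi>' \<phi>'' :: "real \<Rightarrow> real" and f :: "'a::euclidean_space \<Rightarrow> real"
  assumes f: "C2_with f G"
    and \<phi>: "\<And>t. (\<phi> has_real_derivative \<phi>' t) (at t)" "\<And>t. (\<phi>' has_real_derivative \<phi>'' t) (at t)"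
    and c: "continuous_on UNIV \<phi>''"
  shows "C2_with (\<lambda>x. \<phi> (f x)) (\<lambda>x. \<phi>' (f x) *\<^sub>R G x)"
proof -
  obtain H where H: "\<And>x. (G has_derivative H x) (at x)" using f unfolding C2_with_def by blast
  have D': "((\<lambda>x. \<phi>' (f x)) has_derivative (\<lambda>h. \<phi>'' (f x) * (G x \<bullet> h))) (at x)" for x
    using has_derivative_compose[OF C2_withD[OF f] has_field_derivative_imp_has_derivative[OF \<phi>(2)]] by simp
  have D: "((\<lambda>x. \<phi> (f x)) has_derivative (\<lambda>h. \<phi>' (f x) * (G x \<bullet> h))) (at x)" for x
    using has_derivative_compose[OF C2_withD[OF f] has_field_derivative_imp_has_derivative[OF \<phi>(1)]] by simp
  show ?thesis
  proof (rule C2_withI[where H="\<lambda>x h. \<phi>' (f x) *\<^sub>R H x h + (\<phi>'' (f x) * (G x \<bullet> h)) *\<^sub>R G x"])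
    show "((\<lambda>x. \<phi> (f x)) has_derivative (\<lambda>h. (\<phi>' (f x) *\<^sub>R G x) \<bullet> h)) (at x)" for x
      using D by simp
    show "((\<lambda>x. \<phi>' (f x) *\<^sub>R G x) has_derivative (\<lambda>h. \<phi>' (f x) *\<^sub>R H x h + (\<phi>'' (f x) * (G x \<bullet> h)) *\<^sub>R G x)) (at x)" for x
      by (intro has_derivative_scaleR H D')
    fix R
    obtain M H' where M: "M \<ge> 0" "\<And>x. (G has_derivative H' x) (at x)"
      "\<And>x. norm x \<le> R \<Longrightarrow> \<bar>f x\<bar> \<le> M" "\<And>x. norm x \<le> R \<Longrightarrow> norm (G x) \<le> M"
      "\<And>x h. norm x \<le> R \<Longrightarrow> norm (H' x h) \<le> M * norm h" using C2_with_bounds[OF f, of R] by metis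
    have eq: "H' x = H x" for x using has_derivative_unique[OF M(2) H] by auto
    have "continuous_on UNIV \<phi>'" by (intro continuous_at_imp_continuous_on ballI DERIV_isCont[OF \<phi>(2)])
    then obtain M1 where M1: "M1 \<ge> 0" "\<And>t. norm t \<le> M \<Longrightarrow> norm (\<phi>' t) \<le> M1" using bounded_on_cball by blast
    obtain M2 where M2: "M2 \<ge> 0" "\<And>t. norm t \<le> M \<Longrightarrow> norm (\<phi>'' t) \<le> M2" using bounded_on_cball[OF c] by blast
    show "\<exists>M. \<forall>x. norm x \<le> R \<longrightarrow> (\<forall>h. norm (\<phi>' (f x) *\<^sub>R H x h + (\<phi>'' (f x) * (G x \<bullet> h)) *\<^sub>R G x) \<le> M * norm h)"
    proof (intro exI[of _ "M1 * M + M2 * M * M"] allI impI)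
      fix x h :: 'a assume x: "norm x \<le> R"
      have i: "\<bar>G x \<bullet> h\<bar> \<le> M * norm h"
        using Cauchy_Schwarz_ineq2[of "G x" h] mult_right_mono[OF M(4)[OF x], of "norm h"] by auto
      have "norm (\<phi>' (f x) *\<^sub>R H x h) \<le> M1 * (M * norm h)"
        unfolding norm_scaleR using M M1 x eq by (intro mult_mono) auto
      moreover have "norm ((\<phi>'' (f x) * (G x \<bullet> h)) *\<^sub>R G x) \<le> (M2 * (M * norm h)) * M"
        unfolding norm_scaleR abs_mult using M M2 x i by (intro mult_mono) auto
      ultimately show "norm (\<phi>' (f x) *\<^sub>R H x h + (\<phi>'' (f x) * (G x \<bullet> h)) *\<^sub>R G x) \<le> (M1 * M + M2 * M * M) * norm h"
        using norm_triangle_ineq[of "\<phi>' (f x) *\<^sub>R H x h" "(\<phi>'' (f x) * (G x \<bullet> h)) *\<^sub>R G x"]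
        by (simp add: algebra_simps)
    qed
  qed
qed

lemma C2_with_sum:
  assumes "finite I" "\<And>i. i \<in> I \<Longrightarrow> C2_with (f i) (G i)"
  shows "C2_with (\<lambda>x. \<Sum>i\<in>I. f i x) (\<lambda>x. \<Sum>i\<in>I. G i x)"
  using assms by (induction I rule: finite_induct) (auto intro: C2_with_const C2_with_add)

lemma C2_with_normsq: "C2_with (\<lambda>x. (norm (x - p))\<^sup>2) (\<lambda>x. 2 *\<^sub>R (x - p))"
proof (rule C2_withI[where H="\<lambda>x h. 2 *\<^sub>R h"])
  show "((\<lambda>x. (norm (x - p))\<^sup>2) has_derivative (\<lambda>h. 2 *\<^sub>R (x - p) \<bullet> h)) (at x)" for x
    unfolding power2_norm_eq_inner by (auto intro!: derivative_eq_intros simp: inner_commute)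
qed (auto intro!: derivative_eq_intros exI[of _ 2] has_derivative_scaleR_right has_derivative_ident)

section \<open>Geometry of the domain\<close>

text \<open>\<open>g\<close> is constant along \<open>e\<close>, so its gradient is orthogonal to
  \<open>e\<close>; the gradient of the height function therefore has \<open>e\<close>-component 1
  and never vanishes.\<close>

lemma C2_with_C3_graph:
  assumes "C3_graph_at \<Omega> p r e g"
  shows "C2_with (\<lambda>x. x \<bullet> e - g x) (\<lambda>x. e - grad UNIV g x)" (is ?C2)
    and "(e - grad UNIV g x) \<bullet> e = 1"
proof -
  have e: "norm e = 1" and g: "Ck (Suc (Suc (Suc 0))) UNIV UNIV g" and inv: "\<And>x t. g (x + t *\<^sub>R e) = g x"
    using assms by (auto simp: C3_graph_at_def numeral_3_eq_3 simp del: Ck.simps)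
  note g2 = Ck_C2_with[OF g]
  show ?C2
    using C2_with_add[OF C2_with_inner[of e] C2_with_mult[OF C2_with_const[of "-1"] g2]] by simp
  have "((\<lambda>t. g (x + t *\<^sub>R e)) has_real_derivative grad UNIV g x \<bullet> e) (at 0)"
    using has_derivative_line[of g "grad UNIV g x" x 0 e] C2_withD[OF g2, of x] by simp
  moreover have "((\<lambda>t. g (x + t *\<^sub>R e)) has_real_derivative 0) (at 0)" by (simp add: inv)
  ultimately have "grad UNIV g x \<bullet> e = 0" by (rule DERIV_unique)
  then show "(e - grad UNIV g x) \<bullet> e = 1" using e by (simp add: inner_diff_left dot_square_norm)
qed

lemma C3_graph_at_iff:
  assumes "C3_graph_at \<Omega> p r e g" "x \<in> ball p r"
  shows "x \<in> \<Omega> \<longleftrightarrow> x \<bullet> e - g x > 0"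
  using assms unfolding C3_graph_at_def by (auto simp: set_eq_iff)

lemma C3_graph_at_closure:
  assumes G: "C3_graph_at \<Omega> p r e g" and x: "x \<in> ball p r" "x \<in> closure \<Omega>"
  shows "x \<bullet> e - g x \<ge> 0"
proof -
  have c: "continuous_on UNIV (\<lambda>x. x \<bullet> e - g x)"
    by (rule C2_with_continuous(1)[OF C2_with_C3_graph(1)[OF G]])
  have op: "open {y \<in> ball p r. y \<bullet> e - g y < 0}"
  proof -
    have "open ((\<lambda>x. x \<bullet> e - g x) -` {..<0})" by (rule open_vimage[OF _ c]) auto
    moreover have "{y \<in> ball p r. y \<bullet> e - g y < 0} = ball p r \<inter> (\<lambda>x. x \<bullet> e - g x) -` {..<0}" by auto
    ultimately show ?thesis by auto
  qed
  have "{y \<in> ball p r. y \<bullet> e - g y < 0} \<inter> \<Omega> = {}" using C3_graph_at_iff[OF G] by force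
  then have "{y \<in> ball p r. y \<bullet> e - g y < 0} \<inter> closure \<Omega> = {}" using open_Int_closure_eq_empty[OF op] by blast
  then show ?thesis using x by fastforce
qed

lemma C3_graph_at_frontier:
  assumes "C3_graph_at \<Omega> p r e g" "x \<in> ball p r" "x \<in> frontier \<Omega>" "open \<Omega>"
  shows "x \<bullet> e - g x = 0"
proof -
  have "x \<notin> \<Omega>" "x \<in> closure \<Omega>" using assms by (auto simp: frontier_def interior_open)
  then show ?thesis using C3_graph_at_iff[OF assms(1,2)] C3_graph_at_closure[OF assms(1,2)] by auto
qed

section \<open>Comparison of normals and a global defining function\<close>

lemma pos_derivative_imp_pos:
  fixes h :: "'a::euclidean_space \<Rightarrow> real"
  assumes "(h has_derivative (\<lambda>v. G \<bullet> v)) (at x)" "h x = 0" "G \<bullet> w > 0"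
  shows "\<exists>d>0. \<forall>t. 0 < t \<longrightarrow> t < d \<longrightarrow> h (x + t *\<^sub>R w) > 0"
proof -
  have "((\<lambda>t. h (x + t *\<^sub>R w)) has_real_derivative G \<bullet> w) (at 0)"
    using has_derivative_line[of h G x 0 w] assms(1) by simp
  from DERIV_pos_inc_right[OF this assms(3)] show ?thesis using assms(2) by auto
qed

text \<open>If the directions differed, moving along \<open>w = sgn G1 - sgn G2\<close> would make
  \<open>h1\<close> increase and \<open>h2\<close> decrease, reaching points with
  \<open>h1 > 0 > h2\<close>. It shows that all local graphs at a boundary point give the same
  normal, and that this is also the normal of the global defining function.\<close>

lemma sgn_gradient_eq:
  fixes h1 h2 :: "'a::euclidean_space \<Rightarrow> real"
  assumes h1: "(h1 has_derivative (\<lambda>v. G1 \<bullet> v)) (at x)" "h1 x = 0" "G1 \<noteq> 0"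
    and h2: "(h2 has_derivative (\<lambda>v. G2 \<bullet> v)) (at x)" "h2 x = 0" "G2 \<noteq> 0"
    and sub: "d > 0" "\<And>y. y \<in> ball x d \<Longrightarrow> h1 y > 0 \<Longrightarrow> h2 y \<ge> 0"
  shows "sgn G1 = sgn G2"
proof (rule ccontr)
  assume ne: "sgn G1 \<noteq> sgn G2"
  define w where "w = sgn G1 - sgn G2"
  have n: "norm (sgn G1) = 1" "norm (sgn G2) = 1" using h1 h2 by (auto simp: norm_sgn)
  have "(norm w)\<^sup>2 > 0" using ne by (simp add: w_def)
  moreover have "(norm w)\<^sup>2 = 2 - 2 * (sgn G1 \<bullet> sgn G2)"
  proof -
    have "sgn G1 \<bullet> sgn G1 = 1" "sgn G2 \<bullet> sgn G2 = 1" using n by (simp_all add: dot_square_norm)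
    then show ?thesis unfolding w_def power2_norm_eq_inner
      by (simp add: inner_diff_left inner_diff_right inner_commute)
  qed
  ultimately have c: "sgn G1 \<bullet> sgn G2 < 1" by linarith
  have g: "G1 = norm G1 *\<^sub>R sgn G1" "G2 = norm G2 *\<^sub>R sgn G2" using h1(3) h2(3) by (simp_all add: sgn_div_norm)
  have "G1 \<bullet> w = norm G1 * (1 - sgn G1 \<bullet> sgn G2)"
    by (subst g(1)) (simp add: w_def inner_diff_right dot_square_norm n algebra_simps)
  then have p1: "G1 \<bullet> w > 0" using c h1 by simp
  have "(- G2) \<bullet> w = norm G2 * (1 - sgn G1 \<bullet> sgn G2)"
    by (subst g(2)) (simp add: w_def inner_diff_right dot_square_norm n inner_commute algebra_simps)
  then have p2: "(- G2) \<bullet> w > 0" using c h2 by simp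
  have h2': "((\<lambda>y. - h2 y) has_derivative (\<lambda>v. (- G2) \<bullet> v)) (at x)"
    using has_derivative_minus[OF h2(1)] by simp
  obtain d1 where d1: "d1 > 0" "\<And>t. 0 < t \<Longrightarrow> t < d1 \<Longrightarrow> h1 (x + t *\<^sub>R w) > 0"
    using pos_derivative_imp_pos[OF h1(1,2) p1] by blast
  obtain d2 where d2: "d2 > 0" "\<And>t. 0 < t \<Longrightarrow> t < d2 \<Longrightarrow> - h2 (x + t *\<^sub>R w) > 0"
    using pos_derivative_imp_pos[OF h2' _ p2] h2 by auto
  define d3 where "d3 = d / (norm w + 1)"
  have nw: "norm w + 1 > 0" by (simp add: add_nonneg_pos)
  have d3: "d3 > 0" using sub nw by (simp add: d3_def)
  define t where "t = min d1 (min d2 d3) / 2"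
  have t: "0 < t" "t < d1" "t < d2" "t < d3" using d1 d2 d3 by (auto simp: t_def)
  have "t * norm w \<le> t * (norm w + 1)" using t by (intro mult_left_mono) auto
  also have "\<dots> < d" using t(4) nw unfolding d3_def by (simp add: pos_less_divide_eq)
  finally have "x + t *\<^sub>R w \<in> ball x d" using t by (simp add: dist_norm)
  from sub(2)[OF this d1(2)] d2(2) t show False by fastforce
qed

text \<open>Used to see that the cube of the positive part is twice continuously differentiable, as
  a cutoff entering \<open>C2_with\<close> has to be. At 0 the difference quotient is dominated by
  \<open>(max 0 h) ^ n\<close>.\<close>

lemma DERIV_max_0_power:
  fixes t :: real
  assumes "n \<ge> 1"
  shows "((\<lambda>t. (max 0 t) ^ Suc n) has_real_derivative real (Suc n) * (max 0 t) ^ n) (at t)"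
proof -
  consider "t < 0" | "t = 0" | "t > 0" by linarith
  then show ?thesis
  proof cases
    case 1
    have "((\<lambda>t. 0) has_real_derivative 0) (at t)" by simp
    moreover have "\<forall>\<^sub>F s in nhds t. (0::real) = (max 0 s) ^ Suc n"
      using eventually_nhds_in_open[of "{..<0}" t] 1 by (auto elim!: eventually_mono)
    moreover have "0 = real (Suc n) * (max 0 t) ^ n" using 1 assms by simp
    ultimately show ?thesis
      using DERIV_cong_ev[of t t "\<lambda>t. 0" "\<lambda>t. (max 0 t) ^ Suc n" 0 "real (Suc n) * (max 0 t) ^ n"] by blast
  next
    case 3
    have "((\<lambda>t. t ^ Suc n) has_real_derivative real (Suc n) * t ^ n) (at t)"
      using DERIV_pow[of "Suc n" t] by simp
    moreover have "\<forall>\<^sub>F s in nhds t. s ^ Suc n = (max 0 s) ^ Suc n"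
      using eventually_nhds_in_open[of "{0<..}" t] 3 by (auto elim!: eventually_mono simp: max_def)
    moreover have "real (Suc n) * t ^ n = real (Suc n) * (max 0 t) ^ n" using 3 by simp
    ultimately show ?thesis
      using DERIV_cong_ev[of t t "\<lambda>t. t ^ Suc n" "\<lambda>t. (max 0 t) ^ Suc n" "real (Suc n) * t ^ n" "real (Suc n) * (max 0 t) ^ n"] by blast
  next
    case 2
    have lim: "((\<lambda>h::real. (max 0 h) ^ n) \<longlongrightarrow> 0) (at 0)"
    proof -
      have "((\<lambda>h::real. (max 0 h) ^ n) \<longlongrightarrow> (max 0 0) ^ n) (at 0)" by (intro tendsto_intros)
      moreover have "(max 0 0::real) ^ n = 0" using assms by simp
      ultimately show ?thesis by (simp only:)
    qed
    have "((\<lambda>h::real. ((max 0 h) ^ Suc n) / h) \<longlongrightarrow> 0) (at 0)"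
    proof (rule Lim_null_comparison[OF _ lim])
      show "\<forall>\<^sub>F h in at (0::real). norm ((max 0 h) ^ Suc n / h) \<le> (max 0 h) ^ n"
        by (rule eventuallyI) (auto simp: max_def abs_mult)
    qed
    moreover have z: "real (Suc n) * (max 0 t) ^ n = 0" using 2 assms by simp
    ultimately show ?thesis using 2 unfolding has_field_derivative_iff z by simp
  qed
qed

lemma C2_with_bump:
  "C2_with (\<lambda>x. (max 0 (r\<^sup>2 - (norm (x - p))\<^sup>2)) ^ 3)
     (\<lambda>x. (3 * (max 0 (r\<^sup>2 - (norm (x - p))\<^sup>2)) ^ 2) *\<^sub>R (-2 *\<^sub>R (x - p)))"
proof -
  have f: "C2_with (\<lambda>x. r\<^sup>2 - (norm (x - p))\<^sup>2) (\<lambda>x. -2 *\<^sub>R (x - p))"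
    using C2_with_add[OF C2_with_const[of "r\<^sup>2"] C2_with_mult[OF C2_with_const[of "-1"] C2_with_normsq[of p]]] by simp
  have "((\<lambda>t. (max 0 t) ^ 3) has_real_derivative 3 * (max 0 t) ^ 2) (at t)" for t :: real
    using DERIV_max_0_power[of 2 t] by (simp add: eval_nat_numeral)
  moreover have "((\<lambda>t. 3 * (max 0 t) ^ 2) has_real_derivative 6 * max 0 t) (at t)" for t :: real
    using DERIV_cmult[OF DERIV_max_0_power[of 1 t], of 3] by (simp add: eval_nat_numeral)
  ultimately show ?thesis
    by (rule C2_with_compose[OF f]) (auto intro!: continuous_intros)
qed

text \<open>In its ball each height function is positive exactly inside \<open>\<Omega>\<close>. The
  heights are glued with nonnegative bumps that need not sum to 1: on the frontier all heights
  vanish, so the gradient is a combination of their gradients with nonnegative weights, and these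
  gradients all point in the one normal direction, so nothing cancels. Outside the chosen balls
  \<open>\<rho>\<close> is 0; hence it is positive only in \<open>\<Omega>\<close>, but not
  necessarily on all of it.\<close>

lemma defining_function:
  fixes \<Omega> :: "'a::euclidean_space set"
  assumes dom: "bounded_domain \<Omega>" and C3: "C3_boundary \<Omega>"
  obtains \<rho> R where "C2_with \<rho> R" "\<And>x. x \<in> closure \<Omega> \<Longrightarrow> \<rho> x \<ge> 0"
    "\<And>x. x \<in> frontier \<Omega> \<Longrightarrow> \<rho> x = 0" "\<And>x. \<rho> x > 0 \<Longrightarrow> x \<in> \<Omega>"
    "\<And>x. x \<in> frontier \<Omega> \<Longrightarrow> R x \<noteq> 0"
    "\<And>x v. x \<in> frontier \<Omega> \<Longrightarrow> inward_unit_normal \<Omega> x v \<Longrightarrow> v = sgn (R x)"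
proof -
  have op: "open \<Omega>" and bd: "bounded \<Omega>" using dom by (auto simp: bounded_domain_def)
  obtain r e g where G: "\<And>p. p \<in> frontier \<Omega> \<Longrightarrow> C3_graph_at \<Omega> p (r p) (e p) (g p)"
    using C3 unfolding C3_boundary_def by metis
  have rp: "r p > 0" if "p \<in> frontier \<Omega>" for p using G[OF that] by (simp add: C3_graph_at_def)
  have "compact (frontier \<Omega>)" using bd by (rule compact_frontier_bounded)
  moreover have "frontier \<Omega> \<subseteq> \<Union> ((\<lambda>p. ball p (r p)) ` frontier \<Omega>)" using rp by force
  ultimately obtain F where F: "F \<subseteq> frontier \<Omega>" "finite F" "frontier \<Omega> \<subseteq> (\<Union>p\<in>F. ball p (r p))"
    using compactE_image[of "frontier \<Omega>" "frontier \<Omega>" "\<lambda>p. ball p (r p)"] by (metis open_ball)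
  define h where "h p x = x \<bullet> e p - g p x" for p x
  define Dh where "Dh p x = e p - grad UNIV (g p) x" for p x
  define bump where "bump p x = (max 0 ((r p)\<^sup>2 - (norm (x - p))\<^sup>2)) ^ 3" for p x :: 'a
  define Dbump where "Dbump p x = (3 * (max 0 ((r p)\<^sup>2 - (norm (x - p))\<^sup>2)) ^ 2) *\<^sub>R (-2 *\<^sub>R (x - p))" for p x :: 'a
  define \<rho> where "\<rho> x = (\<Sum>p\<in>F. bump p x * h p x)" for x
  define R where "R x = (\<Sum>p\<in>F. bump p x *\<^sub>R Dh p x + h p x *\<^sub>R Dbump p x)" for x
  have h: "C2_with (h p) (Dh p)" "Dh p x \<bullet> e p = 1" if "p \<in> F" for p x
    using C2_with_C3_graph[OF G] that F unfolding h_def[abs_def] Dh_def[abs_def] by auto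
  have Dh0: "Dh p x \<noteq> 0" if "p \<in> F" for p x using h(2)[OF that, of x] by auto
  have C2: "C2_with \<rho> R" unfolding \<rho>_def[abs_def] R_def[abs_def]
  proof (intro C2_with_sum F C2_with_mult h)
    show "C2_with (bump p) (Dbump p)" for p
      using C2_with_bump[of "r p" p] unfolding bump_def[abs_def] Dbump_def[abs_def] .
  qed
  have inball: "x \<in> ball p (r p) \<longleftrightarrow> (r p)\<^sup>2 - (norm (x - p))\<^sup>2 > 0" if "p \<in> F" for p x
  proof -
    have "norm (x - p) < r p \<longleftrightarrow> (norm (x - p))\<^sup>2 < (r p)\<^sup>2"
      using rp[of p] that F by (meson norm_ge_zero power2_less_imp_less power_strict_mono zero_less_numeral less_imp_le subsetD) 
    then show ?thesis by (simp add: dist_norm norm_minus_commute)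
  qed
  have chi: "bump p x \<ge> 0" "bump p x > 0 \<longleftrightarrow> x \<in> ball p (r p)" "x \<notin> ball p (r p) \<Longrightarrow> bump p x = 0" "x \<notin> ball p (r p) \<Longrightarrow> Dbump p x = 0"
    if "p \<in> F" for p x
    using inball[OF that, of x] by (auto simp: bump_def Dbump_def max_def)
  have fr0: "h p x = 0" if "p \<in> F" "x \<in> ball p (r p)" "x \<in> frontier \<Omega>" for p x
    unfolding h_def using C3_graph_at_frontier[OF G] that F op by auto
  have iff: "x \<in> \<Omega> \<longleftrightarrow> h p x > 0" if "p \<in> F" "x \<in> ball p (r p)" for p x
    unfolding h_def using C3_graph_at_iff[OF G] that F by auto
  have rho0: "\<rho> x = 0" if "x \<in> frontier \<Omega>" for x
    unfolding \<rho>_def using fr0 chi that by (intro sum.neutral) (metis mult_eq_0_iff)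
  have Rx: "\<exists>v. R x \<bullet> v > 0" if x: "x \<in> frontier \<Omega>" for x
  proof -
    obtain q where q: "q \<in> F" "x \<in> ball q (r q)" using F(3) x by auto
    define v where "v = sgn (Dh q x)"
    have same: "sgn (Dh p x) = v" if p: "p \<in> F" "x \<in> ball p (r p)" for p
    proof -
      obtain d where d: "d > 0" "ball x d \<subseteq> ball p (r p) \<inter> ball q (r q)"
        using open_contains_ball_eq[of "ball p (r p) \<inter> ball q (r q)" x] p q by blast
      show ?thesis unfolding v_def
      proof (rule sgn_gradient_eq[OF C2_withD[OF h(1)[OF p(1)]] fr0[OF p x] Dh0[OF p(1)]
            C2_withD[OF h(1)[OF q(1)]] fr0[OF q x] Dh0[OF q(1)] d(1)])
        show "h q y \<ge> 0" if "y \<in> ball x d" "h p y > 0" for y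
          using iff[of p y] iff[of q y] p q d that by fastforce
      qed
    qed
    have summand: "(bump p x *\<^sub>R Dh p x + h p x *\<^sub>R Dbump p x) \<bullet> v = bump p x * norm (Dh p x)" if p: "p \<in> F" for p
    proof (cases "x \<in> ball p (r p)")
      case True
      have "Dh p x \<bullet> v = norm (Dh p x)"
        unfolding same[OF p True, symmetric] using Dh0[OF p(1)] by (simp add: sgn_div_norm dot_square_norm power2_eq_square)
      then show ?thesis using fr0[OF p True x] by simp
    next
      case False
      then show ?thesis using chi[OF p] by simp
    qed
    have "R x \<bullet> v = (\<Sum>p\<in>F. bump p x * norm (Dh p x))"
      unfolding R_def inner_sum_left by (intro sum.cong refl summand)
    moreover have "bump q x * norm (Dh q x) > 0" using chi(2)[OF q(1)] q Dh0 by simp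
    then have "(\<Sum>p\<in>F. bump p x * norm (Dh p x)) > 0"
      using F(2) q(1) chi(1) by (intro sum_pos2[of F q]) auto
    ultimately show ?thesis by (intro exI[of _ v]) simp
  qed
  show thesis
  proof (rule that[OF C2])
    show "\<rho> x \<ge> 0" if "x \<in> closure \<Omega>" for x unfolding \<rho>_def
    proof (rule sum_nonneg)
      fix p assume p: "p \<in> F"
      show "bump p x * h p x \<ge> 0"
      proof (cases "x \<in> ball p (r p)")
        case True
        then have "h p x \<ge> 0" unfolding h_def using C3_graph_at_closure[OF G] that p F by auto
        then show ?thesis using chi(1)[OF p] by simp
      qed (use chi[OF p] in auto)
    qed
    show "\<rho> x = 0" if "x \<in> frontier \<Omega>" for x by (rule rho0[OF that])
    have pos: "x \<in> \<Omega>" if px: "\<rho> x > 0" for x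
    proof -
      obtain p where p: "p \<in> F" "bump p x * h p x > 0"
        using px sum_nonpos[of F "\<lambda>p. bump p x * h p x"] unfolding \<rho>_def by fastforce
      then have "bump p x > 0" "h p x > 0" using chi(1)[OF p(1), of x] by (auto simp: zero_less_mult_iff)
      then show ?thesis using iff[OF p(1)] chi(2)[OF p(1)] by auto
    qed
    then show "x \<in> \<Omega>" if "\<rho> x > 0" for x using that .
    have nz: "R x \<noteq> 0" if "x \<in> frontier \<Omega>" for x using Rx[OF that] by auto
    then show "R x \<noteq> 0" if "x \<in> frontier \<Omega>" for x using that .
    show "v = sgn (R x)" if x: "x \<in> frontier \<Omega>" and v: "inward_unit_normal \<Omega> x v" for x v
    proof -
      obtain r' e' g' where G': "C3_graph_at \<Omega> x r' e' g'" and v: "v = sgn (e' - grad UNIV g' x)"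
        using v unfolding inward_unit_normal_def by blast
      have r': "r' > 0" using G' by (simp add: C3_graph_at_def)
      have "sgn (R x) = sgn (e' - grad UNIV g' x)"
      proof (rule sgn_gradient_eq[OF C2_withD[OF C2] rho0[OF x] nz[OF x] C2_withD[OF C2_with_C3_graph(1)[OF G']] _ _ r'])
        show "x \<bullet> e' - g' x = 0" using C3_graph_at_frontier[OF G' _ x op] r' by simp
        show "e' - grad UNIV g' x \<noteq> 0" using C2_with_C3_graph(2)[OF G', of x] by auto
        show "0 \<le> y \<bullet> e' - g' y" if "y \<in> ball x r'" "\<rho> y > 0" for y
          using C3_graph_at_iff[OF G' that(1)] pos[OF that(2)] by simp
      qed
      then show ?thesis using v by simp
    qed
  qed
qed

section \<open>Paths comparable to the distance and Lipschitz bounds on the closure\<close>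

lemma lipschitz_on_segment:
  fixes h :: "'a::euclidean_space \<Rightarrow> real"
  assumes "closed_segment x y \<subseteq> \<Omega>" "\<And>x. x \<in> \<Omega> \<Longrightarrow> (h has_derivative (\<lambda>v. D x \<bullet> v)) (at x)"
    "\<And>x. x \<in> \<Omega> \<Longrightarrow> norm (D x) \<le> L"
  shows "\<bar>h x - h y\<bar> \<le> L * norm (x - y)"
proof -
  have "norm (h x - h y) \<le> L * norm (x - y)"
  proof (rule differentiable_bound[of "closed_segment x y" h "\<lambda>z v. D z \<bullet> v"])
    show "(h has_derivative (\<lambda>v. D z \<bullet> v)) (at z within closed_segment x y)" if "z \<in> closed_segment x y" for z
      using assms(1,2) that has_derivative_at_withinI by blast
    show "onorm (\<lambda>v. D z \<bullet> v) \<le> L" if "z \<in> closed_segment x y" for z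
    proof (rule onorm_le)
      fix v :: 'a
      have "norm (D z) * norm v \<le> L * norm v" using assms(1,3) that by (intro mult_right_mono) auto
      then show "norm (D z \<bullet> v) \<le> L * norm v" using Cauchy_Schwarz_ineq2[of "D z" v] by simp
    qed
  qed auto
  then show ?thesis by simp
qed

text \<open>Three segments are enough for pairs of points near a graph. They have to stay in the
  open set, where the derivatives exist.\<close>

definition joined_by_short_path :: "'a::euclidean_space set \<Rightarrow> real \<Rightarrow> 'a \<Rightarrow> 'a \<Rightarrow> bool" where
  "joined_by_short_path \<Omega> \<Lambda> x y \<longleftrightarrow> (\<exists>a b. closed_segment x a \<subseteq> \<Omega> \<and> closed_segment a b \<subseteq> \<Omega> \<and> closed_segment b y \<subseteq> \<Omega>
     \<and> norm (x - a) + norm (a - b) + norm (b - y) \<le> \<Lambda> * norm (x - y))"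

lemma joined_by_short_path_mono:
  "joined_by_short_path \<Omega> \<Lambda> x y \<Longrightarrow> \<Lambda> \<le> \<Lambda>' \<Longrightarrow> joined_by_short_path \<Omega> \<Lambda>' x y"
  unfolding joined_by_short_path_def by (meson order_trans mult_right_mono norm_ge_zero)

lemma joined_by_short_path_lipschitz:
  fixes h :: "'a::euclidean_space \<Rightarrow> real"
  assumes "joined_by_short_path \<Omega> \<Lambda> x y" "\<And>x. x \<in> \<Omega> \<Longrightarrow> (h has_derivative (\<lambda>v. D x \<bullet> v)) (at x)"
    "\<And>x. x \<in> \<Omega> \<Longrightarrow> norm (D x) \<le> L" and L: "L \<ge> 0"
  shows "\<bar>h x - h y\<bar> \<le> \<Lambda> * L * norm (x - y)"
proof -
  obtain a b where ab: "closed_segment x a \<subseteq> \<Omega>" "closed_segment a b \<subseteq> \<Omega>" "closed_segment b y \<subseteq> \<Omega>"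
    "norm (x - a) + norm (a - b) + norm (b - y) \<le> \<Lambda> * norm (x - y)"
    using assms(1) unfolding joined_by_short_path_def by blast
  note l = lipschitz_on_segment[OF _ assms(2,3)]
  have "\<bar>h x - h y\<bar> \<le> L * norm (x - a) + L * norm (a - b) + L * norm (b - y)"
    using l[OF ab(1)] l[OF ab(2)] l[OF ab(3)] by linarith
  also have "\<dots> = L * (norm (x - a) + norm (a - b) + norm (b - y))" by (simp add: algebra_simps)
  also have "\<dots> \<le> L * (\<Lambda> * norm (x - y))" using ab(4) L by (intro mult_left_mono)
  finally show ?thesis by (simp add: mult_ac)
qed

text \<open>Near a boundary point the path goes up along the graph direction by a multiple of the
  distance, across, and down again.\<close>

lemma graph_joined_by_short_path:
  fixes \<Omega> :: "'a::euclidean_space set"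
  assumes G: "C3_graph_at \<Omega> p r e g"
  obtains r1 \<Lambda> where "r1 > 0" "\<And>x y. x \<in> \<Omega> \<inter> ball p r1 \<Longrightarrow> y \<in> \<Omega> \<inter> ball p r1 \<Longrightarrow> joined_by_short_path \<Omega> \<Lambda> x y"
proof -
  have e: "norm e = 1" and r: "r > 0" and inv: "\<And>x t. g (x + t *\<^sub>R e) = g x"
    and g: "Ck (Suc (Suc (Suc 0))) UNIV UNIV g"
    using G by (auto simp: C3_graph_at_def numeral_3_eq_3 simp del: Ck.simps)
  have ee: "e \<bullet> e = 1" using e by (simp add: dot_square_norm)
  note g2 = Ck_C2_with[OF g]
  obtain m where m: "m \<ge> 0" "\<And>x. norm x \<le> norm p + r \<Longrightarrow> norm (grad UNIV g x) \<le> m"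
    using bounded_on_cball[OF C2_with_continuous(2)[OF g2], of "norm p + r"] by blast
  \<comment> \<open>\<open>m\<close> bounds the slope of the graph, and the extra 1 pays for the
    change of height along the shifted segment. The radius \<open>r1\<close> is such that a lift by
    \<open>M t\<close> with \<open>t < 2 r1\<close> stays in the ball of radius
    \<open>r\<close>.\<close>
  define M where "M = m + 1"
  define r1 where "r1 = r / (2 * M + 1)"
  have M: "M \<ge> 1" using m by (simp add: M_def)
  have r1: "r1 > 0" "r1 * (2 * M + 1) = r" using r M by (auto simp: r1_def)
  have r1r: "r1 \<le> r" using r1 M mult_left_mono[of 1 "2 * M + 1" r1] by simp
  have glip: "\<bar>g x - g y\<bar> \<le> m * norm (x - y)" if "x \<in> ball p r" "y \<in> ball p r" for x y
  proof (rule lipschitz_on_segment[where \<Omega>="ball p r"])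
    show "closed_segment x y \<subseteq> ball p r" using that by (intro closed_segment_subset) auto
    show "norm (grad UNIV g z) \<le> m" if "z \<in> ball p r" for z
      using that norm_triangle_sub[of z p] by (intro m) (simp add: dist_norm norm_minus_commute)
  qed (rule C2_withD[OF g2])
  have main: "closed_segment x (x + (M * t) *\<^sub>R e) \<subseteq> \<Omega>"
    if x: "x \<in> \<Omega> \<inter> ball p r1" and t: "0 \<le> t" "t < 2 * r1" for x t
  proof
    fix z assume "z \<in> closed_segment x (x + (M * t) *\<^sub>R e)"
    then obtain u where u: "0 \<le> u" "u \<le> 1" "z = x + (u * (M * t)) *\<^sub>R e"
      by (auto simp: in_segment algebra_simps)
    have "norm (z - p) \<le> norm (x - p) + u * (M * t)"
      using norm_triangle_ineq[of "x - p" "(u * (M * t)) *\<^sub>R e"] u e M t by (simp add: algebra_simps abs_mult)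
    also have "u * (M * t) \<le> M * t" using u M t by (simp add: mult_left_le_one_le)
    also have "M * t \<le> M * (2 * r1)" using t M by (intro mult_left_mono) auto
    also have "norm (x - p) + M * (2 * r1) < r1 + M * (2 * r1)" using x by (simp add: dist_norm norm_minus_commute)
    also have "\<dots> = r" using r1(2) by (simp add: algebra_simps)
    finally have zb: "z \<in> ball p r" by (simp add: dist_norm norm_minus_commute)
    have "x \<bullet> e - g x > 0" using C3_graph_at_iff[OF G, of x] x r1r by auto
    moreover have "u * (M * t) \<ge> 0" using u M t by simp
    ultimately have "z \<bullet> e - g z > 0" by (simp add: u(3) inner_add_left ee inv)
    then show "z \<in> \<Omega>" using C3_graph_at_iff[OF G zb] by simp
  qed
  have "joined_by_short_path \<Omega> (2 * M + 1) x y" if x: "x \<in> \<Omega> \<inter> ball p r1" and y: "y \<in> \<Omega> \<inter> ball p r1" for x y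
  proof -
    define t where "t = norm (x - y)"
    have t: "0 \<le> t" "t < 2 * r1"
      using x y norm_triangle_ineq4[of "x - p" "y - p"] by (auto simp: t_def dist_norm norm_minus_commute)
    define a b where "a = x + (M * t) *\<^sub>R e" and "b = y + (M * t) *\<^sub>R e"
    have "closed_segment a b \<subseteq> \<Omega>"
    proof
      fix z assume "z \<in> closed_segment a b"
      then obtain u where u: "0 \<le> u" "u \<le> 1" "z = (1 - u) *\<^sub>R a + u *\<^sub>R b" by (auto simp: in_segment)
      define w where "w = (1 - u) *\<^sub>R x + u *\<^sub>R y"
      have z: "z = w + (M * t) *\<^sub>R e" by (simp add: u(3) a_def b_def w_def algebra_simps)
      have "w \<in> closed_segment x y" using u by (auto simp: in_segment w_def)
      then have w: "w \<in> ball p r1" using x y closed_segment_subset[of x "ball p r1" y] by auto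
      have "w - x = u *\<^sub>R (y - x)" by (simp add: w_def algebra_simps)
      then have wx: "norm (w - x) \<le> t" using u by (simp add: t_def norm_minus_commute mult_left_le_one_le)
      have "norm (z - p) \<le> norm (w - p) + M * t"
        using norm_triangle_ineq[of "w - p" "(M * t) *\<^sub>R e"] e M t by (simp add: z algebra_simps abs_mult)
      also have "M * t \<le> M * (2 * r1)" using t M by (intro mult_left_mono) auto
      also have "norm (w - p) + M * (2 * r1) < r1 + M * (2 * r1)" using w by (simp add: dist_norm norm_minus_commute)
      also have "\<dots> = r" using r1(2) by (simp add: algebra_simps)
      finally have zb: "z \<in> ball p r" by (simp add: dist_norm norm_minus_commute)
      have "\<bar>(w - x) \<bullet> e\<bar> \<le> t" using Cauchy_Schwarz_ineq2[of "w - x" e] e wx by simp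
      moreover have "\<bar>g w - g x\<bar> \<le> m * t"
        using glip[of w x] w x r1r wx m mult_left_mono[OF wx m(1)] by fastforce
      moreover have "x \<bullet> e - g x > 0" using C3_graph_at_iff[OF G, of x] x r1r by auto
      moreover have "z \<bullet> e - g z = w \<bullet> e + M * t - g w" by (simp add: z inner_add_left ee inv)
      moreover have "M * t = m * t + t" by (simp add: M_def algebra_simps)
      ultimately have "z \<bullet> e - g z > 0" by (simp add: inner_diff_left abs_le_iff)
      then show "z \<in> \<Omega>" using C3_graph_at_iff[OF G zb] by simp
    qed
    moreover have "closed_segment x a \<subseteq> \<Omega>" "closed_segment b y \<subseteq> \<Omega>"
      using main[OF x t] main[OF y t] by (auto simp: a_def b_def closed_segment_commute)
    moreover have "norm (x - a) + norm (a - b) + norm (b - y) = (2 * M + 1) * norm (x - y)"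
      using e M t by (simp add: a_def b_def t_def algebra_simps)
    ultimately show ?thesis unfolding joined_by_short_path_def by (intro exI[of _ a] exI[of _ b]) auto
  qed
  then show thesis using that r1(1) by blast
qed

text \<open>The bound \<open>L\<close> is demanded of the derivative and of the values: short paths
  are constructed for nearby points only, and distant points are handled through the values.
  Quantifying over all functions lets one constant of the domain serve \<open>f\<close>,
  \<open>\<psi>\<close> and \<open>u\<close>.\<close>

definition quasi_lipschitz_constant :: "'a::euclidean_space set \<Rightarrow> real \<Rightarrow> bool" where
  "quasi_lipschitz_constant \<Omega> \<Lambda> \<longleftrightarrow> (\<forall>h D L. (\<forall>x\<in>\<Omega>. ((h :: 'a \<Rightarrow> real) has_derivative (\<lambda>v. D x \<bullet> v)) (at x) \<and> norm (D x) \<le> L)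
     \<longrightarrow> continuous_on (closure \<Omega>) h \<longrightarrow> (\<forall>x\<in>closure \<Omega>. \<bar>h x\<bar> \<le> L)
     \<longrightarrow> (\<forall>x\<in>closure \<Omega>. \<forall>y\<in>closure \<Omega>. \<bar>h x - h y\<bar> \<le> \<Lambda> * L * norm (x - y)))"

lemma quasi_lipschitz_constantD:
  fixes h :: "'a::euclidean_space \<Rightarrow> real"
  assumes "quasi_lipschitz_constant \<Omega> \<Lambda>" "\<And>x. x \<in> \<Omega> \<Longrightarrow> (h has_derivative (\<lambda>v. D x \<bullet> v)) (at x)"
    "\<And>x. x \<in> \<Omega> \<Longrightarrow> norm (D x) \<le> L" "continuous_on (closure \<Omega>) h" "\<And>x. x \<in> closure \<Omega> \<Longrightarrow> \<bar>h x\<bar> \<le> L"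
    "x \<in> closure \<Omega>" "y \<in> closure \<Omega>"
  shows "\<bar>h x - h y\<bar> \<le> \<Lambda> * L * norm (x - y)"
proof -
  have "\<forall>x\<in>\<Omega>. (h has_derivative (\<lambda>v. D x \<bullet> v)) (at x) \<and> norm (D x) \<le> L" using assms(2,3) by blast
  then show ?thesis using assms(1,4-7) unfolding quasi_lipschitz_constant_def by blast
qed

lemma quasiconvex_lipschitz:
  fixes \<Omega> :: "'a::euclidean_space set"
  assumes dom: "bounded_domain \<Omega>" and C3: "C3_boundary \<Omega>"
  obtains \<Lambda> where "\<Lambda> \<ge> 1" "quasi_lipschitz_constant \<Omega> \<Lambda>"
proof -
  have op: "open \<Omega>" and bd: "bounded \<Omega>" using dom by (auto simp: bounded_domain_def)
  have "\<exists>r1>0. \<exists>\<Lambda>. \<forall>x\<in>\<Omega> \<inter> ball p r1. \<forall>y\<in>\<Omega> \<inter> ball p r1. joined_by_short_path \<Omega> \<Lambda> x y" if "p \<in> closure \<Omega>" for p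
  proof (cases "p \<in> \<Omega>")
    case True
    then obtain r where r: "r > 0" "ball p r \<subseteq> \<Omega>" using op open_contains_ball by blast
    have "joined_by_short_path \<Omega> 1 x y" if "x \<in> ball p r" "y \<in> ball p r" for x y
      unfolding joined_by_short_path_def
      using closed_segment_subset[of x "ball p r" y] that r by (intro exI[of _ y]) auto
    then show ?thesis using r by blast
  next
    case False
    then have "p \<in> frontier \<Omega>" using that op by (simp add: frontier_def interior_open)
    then obtain r e g where "C3_graph_at \<Omega> p r e g" using C3 unfolding C3_boundary_def by blast
    from graph_joined_by_short_path[OF this] show ?thesis by (metis (lifting))
  qed
  then obtain r1 \<Lambda>1 where r1: "\<And>p. p \<in> closure \<Omega> \<Longrightarrow> r1 p > 0"
    "\<And>p x y. p \<in> closure \<Omega> \<Longrightarrow> x \<in> \<Omega> \<inter> ball p (r1 p) \<Longrightarrow> y \<in> \<Omega> \<inter> ball p (r1 p) \<Longrightarrow> joined_by_short_path \<Omega> (\<Lambda>1 p) x y"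
    by metis
  have cpt: "compact (closure \<Omega>)" using bd by (simp add: compact_closure)
  have "closure \<Omega> \<subseteq> \<Union> ((\<lambda>p. ball p (r1 p)) ` closure \<Omega>)" using r1 by force
  then obtain F where F: "F \<subseteq> closure \<Omega>" "finite F" "closure \<Omega> \<subseteq> (\<Union>p\<in>F. ball p (r1 p))"
    using compactE_image[OF cpt, of "closure \<Omega>" "\<lambda>p. ball p (r1 p)"] by (metis open_ball)
  \<comment> \<open>A Lebesgue number of the cover: points closer than \<open>r0\<close> share a
    ball with short paths. For the others the summand \<open>2 / r0\<close> of
    \<open>\<Lambda>\<close> makes the trivial bound \<open>2 L\<close> sufficient.\<close>
  obtain r0 where r0: "r0 > 0" "\<And>x. x \<in> closure \<Omega> \<Longrightarrow> \<exists>G\<in>(\<lambda>p. ball p (r1 p)) ` F. ball x r0 \<subseteq> G"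
    using Heine_Borel_lemma[OF cpt, of "(\<lambda>p. ball p (r1 p)) ` F"] F by auto
  define \<Lambda> where "\<Lambda> = 1 + 2 / r0 + (\<Sum>p\<in>F. \<bar>\<Lambda>1 p\<bar>)"
  have \<Lambda>: "\<Lambda> \<ge> 1" "\<Lambda> \<ge> 2 / r0" "\<And>p. p \<in> F \<Longrightarrow> \<Lambda> \<ge> \<Lambda>1 p"
  proof -
    have S: "(\<Sum>p\<in>F. \<bar>\<Lambda>1 p\<bar>) \<ge> 0" by (simp add: sum_nonneg)
    then show "\<Lambda> \<ge> 1" "\<Lambda> \<ge> 2 / r0" using r0(1) by (simp_all add: \<Lambda>_def)
    show "\<Lambda> \<ge> \<Lambda>1 p" if "p \<in> F" for p
    proof -
      have "\<bar>\<Lambda>1 p\<bar> \<le> (\<Sum>p\<in>F. \<bar>\<Lambda>1 p\<bar>)" using F(2) that by (intro member_le_sum) auto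
      moreover have "2 / r0 > 0" using r0(1) by simp
      ultimately show ?thesis unfolding \<Lambda>_def by linarith
    qed
  qed
  show thesis
  proof (rule that[OF \<Lambda>(1)], unfold quasi_lipschitz_constant_def, intro allI impI ballI)
    fix h :: "'a \<Rightarrow> real" and D L x y
    assume h': "\<forall>x\<in>\<Omega>. (h has_derivative (\<lambda>v. D x \<bullet> v)) (at x) \<and> norm (D x) \<le> L"
      "continuous_on (closure \<Omega>) h" "\<forall>x\<in>closure \<Omega>. \<bar>h x\<bar> \<le> L" and xy: "x \<in> closure \<Omega>" "y \<in> closure \<Omega>"
    have h: "\<And>x. x \<in> \<Omega> \<Longrightarrow> (h has_derivative (\<lambda>v. D x \<bullet> v)) (at x)" "\<And>x. x \<in> \<Omega> \<Longrightarrow> norm (D x) \<le> L"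
      "continuous_on (closure \<Omega>) h" "\<And>x. x \<in> closure \<Omega> \<Longrightarrow> \<bar>h x\<bar> \<le> L"
      using h' by auto
    have L: "L \<ge> 0" using h(4)[OF xy(1)] by linarith
    have open_case: "\<bar>h x - h y\<bar> \<le> \<Lambda> * L * norm (x - y)" if x: "x \<in> \<Omega>" and y: "y \<in> \<Omega>" for x y
    proof (cases "norm (x - y) < r0")
      case True
      have xc: "x \<in> closure \<Omega>" using x closure_subset by auto
      obtain p where p: "p \<in> F" "ball x r0 \<subseteq> ball p (r1 p)" using r0(2)[OF xc] by auto
      have "x \<in> ball x r0" "y \<in> ball x r0" using r0(1) True by (auto simp: dist_norm)
      then have "joined_by_short_path \<Omega> (\<Lambda>1 p) x y" using r1(2)[of p x y] p F x y by blast
      then have "joined_by_short_path \<Omega> \<Lambda> x y" using joined_by_short_path_mono \<Lambda>(3)[OF p(1)] by blast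
      then show ?thesis by (rule joined_by_short_path_lipschitz[OF _ h(1,2) L])
    next
      case False
      have xc: "x \<in> closure \<Omega>" "y \<in> closure \<Omega>" using x y closure_subset by auto
      have "2 \<le> \<Lambda> * norm (x - y)"
      proof -
        have "2 = (2 / r0) * r0" using r0 by simp
        also have "\<dots> \<le> \<Lambda> * norm (x - y)" using False r0 \<Lambda> by (intro mult_mono) auto
        finally show ?thesis .
      qed
      then have "L * 2 \<le> L * (\<Lambda> * norm (x - y))" using L by (intro mult_left_mono)
      moreover have "\<bar>h x - h y\<bar> \<le> L * 2" using h(4)[OF xc(1)] h(4)[OF xc(2)] by linarith
      ultimately show ?thesis by (simp add: mult_ac)
    qed
    have "(\<lambda>p. \<bar>h (fst p) - h (snd p)\<bar> - \<Lambda> * L * norm (fst p - snd p)) (x, y) \<le> 0"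
    proof (rule continuous_le_on_closure[of "\<Omega> \<times> \<Omega>"])
      show "continuous_on (closure (\<Omega> \<times> \<Omega>)) (\<lambda>p. \<bar>h (fst p) - h (snd p)\<bar> - \<Lambda> * L * norm (fst p - snd p))"
        unfolding closure_Times
        by (intro continuous_intros continuous_on_compose2[OF h(3)]) auto
      show "(x, y) \<in> closure (\<Omega> \<times> \<Omega>)" using xy by (simp add: closure_Times)
      show "\<bar>h (fst p) - h (snd p)\<bar> - \<Lambda> * L * norm (fst p - snd p) \<le> 0" if "p \<in> \<Omega> \<times> \<Omega>" for p
        using open_case[of "fst p" "snd p"] that by auto
    qed
    then show "\<bar>h x - h y\<bar> \<le> \<Lambda> * L * norm (x - y)" by simp
  qed
qed

section \<open>Data on the cylinder\<close>

lemma grad_prod_eq: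
  "grad U f p = (grad_x U f p, deriv_z U f p)" for U :: "('a::euclidean_space \<times> real) set"
proof (rule prod_eqI)
  have i: "grad U f p \<bullet> b = dir_deriv U b f p" if "b \<in> Basis" for b
    unfolding grad_def using that by simp
  show "fst (grad U f p) = fst (grad_x U f p, deriv_z U f p)"
  proof (rule euclidean_eqI)
    fix b :: 'a assume b: "b \<in> Basis"
    then have "(b, 0::real) \<in> Basis" by (simp add: Basis_prod_def)
    from i[OF this] show "fst (grad U f p) \<bullet> b = fst (grad_x U f p, deriv_z U f p) \<bullet> b"
      using b by (simp add: inner_prod_def grad_x_def)
  qed
  have "(0::'a, 1::real) \<in> Basis" by (simp add: Basis_prod_def)
  from i[OF this] show "snd (grad U f p) = snd (grad_x U f p, deriv_z U f p)"
    by (simp add: inner_prod_def deriv_z_def)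
qed

text \<open>Derivatives in the cylinder are available for \<open>|z| < M0\<close>, whereas
  \<open>u\<close> may attain \<open>M0\<close> or \<open>- M0\<close>. Estimates are proved in the
  open interval and passed to the endpoints by continuity.\<close>

lemma le_on_closed_interval:
  fixes M0 :: real and h :: "real \<Rightarrow> real"
  assumes M0: "M0 > 0" and h: "continuous_on {-M0..M0} h" "z \<in> {-M0..M0}" "\<And>z. \<bar>z\<bar> < M0 \<Longrightarrow> h z \<le> c"
  shows "h z \<le> c"
proof (rule continuous_le_on_closure[of "{-M0<..<M0}" h z c])
  show "continuous_on (closure {-M0<..<M0}) h" "z \<in> closure {-M0<..<M0}" using M0 h by auto
  show "h z \<le> c" if "z \<in> {-M0<..<M0}" for z using h(3)[of z] that by auto
qed

context
  fixes \<Omega> :: "'a::euclidean_space set" and M0 :: real and f :: "'a \<times> real \<Rightarrow> real"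
  assumes f: "Ck 1 (open_cyl \<Omega> M0) (closed_cyl \<Omega> M0) f" and M0: "M0 > 0"
begin

lemma cyl_continuous: "continuous_on (closed_cyl \<Omega> M0) f"
  using f by (rule Ck_continuous_on)

lemma cyl_has_derivative:
  assumes "x \<in> \<Omega>" "\<bar>z\<bar> < M0"
  shows "((\<lambda>x. f (x, z)) has_derivative (\<lambda>v. grad_x (open_cyl \<Omega> M0) f (x, z) \<bullet> v)) (at x)"
    and "((\<lambda>z. f (x, z)) has_real_derivative deriv_z (open_cyl \<Omega> M0) f (x, z)) (at z)"
proof -
  have p: "(x, z) \<in> open_cyl \<Omega> M0" using assms by auto
  have f': "Ck (Suc 0) (open_cyl \<Omega> M0) (closed_cyl \<Omega> M0) f" using f by (simp only: One_nat_def)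
  have D: "(f has_derivative (\<lambda>h. grad (open_cyl \<Omega> M0) f (x, z) \<bullet> h)) (at (x, z))"
    by (rule has_derivative_grad[OF Ck_Suc_differentiable[OF f' p] p])
  have 1: "((\<lambda>x. (x, z)) has_derivative (\<lambda>v. (v, 0))) (at x)"
    by (intro has_derivative_Pair has_derivative_ident has_derivative_const)
  from has_derivative_compose[OF 1 D]
  show "((\<lambda>x. f (x, z)) has_derivative (\<lambda>v. grad_x (open_cyl \<Omega> M0) f (x, z) \<bullet> v)) (at x)"
    by (simp add: grad_prod_eq inner_prod_def)
  have 2: "((\<lambda>z. (x, z)) has_derivative (\<lambda>v. (0, v))) (at z)"
    by (intro has_derivative_Pair has_derivative_ident has_derivative_const)
  from has_derivative_compose[OF 2 D]
  show "((\<lambda>z. f (x, z)) has_real_derivative deriv_z (open_cyl \<Omega> M0) f (x, z)) (at z)"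
    by (simp add: grad_prod_eq inner_prod_def has_field_derivative_def)
qed

lemma cyl_lipschitz_x:
  assumes "bounded_domain \<Omega>"
    and \<Lambda>: "quasi_lipschitz_constant \<Omega> \<Lambda>"
    and L: "\<And>p. p \<in> closed_cyl \<Omega> M0 \<Longrightarrow> \<bar>f p\<bar> \<le> L" "\<And>p. p \<in> closed_cyl \<Omega> M0 \<Longrightarrow> norm (grad_x (open_cyl \<Omega> M0) f p) \<le> L"
    and xy: "x \<in> closure \<Omega>" "y \<in> closure \<Omega>" "z \<in> {-M0..M0}"
  shows "\<bar>f (x, z) - f (y, z)\<bar> \<le> \<Lambda> * L * norm (x - y)"
proof (rule le_on_closed_interval[OF M0 _ xy(3)])
  show "continuous_on {- M0..M0} (\<lambda>z. \<bar>f (x, z) - f (y, z)\<bar>)"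
    using xy by (intro continuous_intros continuous_on_compose2[OF cyl_continuous]) auto
  fix z assume z: "\<bar>z\<bar> < M0"
  show "\<bar>f (x, z) - f (y, z)\<bar> \<le> \<Lambda> * L * norm (x - y)"
  proof (rule quasi_lipschitz_constantD[OF \<Lambda>, of "\<lambda>x. f (x, z)" "\<lambda>x. grad_x (open_cyl \<Omega> M0) f (x, z)", OF _ _ _ _ xy(1,2)])
    show "continuous_on (closure \<Omega>) (\<lambda>x. f (x, z))"
      using z by (intro continuous_intros continuous_on_compose2[OF cyl_continuous]) auto
    show "\<bar>f (x, z)\<bar> \<le> L" if "x \<in> closure \<Omega>" for x using that z by (intro L) auto
    show "norm (grad_x (open_cyl \<Omega> M0) f (x, z)) \<le> L" if "x \<in> \<Omega>" for x
      using that z closure_subset by (intro L) auto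
  qed (use cyl_has_derivative z in auto)
qed

lemma cyl_mono_z:
  assumes "\<And>p. p \<in> closed_cyl \<Omega> M0 \<Longrightarrow> deriv_z (open_cyl \<Omega> M0) f p \<ge> 0"
    and "x \<in> \<Omega>" "- M0 \<le> z" "z \<le> z'" "z' \<le> M0"
  shows "f (x, z) \<le> f (x, z')"
proof (rule DERIV_nonneg_imp_increasing_open[OF assms(4)])
  have xc: "x \<in> closure \<Omega>" using assms(2) closure_subset by auto
  show "\<exists>y. ((\<lambda>z. f (x, z)) has_real_derivative y) (at t) \<and> 0 \<le> y" if "z < t" "t < z'" for t
    using cyl_has_derivative(2)[OF assms(2), of t] assms(1)[of "(x, t)"] xc that assms by force
  show "continuous_on {z..z'} (\<lambda>z. f (x, z))"
    using xc assms by (intro continuous_intros continuous_on_compose2[OF cyl_continuous]) auto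
qed

lemma cyl_lipschitz_z:
  assumes L: "\<And>p. p \<in> closed_cyl \<Omega> M0 \<Longrightarrow> \<bar>deriv_z (open_cyl \<Omega> M0) f p\<bar> \<le> L"
    and x: "x \<in> closure \<Omega>" and z: "z \<in> {-M0..M0}" "z' \<in> {-M0..M0}"
  shows "\<bar>f (x, z) - f (x, z')\<bar> \<le> L * \<bar>z - z'\<bar>"
proof -
  have inner: "\<bar>f (x, z) - f (x, z')\<bar> \<le> L * \<bar>z - z'\<bar>" if "x \<in> \<Omega>" "\<bar>z\<bar> < M0" "\<bar>z'\<bar> < M0" for x z z'
  proof -
    have xc: "x \<in> closure \<Omega>" using that(1) closure_subset by auto
    have "norm (f (x, z) - f (x, z')) \<le> L * norm (z - z')"
    proof (rule field_differentiable_bound[of "{-M0<..<M0}" "\<lambda>z. f (x, z)" "\<lambda>z. deriv_z (open_cyl \<Omega> M0) f (x, z)"])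
      show "((\<lambda>z. f (x, z)) has_real_derivative deriv_z (open_cyl \<Omega> M0) f (x, t)) (at t within {-M0<..<M0})"
        if "t \<in> {-M0<..<M0}" for t
        using cyl_has_derivative(2)[OF \<open>x \<in> \<Omega>\<close>, of t] that by (auto intro: has_field_derivative_at_within)
      show "norm (deriv_z (open_cyl \<Omega> M0) f (x, t)) \<le> L" if "t \<in> {-M0<..<M0}" for t
        using L[of "(x, t)"] xc that by auto
    qed (use that in auto)
    then show ?thesis by simp
  qed
  define S where "S = \<Omega> \<times> ({-M0<..<M0} \<times> {-M0<..<M0})"
  have cS: "closure S = closure \<Omega> \<times> ({-M0..M0} \<times> {-M0..M0})" using M0 by (simp add: S_def closure_Times)
  have "(\<lambda>p. \<bar>f (fst p, fst (snd p)) - f (fst p, snd (snd p))\<bar> - L * \<bar>fst (snd p) - snd (snd p)\<bar>) (x, z, z') \<le> 0"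
  proof (rule continuous_le_on_closure[of S])
    show "continuous_on (closure S) (\<lambda>p. \<bar>f (fst p, fst (snd p)) - f (fst p, snd (snd p))\<bar> - L * \<bar>fst (snd p) - snd (snd p)\<bar>)"
      unfolding cS by (intro continuous_intros continuous_on_compose2[OF cyl_continuous]) auto
    show "(x, z, z') \<in> closure S" using x z by (simp add: cS)
    show "\<bar>f (fst p, fst (snd p)) - f (fst p, snd (snd p))\<bar> - L * \<bar>fst (snd p) - snd (snd p)\<bar> \<le> 0" if "p \<in> S" for p
      using inner[of "fst p" "fst (snd p)" "snd (snd p)"] that by (auto simp: S_def abs_less_iff)
  qed
  then show ?thesis by simp
qed

lemma cyl_C1_norm_bounds:
  assumes "bounded \<Omega>" and n: "C1_norm (open_cyl \<Omega> M0) (closed_cyl \<Omega> M0) f \<le> L" and p: "p \<in> closed_cyl \<Omega> M0"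
  shows "\<bar>f p\<bar> \<le> L" "norm (grad_x (open_cyl \<Omega> M0) f p) \<le> L" "\<bar>deriv_z (open_cyl \<Omega> M0) f p\<bar> \<le> L"
proof -
  have cpt: "compact (closed_cyl \<Omega> M0)" using assms(1) by (intro compact_Times) (auto simp: compact_closure)
  have f': "Ck (Suc 0) (open_cyl \<Omega> M0) (closed_cyl \<Omega> M0) f" using f by (simp only: One_nat_def)
  have bdd: "bdd_above (h ` closed_cyl \<Omega> M0)" if "continuous_on (closed_cyl \<Omega> M0) h" for h :: "_ \<Rightarrow> real"
    using compact_continuous_image[OF that cpt] by (intro bounded_imp_bdd_above compact_imp_bounded)
  have b1: "bdd_above ((\<lambda>x. \<bar>f x\<bar>) ` closed_cyl \<Omega> M0)"
    by (intro bdd continuous_intros cyl_continuous)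
  have b2: "bdd_above ((\<lambda>x. norm (grad (open_cyl \<Omega> M0) f x)) ` closed_cyl \<Omega> M0)"
    by (intro bdd continuous_intros Ck_grad_continuous_on[OF f'])
  have 1: "\<bar>f p\<bar> \<le> (SUP x\<in>closed_cyl \<Omega> M0. \<bar>f x\<bar>)" by (rule cSUP_upper[OF p b1])
  have 2: "norm (grad (open_cyl \<Omega> M0) f p) \<le> (SUP x\<in>closed_cyl \<Omega> M0. norm (grad (open_cyl \<Omega> M0) f x))"
    by (rule cSUP_upper[OF p b2])
  have "\<bar>f p\<bar> \<le> L" "norm (grad (open_cyl \<Omega> M0) f p) \<le> L"
    using 1 2 n unfolding C1_norm_def by (smt (verit) norm_ge_zero)+
  then show "\<bar>f p\<bar> \<le> L" "norm (grad_x (open_cyl \<Omega> M0) f p) \<le> L" "\<bar>deriv_z (open_cyl \<Omega> M0) f p\<bar> \<le> L"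
    using norm_fst_le[of "grad_x (open_cyl \<Omega> M0) f p" "deriv_z (open_cyl \<Omega> M0) f p"]
      norm_snd_le[of "deriv_z (open_cyl \<Omega> M0) f p" "grad_x (open_cyl \<Omega> M0) f p"]
    by (auto simp: grad_prod_eq)
qed

end

section \<open>Behaviour of the solution up to the boundary\<close>

text \<open>A qualitative bound whose constant depends on \<open>u\<close>. It supplies some scale
  at which the doubled function is nonpositive, from which the halving starts, and does not enter
  the final constant.\<close>

lemma Ck_lipschitz_closure:
  assumes u: "Ck (Suc k) \<Omega> (closure \<Omega>) u" and bd: "bounded \<Omega>"
    and \<Lambda>: "quasi_lipschitz_constant \<Omega> \<Lambda>"
  obtains Lu where "\<And>x y. x \<in> closure \<Omega> \<Longrightarrow> y \<in> closure \<Omega> \<Longrightarrow> \<bar>u x - u y\<bar> \<le> Lu * norm (x - y)"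
proof -
  have cpt: "compact (closure \<Omega>)" using bd by (simp add: compact_closure)
  have c: "continuous_on (closure \<Omega>) u" using u by (rule Ck_continuous_on)
  have "bounded (u ` closure \<Omega>)" "bounded (grad \<Omega> u ` closure \<Omega>)"
    using compact_continuous_image[OF c cpt] compact_continuous_image[OF Ck_grad_continuous_on[OF u] cpt]
    by (auto intro: compact_imp_bounded)
  then obtain B1 B2 where B: "\<And>x. x \<in> closure \<Omega> \<Longrightarrow> \<bar>u x\<bar> \<le> B1" "\<And>x. x \<in> closure \<Omega> \<Longrightarrow> norm (grad \<Omega> u x) \<le> B2"
    unfolding bounded_iff by (metis imageI real_norm_def)
  show thesis
  proof (rule that[of "\<Lambda> * max B1 B2"])
    fix x y assume xy: "x \<in> closure \<Omega>" "y \<in> closure \<Omega>"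
    show "\<bar>u x - u y\<bar> \<le> \<Lambda> * max B1 B2 * norm (x - y)"
    proof (rule quasi_lipschitz_constantD[OF \<Lambda>, of u "grad \<Omega> u", OF _ _ c _ xy])
      show "(u has_derivative (\<lambda>v. grad \<Omega> u x \<bullet> v)) (at x)" if "x \<in> \<Omega>" for x
        using has_derivative_grad[OF Ck_Suc_differentiable[OF u that] that] .
    qed (use B closure_subset in \<open>auto simp: le_max_iff_disj\<close>)
  qed
qed

text \<open>On the frontier \<open>grad\<close> is defined as a limit of interior derivatives; the
  mean value theorem along a ray entering \<open>\<Omega>\<close> identifies it with a one-sided
  derivative. This allows the boundary condition to be tested at a maximum.\<close>

lemma boundary_has_derivative_ray:
  fixes u :: "'a::euclidean_space \<Rightarrow> real"
  assumes u: "Ck (Suc k) \<Omega> (closure \<Omega>) u" and x: "x \<in> closure \<Omega>"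
    and d: "d > 0" "\<And>t. 0 < t \<Longrightarrow> t < d \<Longrightarrow> x + t *\<^sub>R v \<in> \<Omega>"
  shows "((\<lambda>t. u (x + t *\<^sub>R v)) has_real_derivative grad \<Omega> u x \<bullet> v) (at 0 within {0..})"
proof -
  define g where "g t = grad \<Omega> u (x + t *\<^sub>R v) \<bullet> v" for t
  have mem: "x + t *\<^sub>R v \<in> closure \<Omega>" if "0 \<le> t" "t < d" for t
    using d(2)[of t] that x closure_subset by (cases "t = 0") auto
  have cg: "continuous_on {0..<d} g" unfolding g_def
    by (intro continuous_intros continuous_on_compose2[OF Ck_grad_continuous_on[OF u]]) (use mem in auto)
  have cu: "continuous_on {0..<d} (\<lambda>t. u (x + t *\<^sub>R v))"
    by (intro continuous_intros continuous_on_compose2[OF Ck_continuous_on[OF u]]) (use mem in auto)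
  have D: "((\<lambda>t. u (x + t *\<^sub>R v)) has_real_derivative g t) (at t)" if "0 < t" "t < d" for t
    unfolding g_def
    by (intro has_derivative_line has_derivative_grad Ck_Suc_differentiable[OF u] d that)
  have "((\<lambda>t. (u (x + t *\<^sub>R v) - u (x + 0 *\<^sub>R v)) / (t - 0)) \<longlongrightarrow> g 0) (at 0 within {0..})"
    unfolding Lim_within
  proof (intro allI impI)
    fix \<epsilon> :: real assume \<epsilon>: "\<epsilon> > 0"
    have "0 \<in> {0..<d}" using d by simp
    then obtain \<delta> where \<delta>: "\<delta> > 0" "\<And>t. t \<in> {0..<d} \<Longrightarrow> dist t 0 < \<delta> \<Longrightarrow> dist (g t) (g 0) < \<epsilon>"
      using cg \<epsilon> unfolding continuous_on_iff by meson
    show "\<exists>da>0. \<forall>t\<in>{0..}. 0 < dist t 0 \<and> dist t 0 < da \<longrightarrow> dist ((u (x + t *\<^sub>R v) - u (x + 0 *\<^sub>R v)) / (t - 0)) (g 0) < \<epsilon>"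
    proof (intro exI[of _ "min \<delta> d"] conjI ballI impI)
      fix t :: real assume "t \<in> {0..}" "0 < dist t 0 \<and> dist t 0 < min \<delta> d"
      then have t: "0 < t" "t < \<delta>" "t < d" by auto
      obtain s where s: "0 < s" "s < t" "u (x + t *\<^sub>R v) - u (x + 0 *\<^sub>R v) = (t - 0) * g s"
      proof -
        have "continuous_on {0..t} (\<lambda>t. u (x + t *\<^sub>R v))" using cu t by (auto intro: continuous_on_subset)
        moreover have "(\<lambda>t. u (x + t *\<^sub>R v)) differentiable (at s)" if "0 < s" "s < t" for s
          using D[of s] that t by (auto simp: real_differentiable_def)
        ultimately obtain l s where ls: "0 < s" "s < t" "((\<lambda>t. u (x + t *\<^sub>R v)) has_real_derivative l) (at s)"
            "u (x + t *\<^sub>R v) - u (x + 0 *\<^sub>R v) = (t - 0) * l"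
          using MVT[OF t(1)] by blast
        then have "l = g s" using DERIV_unique[OF ls(3) D[of s]] t by auto
        then show ?thesis using that ls by auto
      qed
      then have "(u (x + t *\<^sub>R v) - u (x + 0 *\<^sub>R v)) / (t - 0) = g s" using t by simp
      then show "dist ((u (x + t *\<^sub>R v) - u (x + 0 *\<^sub>R v)) / (t - 0)) (g 0) < \<epsilon>" using \<delta>(2)[of s] s t by simp
    qed (use \<delta> d in auto)
  qed
  then show ?thesis by (simp add: has_field_derivative_iff g_def)
qed

section \<open>The doubled function\<close>

definition profile :: "real \<Rightarrow> real \<Rightarrow> real \<Rightarrow> real" where
  "profile C K s = ln (1 + C * K * s) / C"

definition profile' :: "real \<Rightarrow> real \<Rightarrow> real \<Rightarrow> real" where
  "profile' C K s = K / (1 + C * K * s)"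

context
  fixes C K :: real
  assumes C: "C > 0" and K: "K > 0"
begin

lemma profile_arg_pos: "s \<ge> 0 \<Longrightarrow> 1 + C * K * s > 0"
  using C K by (simp add: add_pos_nonneg)

lemma profile_DERIV: "s \<ge> 0 \<Longrightarrow> (profile C K has_real_derivative profile' C K s) (at s)"
  unfolding profile_def[abs_def] profile'_def using profile_arg_pos[of s] C
  by (auto intro!: derivative_eq_intros)

lemma profile'_DERIV: "s \<ge> 0 \<Longrightarrow> (profile' C K has_real_derivative - C * (profile' C K s)\<^sup>2) (at s)"
  unfolding profile'_def[abs_def] using profile_arg_pos[of s] C K
  by (auto intro!: derivative_eq_intros simp: power2_eq_square field_simps)

lemma profile_nonneg: "s \<ge> 0 \<Longrightarrow> profile C K s \<ge> 0"
  using C K by (simp add: profile_def)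

lemma profile'_le_inverse: "s \<ge> 0 \<Longrightarrow> profile' C K s * s \<le> 1 / C"
  using profile_arg_pos[of s] C K by (simp add: profile'_def field_simps)

text \<open>Concavity together with \<open>A(0) = 0\<close>; in the variable
  \<open>t = 1 + C K s\<close> it is \<open>1 - 1 / t \<le> ln t\<close>.\<close>

lemma profile'_le_profile:
  assumes "s \<ge> 0" shows "profile' C K s * s \<le> profile C K s"
proof -
  define t where "t = 1 + C * K * s"
  have t: "t > 0" using profile_arg_pos[OF assms] by (simp add: t_def)
  have "ln (1 / t) \<le> 1 / t - 1" using t by (intro ln_le_minus_one) simp
  then have "1 - 1 / t \<le> ln t" using t by (simp add: ln_div)
  moreover have "C * (profile' C K s * s) = 1 - 1 / t"
    using t unfolding profile'_def t_def[symmetric] by (simp add: t_def field_simps)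
  moreover have "C * profile C K s = ln t" using C by (simp add: profile_def t_def)
  ultimately have "C * (profile' C K s * s) \<le> C * profile C K s" by simp
  then show ?thesis using C by simp
qed

lemma profile_le_linear: "s \<ge> 0 \<Longrightarrow> profile C K s \<le> K * s"
  using ln_add_one_self_le_self[of "C * K * s"] C K by (simp add: profile_def divide_le_eq mult_ac)

text \<open>A converse to \<open>profile'_le_profile\<close>: \<open>A\<close> exceeds
  \<open>s A'\<close> by a factor that stays bounded as long as \<open>A\<close> does. In the
  variable \<open>\<tau> = C K s\<close> it reduces to
  \<open>ln (1 + \<tau>) \<le> \<tau>\<close>.\<close>

lemma profile_le_profile':
  assumes "s \<ge> 0" shows "profile C K s \<le> (1 + C * profile C K s) * (s * profile' C K s)"
proof -
  define \<tau> where "\<tau> = C * K * s"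
  have \<tau>: "\<tau> \<ge> 0" using C K assms by (simp add: \<tau>_def)
  have "ln (1 + \<tau>) \<le> \<tau>" using \<tau> by (intro ln_add_one_self_le_self)
  then have "ln (1 + \<tau>) * (1 + \<tau>) \<le> (1 + ln (1 + \<tau>)) * \<tau>" by (simp add: algebra_simps)
  then have "ln (1 + \<tau>) * (1 + \<tau>) / (C * (1 + \<tau>)) \<le> (1 + ln (1 + \<tau>)) * \<tau> / (C * (1 + \<tau>))"
    using C \<tau> by (intro divide_right_mono) auto
  moreover have "ln (1 + \<tau>) * (1 + \<tau>) / (C * (1 + \<tau>)) = ln (1 + \<tau>) / C" using \<tau> by simp
  ultimately have "ln (1 + \<tau>) / C \<le> (1 + ln (1 + \<tau>)) * (\<tau> / (C * (1 + \<tau>)))" by simp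
  moreover have "\<tau> / (C * (1 + \<tau>)) = s * profile' C K s" using C by (simp add: profile'_def \<tau>_def)
  moreover have "C * profile C K s = ln (1 + \<tau>)" using C by (simp add: profile_def \<tau>_def)
  ultimately show ?thesis by (simp add: profile_def \<tau>_def)
qed

text \<open>From \<open>1 + 2 \<tau> \<le> (1 + \<tau>)^2\<close>. This is what lets an estimate at
  scale \<open>2 K\<close> be read as an estimate in terms of the profile at scale
  \<open>K\<close>.\<close>

lemma profile_double:
  assumes "s \<ge> 0" shows "profile C (2 * K) s \<le> 2 * profile C K s"
proof -
  define \<tau> where "\<tau> = C * K * s"
  have \<tau>: "\<tau> \<ge> 0" using C K assms by (simp add: \<tau>_def)
  have "ln (1 + 2 * \<tau>) \<le> ln ((1 + \<tau>)\<^sup>2)" using \<tau> by (subst ln_le_cancel_iff) (auto simp: power2_eq_square algebra_simps add_pos_nonneg)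
  also have "\<dots> = 2 * ln (1 + \<tau>)" using \<tau> by (simp add: ln_realpow)
  finally show ?thesis using C by (simp add: profile_def \<tau>_def divide_right_mono mult_ac)
qed

end

lemma profile_0 [simp]: "profile C K 0 = 0"
  by (simp add: profile_def)

text \<open>The interval is split at \<open>C K s = T\<close>. Below, the slope is still at least
  \<open>|B|\<close>; above, the value is already at least \<open>|B| s1\<close>, and
  \<open>T\<close> is chosen to make this so, because the profile grows only
  logarithmically.\<close>

lemma profile_dominates_linear:
  assumes C: "C > 0" and s1: "s1 > 0"
  shows "\<exists>K1>0. \<forall>K\<ge>K1. \<forall>s. 0 \<le> s \<longrightarrow> s \<le> s1 \<longrightarrow> B * s \<le> profile C K s"
proof -
  define T where "T = exp (C * (\<bar>B\<bar> * s1))"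
  have T: "T > 0" by (simp add: T_def)
  define K1 where "K1 = (\<bar>B\<bar> + 1) * (1 + T)"
  have K1: "K1 > 0" using T by (simp add: K1_def)
  have "B * s \<le> profile C K s" if K: "K \<ge> K1" and s: "0 \<le> s" "s \<le> s1" for K s
  proof (cases "C * K * s \<le> T")
    case True
    have Kp: "K > 0" using K K1 by simp
    have "\<bar>B\<bar> \<le> profile' C K s"
    proof -
      have "\<bar>B\<bar> * (1 + C * K * s) \<le> (\<bar>B\<bar> + 1) * (1 + T)" using True T s C Kp by (intro mult_mono) auto
      also have "\<dots> \<le> K" using K by (simp add: K1_def)
      finally show ?thesis unfolding profile'_def using profile_arg_pos[OF C Kp s(1)] by (simp add: pos_le_divide_eq)
    qed
    then have "\<bar>B\<bar> * s \<le> profile' C K s * s" using s by (intro mult_right_mono)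
    also have "\<dots> \<le> profile C K s" by (rule profile'_le_profile[OF C Kp s(1)])
    finally show ?thesis using s abs_ge_self[of "B * s"] by (simp add: abs_mult)
  next
    case False
    have "C * (\<bar>B\<bar> * s1) = ln T" by (simp add: T_def)
    also have "\<dots> \<le> ln (1 + C * K * s)" using False T by (intro ln_mono) auto
    finally have "\<bar>B\<bar> * s1 \<le> profile C K s" using C by (simp add: profile_def pos_le_divide_eq mult.commute)
    moreover have "\<bar>B\<bar> * s \<le> \<bar>B\<bar> * s1" using s by (intro mult_left_mono) auto
    moreover have "B * s \<le> \<bar>B\<bar> * s" using s by (intro mult_right_mono) auto
    ultimately show ?thesis by linarith
  qed
  then show ?thesis using K1 by blast
qed

lemma norm_line_DERIV_0:
  fixes w v :: "'a::euclidean_space"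
  assumes "w \<noteq> 0"
  shows "((\<lambda>t. norm (w + t *\<^sub>R v)) has_real_derivative (w \<bullet> v / norm w)) (at 0)"
proof (rule norm_line_derivative[OF assms, of v])
  fix d :: real
  assume d: "d > 0" "\<And>t. \<bar>t\<bar> < d \<Longrightarrow>
    ((\<lambda>t. norm (w + t *\<^sub>R v)) has_real_derivative ((w + t *\<^sub>R v) \<bullet> v / norm (w + t *\<^sub>R v))) (at t)"
  show ?thesis using d(2)[of 0] d(1) by simp
qed

text \<open>Every constant of the estimate is a parameter fixed independently of \<open>u\<close>;
  the Lipschitz constant of \<open>u\<close> is therefore quantified inside \<open>ulip\<close>. The
  fourth assumption on \<open>nu\<close> is a uniform exterior ball condition of radius
  \<open>1 / (2 cO)\<close> in quadratic form. \<open>\<kappa>\<close> says how steeply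
  \<open>E\<close> falls along the inward normal; \<open>ME\<close> depends on it, and the remaining
  constants are chosen after that.\<close>

locale doubled_neumann =
  fixes \<Omega> :: "'a::euclidean_space set" and u :: "'a \<Rightarrow> real" and f :: "'a \<times> real \<Rightarrow> real"
    and Psi :: "'a \<Rightarrow> real \<Rightarrow> 'a" and E :: "'a \<Rightarrow> real" and gE :: "'a \<Rightarrow> 'a" and HE :: "'a \<Rightarrow> 'a \<Rightarrow> 'a"
    and nu :: "'a \<Rightarrow> 'a"
    and M0 L \<Lambda> ME \<kappa> cO a0 \<beta> c1 C Kmin s1 K0 :: real
  assumes op: "open \<Omega>" and bd: "bounded \<Omega>"
    and u: "Ck (Suc (Suc 0)) \<Omega> (closure \<Omega>) u"
    and uM: "\<And>x. x \<in> closure \<Omega> \<Longrightarrow> \<bar>u x\<bar> \<le> M0"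
    and ulip: "\<exists>Lu. \<forall>x\<in>closure \<Omega>. \<forall>y\<in>closure \<Omega>. \<bar>u x - u y\<bar> \<le> Lu * norm (x - y)"
    and pde: "\<And>x. x \<in> \<Omega> \<Longrightarrow> mean_curvature_op \<Omega> u x = f (x, u x)"
    and f_bd: "\<And>x z. x \<in> \<Omega> \<Longrightarrow> z \<in> {-M0..M0} \<Longrightarrow> \<bar>f (x, z)\<bar> \<le> L"
    and f_lip: "\<And>x y z. x \<in> \<Omega> \<Longrightarrow> y \<in> \<Omega> \<Longrightarrow> z \<in> {-M0..M0} \<Longrightarrow> \<bar>f (x, z) - f (y, z)\<bar> \<le> \<Lambda> * norm (x - y)"
    and f_mono: "\<And>x z z'. x \<in> \<Omega> \<Longrightarrow> - M0 \<le> z \<Longrightarrow> z \<le> z' \<Longrightarrow> z' \<le> M0 \<Longrightarrow> f (x, z) \<le> f (x, z')"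
    and Psi_bd: "\<And>x z. x \<in> closure \<Omega> \<Longrightarrow> z \<in> {-M0..M0} \<Longrightarrow> norm (Psi x z) \<le> \<Lambda>"
    and Psi_lip: "\<And>x z x' z'. x \<in> closure \<Omega> \<Longrightarrow> z \<in> {-M0..M0} \<Longrightarrow> x' \<in> closure \<Omega> \<Longrightarrow> z' \<in> {-M0..M0}
        \<Longrightarrow> norm (Psi x z - Psi x' z') \<le> \<Lambda> * (norm (x - x') + \<bar>z - z'\<bar>)"
    and Psi_cont: "continuous_on (closure \<Omega> \<times> {-M0..M0}) (\<lambda>p. Psi (fst p) (snd p))"
    and E: "\<And>x. (E has_derivative (\<lambda>h. gE x \<bullet> h)) (at x)" "\<And>x. (gE has_derivative HE x) (at x)"
    and E_bd: "\<And>x. x \<in> closure \<Omega> \<Longrightarrow> 1 / 2 \<le> E x" "\<And>x. x \<in> closure \<Omega> \<Longrightarrow> E x \<le> 3 / 2"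
      "\<And>x. x \<in> closure \<Omega> \<Longrightarrow> norm (gE x) \<le> ME" "\<And>x h. x \<in> closure \<Omega> \<Longrightarrow> norm (HE x h) \<le> ME * norm h"
    and nu: "\<And>x. x \<in> frontier \<Omega> \<Longrightarrow> norm (nu x) = 1"
      "\<And>x. x \<in> frontier \<Omega> \<Longrightarrow> \<exists>d>0. \<forall>t. 0 < t \<longrightarrow> t < d \<longrightarrow> x + t *\<^sub>R nu x \<in> \<Omega>"
      "\<And>x. x \<in> frontier \<Omega> \<Longrightarrow> grad \<Omega> u x \<bullet> nu x = - (Psi x (u x) \<bullet> nu x)"
      "\<And>x y. x \<in> frontier \<Omega> \<Longrightarrow> y \<in> closure \<Omega> \<Longrightarrow> (y - x) \<bullet> nu x \<ge> - cO * (norm (y - x))\<^sup>2"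
      "\<And>x. x \<in> frontier \<Omega> \<Longrightarrow> gE x \<bullet> nu x \<le> - \<kappa>"
    and M0: "M0 > 0" and \<Lambda>: "\<Lambda> \<ge> 1" and cO: "cO \<ge> 0" and ME: "ME \<ge> 0" and L: "L \<ge> 0"
    and \<kappa>: "\<kappa> \<ge> 8 * \<Lambda> + 4 * \<Lambda>\<^sup>2 + 3 * cO + 1"
    \<comment> \<open>\<open>a0\<close> bounds \<open>A\<close>, \<open>\<beta>\<close> the distance
      of both gradients from \<open>k e\<close>, and \<open>c1 A\<close> the distance between them.
      \<open>C_big\<close> contradicts the conclusion of \<open>concavity_bound\<close>.
      \<open>Kmin\<close> is the least slope, guaranteed up to distance \<open>s1\<close> by the
      third bound on \<open>s1\<close> and the first on \<open>K0\<close>; the second bound on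
      \<open>K0\<close> lifts the profile at \<open>s1\<close> to at least
      \<open>a0\<close>.\<close>
    and a0_def: "a0 = 2 * M0 + \<Lambda>"
    and \<beta>_def: "\<beta> = 2 * (a0 * ME + 3 * \<Lambda>) + 12 * \<Lambda>"
    and c1_def: "c1 = 2 * ME + 2 * \<Lambda> + 2 * \<Lambda> * (3 + \<beta>)"
    and C1: "C \<ge> 1"
    and C_big: "C > 3 * ((\<Lambda> + 2 * \<Lambda> * L) * (4 + \<beta>) + L * c1 * a0 + 3 + 2 * real DIM('a)
      + 4 * real DIM('a) * real DIM('a) * (4 * \<beta> + 4) * ME + 2 * a0 * ME * real DIM('a))"
    and Kmin_def: "Kmin = 1 + 2 * \<beta> + 120000 * real DIM('a) * \<beta>\<^sup>2 * c1\<^sup>2 * a0 * (1 + C * a0)"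
    and s1: "s1 > 0" "s1 \<le> 1 / (4 * \<Lambda>)" "s1 \<le> 1 / (2 * C * Kmin)"
    and K0: "K0 \<ge> 2 * Kmin" "K0 \<ge> exp (C * a0) / (C * s1)"
begin

definition Phi :: "real \<Rightarrow> 'a \<Rightarrow> 'a \<Rightarrow> 'a \<Rightarrow> real \<Rightarrow> real" where
  "Phi K x y \<xi> z = u x - u y - profile C K (norm (x - y)) * (E x + E y)
     + Psi \<xi> z \<bullet> (x - y) - (norm (x - \<xi>))\<^sup>2 - (u x - z)\<^sup>2"

text \<open>The bound \<open>s1\<close> on the distance is a constraint of the maximization;
  \<open>s_lt\<close> shows that it is inactive at a positive maximum.\<close>

definition Phi_nonpos :: "real \<Rightarrow> bool" where
  "Phi_nonpos K \<longleftrightarrow> (\<forall>x\<in>closure \<Omega>. \<forall>y\<in>closure \<Omega>. \<forall>\<xi>\<in>closure \<Omega>. \<forall>z\<in>{-M0..M0}.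
      norm (x - y) \<le> s1 \<longrightarrow> Phi K x y \<xi> z \<le> 0)"

lemma a0: "a0 > 0" "a0 \<ge> 2 * M0 + \<Lambda>" using M0 \<Lambda> by (auto simp: a0_def)

lemma \<beta>: "\<beta> \<ge> 12 * \<Lambda>" "\<beta> \<ge> 0"
proof -
  have "a0 * ME \<ge> 0" using a0 ME by simp
  then show "\<beta> \<ge> 12 * \<Lambda>" "\<beta> \<ge> 0" using \<Lambda> by (auto simp: \<beta>_def)
qed

lemma c1: "c1 \<ge> 0"
proof -
  have "\<Lambda> * (3 + \<beta>) \<ge> 0" using \<Lambda> \<beta> by simp
  then show ?thesis using ME \<Lambda> by (simp add: c1_def)
qed

lemma Kmin: "Kmin \<ge> 1" "Kmin \<ge> 2 * \<beta>" "Kmin \<ge> 24 * \<Lambda>" "120000 * real DIM('a) * \<beta>\<^sup>2 * c1\<^sup>2 * a0 * (1 + C * a0) \<le> Kmin\<^sup>2"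
proof -
  define X where "X = 120000 * real DIM('a) * \<beta>\<^sup>2 * c1\<^sup>2 * a0 * (1 + C * a0)"
  have X: "X \<ge> 0" unfolding X_def using a0 C1 by (intro mult_nonneg_nonneg add_nonneg_nonneg) auto
  have K: "Kmin = 1 + 2 * \<beta> + X" by (simp add: Kmin_def X_def)
  show 1: "Kmin \<ge> 1" "Kmin \<ge> 2 * \<beta>" using K X \<beta> by auto
  then show "Kmin \<ge> 24 * \<Lambda>" using \<beta> by linarith
  have "X \<le> Kmin" using K \<beta> by linarith
  also have "\<dots> \<le> Kmin\<^sup>2" using 1 by (intro self_le_power) auto
  finally show "120000 * real DIM('a) * \<beta>\<^sup>2 * c1\<^sup>2 * a0 * (1 + C * a0) \<le> Kmin\<^sup>2" by (simp add: X_def)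
qed

lemma K0_pos: "K0 > 0" using K0(1) Kmin(1) by linarith

lemma s1_le_1: "s1 \<le> 1" "\<Lambda> * s1 \<le> 1 / 4"
proof -
  show 1: "\<Lambda> * s1 \<le> 1 / 4" using s1(2) \<Lambda> by (simp add: field_simps)
  have "s1 \<le> \<Lambda> * s1" using \<Lambda> s1 by simp
  then show "s1 \<le> 1" using 1 by linarith
qed

lemma profile'_ge_Kmin:
  assumes "K \<ge> K0" "0 \<le> s" "s \<le> s1" shows "profile' C K s \<ge> Kmin"
proof -
  have K: "K > 0" "2 * Kmin \<le> K" using assms K0 K0_pos by auto
  have Cp: "C > 0" using C1 by simp
  have "s \<le> 1 / (2 * C * Kmin)" using assms s1(3) by linarith
  then have "C * Kmin * s \<le> 1 / 2" using Cp Kmin(1) by (simp add: field_simps)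
  then have "K * (C * Kmin * s) \<le> K * (1 / 2)" using K by (intro mult_left_mono) auto
  moreover have "Kmin * (1 + C * K * s) = Kmin + K * (C * Kmin * s)" by (simp add: algebra_simps)
  ultimately have "Kmin * (1 + C * K * s) \<le> K" using K by linarith
  then show ?thesis using profile_arg_pos[OF Cp K(1) assms(2)] by (simp add: profile'_def pos_le_divide_eq)
qed

lemma profile_s1: assumes "K \<ge> K0" shows "profile C K s1 \<ge> a0"
proof -
  have Cp: "C > 0" using C1 by simp
  have "exp (C * a0) / (C * s1) \<le> K" using K0(2) assms by linarith
  then have "exp (C * a0) \<le> K * (C * s1)" using Cp s1(1) by (simp only: pos_divide_le_eq mult_pos_pos)
  then have "exp (C * a0) \<le> C * K * s1" by (simp add: mult_ac)
  then have "exp (C * a0) \<le> 1 + C * K * s1" by simp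
  then have "C * a0 \<le> ln (1 + C * K * s1)" by (metis exp_gt_zero ln_exp ln_mono)
  then show ?thesis using Cp by (simp add: profile_def pos_le_divide_eq mult.commute)
qed

section \<open>Constraints at a positive maximum of the doubled function\<close>

context
  fixes K x y \<xi> z
  assumes K: "K \<ge> K0" and x: "x \<in> closure \<Omega>" and y: "y \<in> closure \<Omega>" and \<xi>: "\<xi> \<in> closure \<Omega>"
    and z: "z \<in> {-M0..M0}" and s_le: "norm (x - y) \<le> s1"
    and pos: "Phi K x y \<xi> z > 0"
    and max: "\<And>x' y' \<xi>' z'. x' \<in> closure \<Omega> \<Longrightarrow> y' \<in> closure \<Omega> \<Longrightarrow> \<xi>' \<in> closure \<Omega> \<Longrightarrow> z' \<in> {-M0..M0}
        \<Longrightarrow> norm (x' - y') \<le> s1 \<Longrightarrow> Phi K x' y' \<xi>' z' \<le> Phi K x y \<xi> z"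
    and np: "Phi_nonpos (2 * K)"
begin

definition s where "s = norm (x - y)"
definition A where "A = profile C K s"
definition A1 where "A1 = profile' C K s"
definition e where "e = (x - y) /\<^sub>R s"
definition \<eta> where "\<eta> = E x + E y"
definition \<theta> where "\<theta> = 1 - 2 * (u x - z)"

lemma Cp: "C > 0" using C1 by simp
lemma Kp: "K > 0" using K K0_pos by simp

lemma xy_ne: "x \<noteq> y"
proof
  assume "x = y"
  then have "Phi K x y \<xi> z = - (norm (x - \<xi>))\<^sup>2 - (u x - z)\<^sup>2" by (simp add: Phi_def)
  moreover have "(norm (x - \<xi>))\<^sup>2 \<ge> 0" "(u x - z)\<^sup>2 \<ge> 0" by auto
  ultimately show False using pos by linarith
qed

lemma s: "s > 0" "s \<le> s1" "s \<le> 1" using xy_ne s_le s1_le_1 by (auto simp: s_def)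

lemma e: "norm e = 1" "x - y = s *\<^sub>R e" using s(1) by (auto simp: e_def s_def)

lemma \<eta>: "1 \<le> \<eta>" "\<eta> \<le> 3" using E_bd(1,2)[OF x] E_bd(1,2)[OF y] by (auto simp: \<eta>_def)

lemma A1: "A1 \<ge> Kmin" "A1 \<ge> 1" "A1 > 0" "A1 * s \<le> A" "A1 * s \<le> 1"
proof -
  show 1: "A1 \<ge> Kmin" unfolding A1_def using profile'_ge_Kmin[OF K] s by simp
  then show "A1 \<ge> 1" "A1 > 0" using Kmin by auto
  show "A1 * s \<le> A" unfolding A1_def A_def using profile'_le_profile[OF Cp Kp] s by simp
  have "A1 * s \<le> 1 / C" unfolding A1_def using profile'_le_inverse[OF Cp Kp] s by simp
  also have "\<dots> \<le> 1" using C1 by simp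
  finally show "A1 * s \<le> 1" .
qed

lemma s_A: "s \<le> A" "\<Lambda> * s \<le> A" "A > 0"
proof -
  have "1 * s \<le> A1 * s" using A1(2) s by (intro mult_right_mono) auto
  then show 1: "s \<le> A" using A1(4) by simp
  then show "A > 0" using s by simp
  have "\<Lambda> \<le> A1" using Kmin(3) \<Lambda> A1(1) by linarith
  then have "\<Lambda> * s \<le> A1 * s" using s by (intro mult_right_mono) auto
  then show "\<Lambda> * s \<le> A" using A1(4) by simp
qed

lemma ux: "u x \<in> {-M0..M0}" "u y \<in> {-M0..M0}" using uM[OF x] uM[OF y] by auto

lemma x_\<xi>: "norm (x - \<xi>) \<le> \<Lambda> * s"
proof -
  have "Phi K x y x z \<le> Phi K x y \<xi> z" by (rule max[OF x y x z s_le])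
  then have "(norm (x - \<xi>))\<^sup>2 \<le> (Psi \<xi> z - Psi x z) \<bullet> (x - y)"
    by (simp add: Phi_def inner_diff_left)
  also have "\<dots> \<le> norm (Psi \<xi> z - Psi x z) * s" unfolding s_def by (rule norm_cauchy_schwarz)
  also have "\<dots> \<le> \<Lambda> * norm (x - \<xi>) * s"
    using Psi_lip[OF \<xi> z x z] s by (intro mult_right_mono) (auto simp: norm_minus_commute)
  finally have "norm (x - \<xi>) * norm (x - \<xi>) \<le> (\<Lambda> * s) * norm (x - \<xi>)" by (simp add: power2_eq_square mult_ac)
  then show ?thesis using \<Lambda> s by (cases "norm (x - \<xi>) = 0") (auto simp: mult_le_cancel_right)
qed

lemma ux_z: "\<bar>u x - z\<bar> \<le> \<Lambda> * s"
proof -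
  have "Phi K x y \<xi> (u x) \<le> Phi K x y \<xi> z" by (rule max[OF x y \<xi> ux(1) s_le])
  then have "(u x - z)\<^sup>2 \<le> (Psi \<xi> z - Psi \<xi> (u x)) \<bullet> (x - y)"
    by (simp add: Phi_def inner_diff_left)
  also have "\<dots> \<le> norm (Psi \<xi> z - Psi \<xi> (u x)) * s" unfolding s_def by (rule norm_cauchy_schwarz)
  also have "\<dots> \<le> \<Lambda> * \<bar>u x - z\<bar> * s"
    using Psi_lip[OF \<xi> z \<xi> ux(1)] s by (intro mult_right_mono) (auto simp: abs_minus_commute)
  finally have *: "\<bar>u x - z\<bar> * \<bar>u x - z\<bar> \<le> (\<Lambda> * s) * \<bar>u x - z\<bar>" by (simp add: power2_eq_square mult_ac)
  show ?thesis
  proof (cases "u x = z")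
    case False
    show ?thesis by (rule mult_right_le_imp_le[OF *]) (use False in simp)
  qed (use \<Lambda> s in simp)
qed

lemma Psi_s: "\<bar>Psi \<xi>' z' \<bullet> (x - y)\<bar> \<le> \<Lambda> * s" if "\<xi>' \<in> closure \<Omega>" "z' \<in> {-M0..M0}"
proof -
  have "norm (Psi \<xi>' z') * s \<le> \<Lambda> * s" using Psi_bd[OF that] s by (intro mult_right_mono) auto
  then show ?thesis using Cauchy_Schwarz_ineq2[of "Psi \<xi>' z'" "x - y"] unfolding s_def by linarith
qed

text \<open>Positivity of the maximum with the penalties dropped. It bounds \<open>A\<close> from
  above and forces \<open>u y \<le> u x\<close>, the order in which the monotonicity of
  \<open>f\<close> in \<open>z\<close> has the favourable sign.\<close>

lemma A_\<eta>: "A * \<eta> < u x - u y + \<Lambda> * s"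
proof -
  have "Phi K x y \<xi> z = u x - u y - A * \<eta> + Psi \<xi> z \<bullet> (x - y) - (norm (x - \<xi>))\<^sup>2 - (u x - z)\<^sup>2"
    by (simp add: Phi_def A_def \<eta>_def s_def)
  moreover have "(norm (x - \<xi>))\<^sup>2 \<ge> 0" "(u x - z)\<^sup>2 \<ge> 0" by auto
  ultimately show ?thesis using pos Psi_s[OF \<xi> z] by linarith
qed

lemma A_le: "A \<le> A * \<eta>" "A \<le> a0" "u y \<le> u x"
proof -
  show 1: "A \<le> A * \<eta>" using \<eta> s_A by simp
  have "\<Lambda> * s \<le> \<Lambda> * 1" using s \<Lambda> by (intro mult_left_mono) auto
  then show "A \<le> a0" using 1 A_\<eta> ux by (auto simp: a0_def)
  show "u y \<le> u x" using 1 A_\<eta> s_A by linarith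
qed

lemma s_lt: "s < s1"
proof (rule ccontr)
  assume "\<not> s < s1"
  then have "s = s1" using s by simp
  then have "A \<ge> a0" unfolding A_def using profile_s1[OF K] by simp
  moreover have "\<Lambda> * s \<le> \<Lambda> * 1" using s \<Lambda> by (intro mult_left_mono) auto
  ultimately show False using A_\<eta> A_le(1) ux by (auto simp: a0_def)
qed

text \<open>Nonpositivity at scale \<open>2 K\<close> is used with \<open>\<xi> = x\<close> and
  \<open>z = u x\<close>, where both penalties vanish: \<open>2 A\<close> times
  \<open>\<eta> \<le> 3\<close>, plus \<open>\<Lambda> s \<le> A\<close>, gives 7. The boundary
  argument at \<open>y\<close> relies on it.\<close>

lemma D_le: "u x - u y \<le> 7 * A"
proof -
  have "Phi (2 * K) x y x (u x) \<le> 0" using np x y ux s_le unfolding Phi_nonpos_def by blast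
  then have "u x - u y \<le> profile C (2 * K) s * \<eta> - Psi x (u x) \<bullet> (x - y)"
    by (simp add: Phi_def s_def \<eta>_def)
  also have "\<dots> \<le> profile C (2 * K) s * \<eta> + \<Lambda> * s" using Psi_s[OF x ux(1)] by linarith
  also have "profile C (2 * K) s * \<eta> \<le> (2 * A) * 3"
    using profile_double[OF Cp Kp] s \<eta> s_A(3) unfolding A_def by (intro mult_mono) auto
  finally show ?thesis using s_A by linarith
qed

lemma x_interior: "x \<in> \<Omega>"
proof (rule ccontr)
  assume "x \<notin> \<Omega>"
  then have xf: "x \<in> frontier \<Omega>" using x op by (simp add: frontier_def interior_open)
  define v where "v = nu x"
  have v: "norm v = 1" using nu(1)[OF xf] by (simp add: v_def)
  obtain d where d: "d > 0" "\<And>t. 0 < t \<Longrightarrow> t < d \<Longrightarrow> x + t *\<^sub>R v \<in> \<Omega>" using nu(2)[OF xf] unfolding v_def by blast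
  define \<phi> where "\<phi> t = Phi K (x + t *\<^sub>R v) y \<xi> z" for t
  have N: "((\<lambda>t. norm (x + t *\<^sub>R v - y)) has_real_derivative e \<bullet> v) (at 0 within {0..})"
  proof -
    have "(x - y) \<bullet> v / norm (x - y) = e \<bullet> v" by (simp add: e_def s_def divide_inverse mult.commute)
    moreover have "(\<lambda>t. norm (x - y + t *\<^sub>R v)) = (\<lambda>t. norm (x + t *\<^sub>R v - y))" by (simp add: algebra_simps)
    ultimately have "((\<lambda>t. norm (x + t *\<^sub>R v - y)) has_real_derivative e \<bullet> v) (at 0)"
      using norm_line_DERIV_0[of "x - y" v] xy_ne by simp
    then show ?thesis by (rule has_field_derivative_at_within)
  qed
  have PN: "((\<lambda>t. profile C K (norm (x + t *\<^sub>R v - y))) has_real_derivative A1 * (e \<bullet> v)) (at 0 within {0..})"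
    using DERIV_chain2[OF _ N, of "profile C K"] profile_DERIV[OF Cp Kp, of s] s by (simp add: A1_def s_def)
  have U: "((\<lambda>t. u (x + t *\<^sub>R v)) has_real_derivative grad \<Omega> u x \<bullet> v) (at 0 within {0..})"
    by (rule boundary_has_derivative_ray[OF u x d])
  have EE: "((\<lambda>t. E (x + t *\<^sub>R v)) has_real_derivative gE x \<bullet> v) (at 0 within {0..})"
    using has_derivative_line[of E "gE x" x 0 v] E(1)[of x] by (auto intro: has_field_derivative_at_within)
  have Q: "((\<lambda>t. (norm (x + t *\<^sub>R v - \<xi>))\<^sup>2) has_real_derivative 2 * ((x - \<xi>) \<bullet> v)) (at 0 within {0..})"
    unfolding power2_norm_eq_inner by (auto intro!: derivative_eq_intros simp: inner_commute has_field_derivative_def)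
  have T: "((\<lambda>t. Psi \<xi> z \<bullet> (x + t *\<^sub>R v - y)) has_real_derivative Psi \<xi> z \<bullet> v) (at 0 within {0..})"
    by (auto intro!: derivative_eq_intros simp: has_field_derivative_def mult.commute)
  define D where "D = \<theta> * (grad \<Omega> u x \<bullet> v) - (A1 * (e \<bullet> v) * \<eta> + A * (gE x \<bullet> v)) + Psi \<xi> z \<bullet> v - 2 * ((x - \<xi>) \<bullet> v)"
  have "(\<phi> has_real_derivative (grad \<Omega> u x \<bullet> v - (A1 * (e \<bullet> v) * (E (x + 0 *\<^sub>R v) + E y) + (gE x \<bullet> v + 0) * profile C K (norm (x + 0 *\<^sub>R v - y)))
      + Psi \<xi> z \<bullet> v - 2 * ((x - \<xi>) \<bullet> v) - 2 * (u (x + 0 *\<^sub>R v) - z) * (grad \<Omega> u x \<bullet> v))) (at 0 within {0..})"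
    unfolding \<phi>_def Phi_def
    by (rule derivative_eq_intros refl U PN EE Q T | simp)+
  also have "(grad \<Omega> u x \<bullet> v - (A1 * (e \<bullet> v) * (E (x + 0 *\<^sub>R v) + E y) + (gE x \<bullet> v + 0) * profile C K (norm (x + 0 *\<^sub>R v - y)))
      + Psi \<xi> z \<bullet> v - 2 * ((x - \<xi>) \<bullet> v) - 2 * (u (x + 0 *\<^sub>R v) - z) * (grad \<Omega> u x \<bullet> v)) = D"
    by (simp add: D_def \<theta>_def \<eta>_def A_def s_def algebra_simps)
  finally have \<phi>: "(\<phi> has_real_derivative D) (at 0 within {0..})" .
  have "D > 0"
  proof -
    \<comment> \<open>By the exterior ball condition \<open>e\<close> points inwards by at most
      \<open>cO s\<close>, and \<open>A1 s \<le> A\<close> turns the slope of the profile into a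
      multiple of \<open>A\<close>.\<close>
    have sv: "A1 * (e \<bullet> v) * \<eta> \<le> 3 * cO * A"
    proof -
      have "(y - x) \<bullet> v \<ge> - cO * s\<^sup>2" using nu(4)[OF xf y] by (simp add: v_def s_def norm_minus_commute)
      moreover have "(y - x) \<bullet> v = - (s * (e \<bullet> v))"
        using arg_cong[OF e(2), of "\<lambda>w. w \<bullet> v"] by (simp add: inner_diff_left)
      ultimately have "s * (e \<bullet> v) \<le> s * (cO * s)" by (simp add: power2_eq_square mult_ac)
      then have "e \<bullet> v \<le> cO * s" using s by simp
      then have "A1 * (e \<bullet> v) \<le> A1 * (cO * s)" using A1(3) by (intro mult_left_mono) auto
      also have "\<dots> = cO * (A1 * s)" by simp
      also have "\<dots> \<le> cO * A" using A1(4) cO by (intro mult_left_mono)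
      finally have 1: "A1 * (e \<bullet> v) \<le> cO * A" .
      have "A1 * (e \<bullet> v) * \<eta> \<le> cO * A * \<eta>" using 1 \<eta> by (intro mult_right_mono) auto
      also have "\<dots> \<le> cO * A * 3" using \<eta> cO s_A by (intro mult_left_mono) auto
      finally show ?thesis by simp
    qed
    have gE: "A * (gE x \<bullet> v) \<le> - \<kappa> * A" using mult_left_mono[OF nu(5)[OF xf], of A] s_A by (simp add: v_def mult.commute)
    have g: "grad \<Omega> u x \<bullet> v = - (Psi x (u x) \<bullet> v)" using nu(3)[OF xf] by (simp add: v_def)
    have 1: "\<bar>(Psi \<xi> z - Psi x (u x)) \<bullet> v\<bar> \<le> 2 * \<Lambda>\<^sup>2 * s"
    proof -
      have "\<bar>(Psi \<xi> z - Psi x (u x)) \<bullet> v\<bar> \<le> norm (Psi \<xi> z - Psi x (u x))"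
        using Cauchy_Schwarz_ineq2[of "Psi \<xi> z - Psi x (u x)" v] v by simp
      also have "\<dots> \<le> \<Lambda> * (norm (\<xi> - x) + \<bar>z - u x\<bar>)" by (rule Psi_lip[OF \<xi> z x ux(1)])
      also have "\<dots> \<le> \<Lambda> * (\<Lambda> * s + \<Lambda> * s)" using x_\<xi> ux_z \<Lambda>
        by (intro mult_left_mono add_mono) (auto simp: norm_minus_commute abs_minus_commute)
      finally show ?thesis by (simp add: power2_eq_square algebra_simps)
    qed
    have 2: "\<bar>2 * (u x - z) * (Psi x (u x) \<bullet> v)\<bar> \<le> 2 * \<Lambda>\<^sup>2 * s"
    proof -
      have "\<bar>Psi x (u x) \<bullet> v\<bar> \<le> \<Lambda>" using Cauchy_Schwarz_ineq2[of "Psi x (u x)" v] v Psi_bd[OF x ux(1)] by simp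
      then have "\<bar>u x - z\<bar> * \<bar>Psi x (u x) \<bullet> v\<bar> \<le> (\<Lambda> * s) * \<Lambda>" using ux_z \<Lambda> s by (intro mult_mono) auto
      moreover have "\<bar>2 * (u x - z) * (Psi x (u x) \<bullet> v)\<bar> = 2 * (\<bar>u x - z\<bar> * \<bar>Psi x (u x) \<bullet> v\<bar>)"
        by (simp only: abs_mult abs_numeral mult.assoc)
      ultimately show ?thesis by (simp add: power2_eq_square mult_ac)
    qed
    have 3: "\<bar>2 * ((x - \<xi>) \<bullet> v)\<bar> \<le> 2 * (\<Lambda> * s)" using Cauchy_Schwarz_ineq2[of "x - \<xi>" v] v x_\<xi> by simp
    have "D = (Psi \<xi> z - Psi x (u x)) \<bullet> v + 2 * (u x - z) * (Psi x (u x) \<bullet> v) - A1 * (e \<bullet> v) * \<eta> - A * (gE x \<bullet> v) - 2 * ((x - \<xi>) \<bullet> v)"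
      unfolding D_def \<theta>_def g by (simp add: inner_diff_left algebra_simps)
    also have "\<dots> \<ge> - (2 * \<Lambda>\<^sup>2 * s) - 2 * \<Lambda>\<^sup>2 * s - 3 * cO * A + \<kappa> * A - 2 * (\<Lambda> * s)"
      using abs_le_D2[OF 1] abs_le_D2[OF 2] abs_le_D1[OF 3] sv gE by linarith
    finally have D: "D \<ge> \<kappa> * A - 3 * cO * A - (4 * \<Lambda>\<^sup>2 + 2 * \<Lambda>) * s" by (simp add: algebra_simps)
    have "(4 * \<Lambda>\<^sup>2 + 2 * \<Lambda>) * s \<le> (4 * \<Lambda>\<^sup>2 + 2 * \<Lambda>) * A" using s_A \<Lambda> by (intro mult_left_mono) auto
    moreover have "\<kappa> * A \<ge> (8 * \<Lambda> + 4 * \<Lambda>\<^sup>2 + 3 * cO + 1) * A" using \<kappa> s_A by (intro mult_right_mono) auto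
    ultimately have "D \<ge> 6 * (\<Lambda> * A) + A" using D by (simp add: algebra_simps)
    moreover have "\<Lambda> * A > 0" using \<Lambda> s_A by simp
    ultimately show ?thesis using s_A by linarith
  qed
  from has_real_derivative_pos_inc_right[OF \<phi> this] obtain d2 where d2: "d2 > 0"
    "\<And>h. 0 < h \<Longrightarrow> h < d2 \<Longrightarrow> \<phi> 0 < \<phi> h" by auto
  \<comment> \<open>The strict inequality \<open>s < s1\<close> leaves room for the shifted pair to
    satisfy the distance constraint.\<close>
  define t where "t = min d (min d2 (s1 - s)) / 2"
  have t: "0 < t" "t < d" "t < d2" "t < s1 - s" using d d2 s_lt by (auto simp: t_def)
  have "norm (x + t *\<^sub>R v - y) \<le> s + t" unfolding s_def
    using norm_triangle_ineq[of "x - y" "t *\<^sub>R v"] v t by (simp add: algebra_simps)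
  then have "Phi K (x + t *\<^sub>R v) y \<xi> z \<le> Phi K x y \<xi> z"
    using t d(2)[OF t(1,2)] closure_subset by (intro max y \<xi> z) auto
  then show False using d2(2)[OF t(1,3)] by (simp add: \<phi>_def)
qed

lemma y_interior: "y \<in> \<Omega>"
proof (rule ccontr)
  assume "y \<notin> \<Omega>"
  then have yf: "y \<in> frontier \<Omega>" using y op by (simp add: frontier_def interior_open)
  define v where "v = nu y"
  have v: "norm v = 1" using nu(1)[OF yf] by (simp add: v_def)
  obtain d where d: "d > 0" "\<And>t. 0 < t \<Longrightarrow> t < d \<Longrightarrow> y + t *\<^sub>R v \<in> \<Omega>" using nu(2)[OF yf] unfolding v_def by blast
  define \<phi> where "\<phi> t = Phi K x (y + t *\<^sub>R v) \<xi> z" for t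
  have N: "((\<lambda>t. norm (x - (y + t *\<^sub>R v))) has_real_derivative - (e \<bullet> v)) (at 0 within {0..})"
  proof -
    have "(x - y) \<bullet> (- v) / norm (x - y) = - (e \<bullet> v)" by (simp add: e_def s_def divide_inverse mult.commute)
    moreover have "(\<lambda>t. norm (x - y + t *\<^sub>R (- v))) = (\<lambda>t. norm (x - (y + t *\<^sub>R v)))" by (simp add: algebra_simps)
    ultimately have "((\<lambda>t. norm (x - (y + t *\<^sub>R v))) has_real_derivative - (e \<bullet> v)) (at 0)"
      using norm_line_DERIV_0[of "x - y" "- v"] xy_ne by simp
    then show ?thesis by (rule has_field_derivative_at_within)
  qed
  have PN: "((\<lambda>t. profile C K (norm (x - (y + t *\<^sub>R v)))) has_real_derivative A1 * (- (e \<bullet> v))) (at 0 within {0..})"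
    using DERIV_chain2[OF _ N, of "profile C K"] profile_DERIV[OF Cp Kp, of s] s by (simp add: A1_def s_def)
  have U: "((\<lambda>t. u (y + t *\<^sub>R v)) has_real_derivative grad \<Omega> u y \<bullet> v) (at 0 within {0..})"
    by (rule boundary_has_derivative_ray[OF u y d])
  have EE: "((\<lambda>t. E (y + t *\<^sub>R v)) has_real_derivative gE y \<bullet> v) (at 0 within {0..})"
    using has_derivative_line[of E "gE y" y 0 v] E(1)[of y] by (auto intro: has_field_derivative_at_within)
  have T: "((\<lambda>t. Psi \<xi> z \<bullet> (x - (y + t *\<^sub>R v))) has_real_derivative - (Psi \<xi> z \<bullet> v)) (at 0 within {0..})"
    by (auto intro!: derivative_eq_intros simp: has_field_derivative_def mult.commute inner_minus_right)
  define D where "D = - (grad \<Omega> u y \<bullet> v) + A1 * (e \<bullet> v) * \<eta> - A * (gE y \<bullet> v) - Psi \<xi> z \<bullet> v"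
  have "(\<phi> has_real_derivative (- (grad \<Omega> u y \<bullet> v) - (A1 * (- (e \<bullet> v)) * (E x + E (y + 0 *\<^sub>R v)) + (0 + gE y \<bullet> v) * profile C K (norm (x - (y + 0 *\<^sub>R v))))
      + - (Psi \<xi> z \<bullet> v))) (at 0 within {0..})"
    unfolding \<phi>_def Phi_def
    by (rule derivative_eq_intros refl U PN EE T | simp)+
  also have "(- (grad \<Omega> u y \<bullet> v) - (A1 * (- (e \<bullet> v)) * (E x + E (y + 0 *\<^sub>R v)) + (0 + gE y \<bullet> v) * profile C K (norm (x - (y + 0 *\<^sub>R v))))
      + - (Psi \<xi> z \<bullet> v)) = D"
    by (simp add: D_def \<eta>_def A_def s_def algebra_simps)
  finally have \<phi>: "(\<phi> has_real_derivative D) (at 0 within {0..})" .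
  have "D > 0"
  proof -
    have sv: "- (A1 * (e \<bullet> v) * \<eta>) \<le> 3 * cO * A"
    proof -
      have "(x - y) \<bullet> v \<ge> - cO * s\<^sup>2" using nu(4)[OF yf x] by (simp add: v_def s_def)
      moreover have "(x - y) \<bullet> v = s * (e \<bullet> v)"
        using arg_cong[OF e(2), of "\<lambda>w. w \<bullet> v"] by simp
      ultimately have "s * (- (e \<bullet> v)) \<le> s * (cO * s)" by (simp add: power2_eq_square mult_ac)
      then have "- (e \<bullet> v) \<le> cO * s" using s by (simp only: mult_le_cancel_left_pos)
      then have "A1 * (- (e \<bullet> v)) \<le> A1 * (cO * s)" using A1(3) by (intro mult_left_mono) auto
      also have "\<dots> = cO * (A1 * s)" by simp
      also have "\<dots> \<le> cO * A" using A1(4) cO by (intro mult_left_mono)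
      finally have 1: "A1 * (- (e \<bullet> v)) \<le> cO * A" .
      have "A1 * (- (e \<bullet> v)) * \<eta> \<le> cO * A * \<eta>" using 1 \<eta> by (intro mult_right_mono) auto
      also have "\<dots> \<le> cO * A * 3" using \<eta> cO s_A by (intro mult_left_mono) auto
      finally show ?thesis by simp
    qed
    have gE: "A * (gE y \<bullet> v) \<le> - \<kappa> * A" using mult_left_mono[OF nu(5)[OF yf], of A] s_A by (simp add: v_def mult.commute)
    have g: "grad \<Omega> u y \<bullet> v = - (Psi y (u y) \<bullet> v)" using nu(3)[OF yf] by (simp add: v_def)
    have 1: "\<bar>(Psi y (u y) - Psi \<xi> z) \<bullet> v\<bar> \<le> 8 * \<Lambda> * A + 2 * \<Lambda>\<^sup>2 * A"
    proof -
      have "\<bar>(Psi y (u y) - Psi \<xi> z) \<bullet> v\<bar> \<le> norm (Psi y (u y) - Psi \<xi> z)"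
        using Cauchy_Schwarz_ineq2[of "Psi y (u y) - Psi \<xi> z" v] v by simp
      also have "\<dots> \<le> \<Lambda> * (norm (y - \<xi>) + \<bar>u y - z\<bar>)" by (rule Psi_lip[OF y ux(2) \<xi> z])
      also have "\<dots> \<le> \<Lambda> * ((A + \<Lambda> * A) + (7 * A + \<Lambda> * A))"
      proof (intro mult_left_mono add_mono)
        have L: "\<Lambda> * s \<le> \<Lambda> * A" using s_A \<Lambda> by (intro mult_left_mono) auto
        show "norm (y - \<xi>) \<le> A + \<Lambda> * A"
          using norm_triangle_ineq[of "y - x" "x - \<xi>"] x_\<xi> L s_A(1) by (simp add: s_def norm_minus_commute)
        show "\<bar>u y - z\<bar> \<le> 7 * A + \<Lambda> * A" using ux_z D_le A_le(3) L by linarith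
      qed (use \<Lambda> in auto)
      finally show ?thesis by (simp add: power2_eq_square algebra_simps)
    qed
    have "D = (Psi y (u y) - Psi \<xi> z) \<bullet> v + A1 * (e \<bullet> v) * \<eta> - A * (gE y \<bullet> v)"
      unfolding D_def g by (simp add: inner_diff_left algebra_simps)
    then have D: "D \<ge> - (8 * \<Lambda> * A + 2 * \<Lambda>\<^sup>2 * A) - 3 * cO * A + \<kappa> * A"
      using 1 sv gE by (simp add: abs_le_iff)
    moreover have "\<kappa> * A \<ge> (8 * \<Lambda> + 4 * \<Lambda>\<^sup>2 + 3 * cO + 1) * A" using \<kappa> s_A by (intro mult_right_mono) auto
    ultimately have "D \<ge> 2 * (\<Lambda>\<^sup>2 * A) + A" by (simp add: algebra_simps)
    moreover have "\<Lambda>\<^sup>2 * A \<ge> 0" using s_A by simp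
    ultimately show ?thesis using s_A by linarith
  qed
  from has_real_derivative_pos_inc_right[OF \<phi> this] obtain d2 where d2: "d2 > 0"
    "\<And>h. 0 < h \<Longrightarrow> h < d2 \<Longrightarrow> \<phi> 0 < \<phi> h" by auto
  define t where "t = min d (min d2 (s1 - s)) / 2"
  have t: "0 < t" "t < d" "t < d2" "t < s1 - s" using d d2 s_lt by (auto simp: t_def)
  have "norm (x - (y + t *\<^sub>R v)) \<le> s + t" unfolding s_def
    using norm_triangle_ineq4[of "x - y" "t *\<^sub>R v"] v t by (simp add: algebra_simps)
  then have "Phi K x (y + t *\<^sub>R v) \<xi> z \<le> Phi K x y \<xi> z"
    using t d(2)[OF t(1,2)] closure_subset by (intro max x \<xi> z) auto
  then show False using d2(2)[OF t(1,3)] by (simp add: \<phi>_def)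
qed

text \<open>The first order conditions place both gradients within \<open>\<beta>\<close> of
  \<open>k e\<close> and, because the same frozen vector occurs in both, within \<open>c1 A\<close>
  of each other. The second order condition then meets the hypotheses of
  \<open>concavity_bound\<close>, whose bound on \<open>C\<close> was excluded in advance.\<close>

lemma no_positive_max: False
proof -
  define p q where "p = grad \<Omega> u x" and "q = grad \<Omega> u y"
  obtain X where X: "twice_diff_at u (grad \<Omega> u) X x" using Ck_twice_diff_at[OF u op x_interior] .
  obtain Y where Y: "twice_diff_at u (grad \<Omega> u) Y y" using Ck_twice_diff_at[OF u op y_interior] .
  have X': "(grad \<Omega> u has_derivative X) (at x)" and Y': "(grad \<Omega> u has_derivative Y) (at y)"
    using X Y by (auto simp: twice_diff_at_def)
  note linX = has_derivative_linear[OF X'] and linY = has_derivative_linear[OF Y']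
  define \<psi> where "\<psi> = Psi \<xi> z"
  \<comment> \<open>With \<open>Psi \<xi> z\<close> frozen, the correction splits into a function of
    \<open>x\<close> and one of \<open>y\<close>; the only terms coupling the two points are those
    of the profile.\<close>
  define P where "P w = u w - (u w - z)\<^sup>2 - (norm (w - \<xi>))\<^sup>2 + \<psi> \<bullet> w" for w
  define gP where "gP w = (1 - 2 * (u w - z)) *\<^sub>R grad \<Omega> u w - 2 *\<^sub>R (w - \<xi>) + \<psi>" for w
  define HP where "HP a = \<theta> *\<^sub>R X a + (- (2 * (p \<bullet> a))) *\<^sub>R p - 2 *\<^sub>R a" for a
  define V where "V w = u w + \<psi> \<bullet> w" for w
  define gV where "gV w = grad \<Omega> u w + \<psi>" for w
  have P: "twice_diff_at P gP HP x"
  proof -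
    obtain d where d: "d > 0" "\<And>w. w \<in> ball x d \<Longrightarrow> (u has_derivative (\<lambda>h. grad \<Omega> u w \<bullet> h)) (at w)"
      using X by (auto simp: twice_diff_at_def)
    have "(P has_derivative (\<lambda>h. gP w \<bullet> h)) (at w)" if "w \<in> ball x d" for w
      unfolding P_def[abs_def] gP_def power2_norm_eq_inner
      by (auto intro!: derivative_eq_intros d(2)[OF that] simp: inner_add_left inner_diff_left inner_commute algebra_simps)
    moreover have "(gP has_derivative HP) (at x)"
    proof -
      have "((\<lambda>w. 1 - 2 * (u w - z)) has_derivative (\<lambda>a. - (2 * (p \<bullet> a)))) (at x)"
        unfolding p_def using d by (auto intro!: derivative_eq_intros)
      from has_derivative_scaleR[OF this X']
      have "((\<lambda>w. (1 - 2 * (u w - z)) *\<^sub>R grad \<Omega> u w) has_derivative (\<lambda>a. \<theta> *\<^sub>R X a + (- (2 * (p \<bullet> a))) *\<^sub>R p)) (at x)"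
        by (simp add: \<theta>_def p_def)
      moreover have "((\<lambda>w. 2 *\<^sub>R (w - \<xi>)) has_derivative (\<lambda>a. 2 *\<^sub>R a)) (at x)"
        by (auto intro!: derivative_eq_intros)
      ultimately have "((\<lambda>w. (1 - 2 * (u w - z)) *\<^sub>R grad \<Omega> u w - 2 *\<^sub>R (w - \<xi>)) has_derivative HP) (at x)"
        unfolding HP_def[abs_def] by (rule has_derivative_diff)
      from has_derivative_add[OF this has_derivative_const[of \<psi>]] show ?thesis
        unfolding gP_def[abs_def] by simp
    qed
    ultimately show ?thesis unfolding twice_diff_at_def using d(1) by blast
  qed
  have V: "twice_diff_at V gV Y y"
  proof -
    obtain d where d: "d > 0" "\<And>w. w \<in> ball y d \<Longrightarrow> (u has_derivative (\<lambda>h. grad \<Omega> u w \<bullet> h)) (at w)"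
      using Y by (auto simp: twice_diff_at_def)
    have "(V has_derivative (\<lambda>h. gV w \<bullet> h)) (at w)" if "w \<in> ball y d" for w
      unfolding V_def[abs_def] gV_def
      by (auto intro!: derivative_eq_intros d(2)[OF that] simp: inner_add_left)
    moreover have "(gV has_derivative Y) (at y)" unfolding gV_def[abs_def]
      by (auto intro!: derivative_eq_intros Y')
    ultimately show ?thesis unfolding twice_diff_at_def using d(1) by blast
  qed
  have EE: "twice_diff_at E gE (HE w) w" for w
    unfolding twice_diff_at_def using E by (auto intro: exI[of _ 1])
  have mx: "\<exists>d>0. \<forall>x'\<in>ball x d. \<forall>y'\<in>ball y d. P x' - V y' - profile C K (norm (x' - y')) * (E x' + E y')
        \<le> P x - V y - profile C K (norm (x - y)) * (E x + E y)"
  proof -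
    obtain dx where dx: "dx > 0" "ball x dx \<subseteq> \<Omega>" using op x_interior open_contains_ball by blast
    obtain dy where dy: "dy > 0" "ball y dy \<subseteq> \<Omega>" using op y_interior open_contains_ball by blast
    define d where "d = min dx (min dy ((s1 - s) / 2))"
    have d: "d > 0" "d \<le> dx" "d \<le> dy" "d \<le> (s1 - s) / 2"
      unfolding d_def using dx dy s_lt by (simp_all only: min_less_iff_conj min.cobounded1 min.coboundedI2 min.cobounded2) simp_all
    have eq: "P x' - V y' - profile C K (norm (x' - y')) * (E x' + E y') = Phi K x' y' \<xi> z" for x' y'
      by (simp add: P_def V_def Phi_def \<psi>_def inner_diff_right)
    have "Phi K x' y' \<xi> z \<le> Phi K x y \<xi> z" if "x' \<in> ball x d" "y' \<in> ball y d" for x' y'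
    proof (rule max[OF _ _ \<xi> z])
      have "x' \<in> ball x dx" "y' \<in> ball y dy" using that d by auto
      then show "x' \<in> closure \<Omega>" "y' \<in> closure \<Omega>" using dx dy closure_subset by blast+
      have "dist x' y' \<le> dist x' x + dist x y + dist y y'" using dist_triangle[of x' y' x] dist_triangle[of x y' y] by linarith
      then show "norm (x' - y') \<le> s1" using that d by (simp add: dist_norm s_def norm_minus_commute)
    qed
    then show ?thesis unfolding eq using d(1) by blast
  qed
  have A2: "(profile' C K has_real_derivative - C * A1\<^sup>2) (at (norm (x - y)))"
    unfolding A1_def s_def using profile'_DERIV[OF Cp Kp] by simp
  note D = doubling_first_second_order[OF P V EE EE xy_ne profile_DERIV[OF Cp Kp less_imp_le] A2 mx,
      folded s_def, folded A_def A1_def e_def \<eta>_def]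
  define k where "k = A1 * \<eta>"
  have k: "k > 0" using A1 \<eta> by (simp add: k_def)
  \<comment> \<open>\<open>k\<close> admits no bound independent of \<open>K\<close>; only
    \<open>s k\<close> does. For this reason every factor that multiplies a full gradient below
    carries an \<open>s\<close>.\<close>
  have sk: "s * k \<le> 3" "s * k \<le> 3 * A"
  proof -
    have "s * k = (A1 * s) * \<eta>" by (simp add: k_def)
    also have "\<dots> \<le> (A1 * s) * 3" using A1 s \<eta> by (intro mult_left_mono) auto
    finally have "s * k \<le> 3 * (A1 * s)" by simp
    then show "s * k \<le> 3" "s * k \<le> 3 * A" using A1(4,5) by linarith+
  qed
  have fx: "\<theta> *\<^sub>R p - k *\<^sub>R e = A *\<^sub>R gE x - \<psi> + 2 *\<^sub>R (x - \<xi>)"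
    using D(1) unfolding gP_def p_def[symmetric] \<theta>_def[symmetric] k_def by (simp add: algebra_simps)
  have fy: "q - k *\<^sub>R e = - (A *\<^sub>R gE y) - \<psi>"
    using D(2) unfolding gV_def q_def[symmetric] k_def by (simp add: algebra_simps)
  have n\<psi>: "norm \<psi> \<le> \<Lambda>" unfolding \<psi>_def by (rule Psi_bd[OF \<xi> z])
  have nE: "norm (A *\<^sub>R gE w) \<le> A * ME" "norm (A *\<^sub>R gE w) \<le> a0 * ME" if "w \<in> closure \<Omega>" for w
  proof -
    show 1: "norm (A *\<^sub>R gE w) \<le> A * ME" using E_bd(3)[OF that] s_A(3) by simp
    have "A * ME \<le> a0 * ME" using A_le(2) ME by (intro mult_right_mono)
    then show "norm (A *\<^sub>R gE w) \<le> a0 * ME" using 1 by linarith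
  qed
  have a0ME: "a0 * ME \<ge> 0" using a0 ME by simp
  have \<Lambda>s: "\<Lambda> * s \<le> \<Lambda> * s1" using s \<Lambda> by (intro mult_left_mono) auto
  have \<theta>1: "\<bar>\<theta> - 1\<bar> \<le> 2 * \<Lambda> * s" using ux_z by (simp add: \<theta>_def abs_minus_commute)
  have \<theta>: "\<theta> \<ge> 1 / 2" using \<theta>1 \<Lambda>s s1_le_1(2) by (simp add: abs_le_iff)
  have qb: "norm (q - k *\<^sub>R e) \<le> \<beta>"
  proof -
    have "norm (q - k *\<^sub>R e) \<le> norm (A *\<^sub>R gE y) + norm \<psi>"
      unfolding fy using norm_triangle_ineq4[of "- (A *\<^sub>R gE y)" \<psi>] by simp
    also have "\<dots> \<le> a0 * ME + \<Lambda>" using nE(2)[OF y] n\<psi> by linarith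
    also have "\<dots> \<le> \<beta>"
    proof -
      have "X + \<Lambda> \<le> 2 * (X + 3 * \<Lambda>) + 12 * \<Lambda>" if "X \<ge> 0" for X using that \<Lambda> by simp
      then show ?thesis unfolding \<beta>_def using a0ME .
    qed
    finally show ?thesis .
  qed
  have pb: "norm (p - k *\<^sub>R e) \<le> \<beta>"
  proof -
    have "\<theta> *\<^sub>R (p - k *\<^sub>R e) = A *\<^sub>R gE x - \<psi> + 2 *\<^sub>R (x - \<xi>) + ((1 - \<theta>) * k) *\<^sub>R e"
      using fx by (simp add: algebra_simps)
    then have "norm (\<theta> *\<^sub>R (p - k *\<^sub>R e)) \<le> norm (A *\<^sub>R gE x) + norm \<psi> + 2 * norm (x - \<xi>) + \<bar>1 - \<theta>\<bar> * k"
      using norm_triangle_ineq[of "A *\<^sub>R gE x - \<psi> + 2 *\<^sub>R (x - \<xi>)" "((1 - \<theta>) * k) *\<^sub>R e"]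
        norm_triangle_ineq[of "A *\<^sub>R gE x - \<psi>" "2 *\<^sub>R (x - \<xi>)"] norm_triangle_ineq4[of "A *\<^sub>R gE x" \<psi>] e(1) k
      by (simp add: abs_mult)
    also have "\<dots> \<le> a0 * ME + \<Lambda> + 2 * \<Lambda> + 6 * \<Lambda>"
    proof -
      have "\<bar>1 - \<theta>\<bar> * k \<le> (2 * \<Lambda> * s) * k" using \<theta>1 k by (intro mult_right_mono) auto
      also have "\<dots> = 2 * \<Lambda> * (s * k)" by simp
      also have "\<dots> \<le> 2 * \<Lambda> * 3" using sk \<Lambda> by (intro mult_left_mono) auto
      finally have "\<bar>1 - \<theta>\<bar> * k \<le> 6 * \<Lambda>" by simp
      moreover have "norm (x - \<xi>) \<le> \<Lambda>" using x_\<xi> mult_left_mono[OF s(3), of \<Lambda>] \<Lambda> by linarith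
      ultimately show ?thesis using nE(2)[OF x] n\<psi> by linarith
    qed
    finally have "\<theta> * norm (p - k *\<^sub>R e) \<le> a0 * ME + 9 * \<Lambda>" using \<theta> by simp
    moreover have "1 / 2 * norm (p - k *\<^sub>R e) \<le> \<theta> * norm (p - k *\<^sub>R e)" using \<theta> by (intro mult_right_mono) auto
    moreover have "Y \<le> 2 * (X + 3 * \<Lambda>) + 12 * \<Lambda>" if "W \<le> X + 9 * \<Lambda>" "1 / 2 * Y \<le> W" for X Y W
      using that by simp
    ultimately show ?thesis unfolding \<beta>_def by blast
  qed
  have pq: "norm (p - q) \<le> c1 * A"
  proof -
    \<comment> \<open>Both \<open>k e\<close> and \<open>\<psi>\<close> cancel in the difference.
      The full gradient is multiplied only by the defect \<open>1 - \<theta>\<close>, which is of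
      order \<open>s\<close>.\<close>
    have "p - q = (A *\<^sub>R gE x + A *\<^sub>R gE y) + 2 *\<^sub>R (x - \<xi>) + (1 - \<theta>) *\<^sub>R p"
    proof -
      have "p - q = (\<theta> *\<^sub>R p - k *\<^sub>R e) - (q - k *\<^sub>R e) + (1 - \<theta>) *\<^sub>R p" by (simp add: algebra_simps)
      then show ?thesis unfolding fx fy by simp
    qed
    then have "norm (p - q) \<le> norm (A *\<^sub>R gE x) + norm (A *\<^sub>R gE y) + 2 * norm (x - \<xi>) + \<bar>1 - \<theta>\<bar> * norm p"
      using norm_triangle_ineq[of "(A *\<^sub>R gE x + A *\<^sub>R gE y) + 2 *\<^sub>R (x - \<xi>)" "(1 - \<theta>) *\<^sub>R p"]
        norm_triangle_ineq[of "A *\<^sub>R gE x + A *\<^sub>R gE y" "2 *\<^sub>R (x - \<xi>)"] norm_triangle_ineq[of "A *\<^sub>R gE x" "A *\<^sub>R gE y"]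
      by simp
    moreover have "\<bar>1 - \<theta>\<bar> * norm p \<le> 2 * \<Lambda> * (3 + \<beta>) * A"
    proof -
      have "norm p \<le> k + \<beta>" using norm_triangle_sub[of p "k *\<^sub>R e"] pb e(1) k by simp
      then have "\<bar>1 - \<theta>\<bar> * norm p \<le> (2 * \<Lambda> * s) * (k + \<beta>)" using \<theta>1 \<Lambda> s by (intro mult_mono) auto
      also have "\<dots> = 2 * \<Lambda> * (s * k + s * \<beta>)" by (simp add: algebra_simps)
      also have "\<dots> \<le> 2 * \<Lambda> * (3 * A + A * \<beta>)" using sk s_A \<beta> \<Lambda> by (intro mult_left_mono add_mono mult_right_mono) auto
      finally show ?thesis by (simp add: algebra_simps)
    qed
    moreover have "2 * norm (x - \<xi>) \<le> 2 * \<Lambda> * A"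
    proof -
      have "\<Lambda> * s \<le> \<Lambda> * A" using s_A \<Lambda> by (intro mult_left_mono) auto
      then show ?thesis using x_\<xi> by simp
    qed
    ultimately show ?thesis using nE(1)[OF x] nE(1)[OF y] by (simp add: c1_def algebra_simps)
  qed
  have f12: "f (x, u x) - f (y, u y) \<ge> - \<Lambda> * s"
  proof -
    have "f (x, u y) \<le> f (x, u x)" using ux A_le(3) by (intro f_mono x_interior) auto
    moreover have "\<bar>f (x, u y) - f (y, u y)\<bar> \<le> \<Lambda> * s" unfolding s_def by (rule f_lip[OF x_interior y_interior ux(2)])
    ultimately show ?thesis by (simp add: abs_le_iff)
  qed
  have eqs: "mc_trace p X = f (x, u x) * mc_speed p" "mc_trace q Y = f (y, u y) * mc_speed q"
    using pde[OF x_interior] pde[OF y_interior] mean_curvature_op_eq[OF X'] mean_curvature_op_eq[OF Y']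
      mc_speed_pos[of p] mc_speed_pos[of q] unfolding p_def q_def by (simp_all add: field_simps)
  have HEb: "\<bar>HE w a \<bullet> a\<bar> \<le> ME * (norm a)\<^sup>2" if "w \<in> closure \<Omega>" for w a
  proof -
    have "\<bar>HE w a \<bullet> a\<bar> \<le> norm (HE w a) * norm a" by (rule Cauchy_Schwarz_ineq2)
    also have "\<dots> \<le> ME * norm a * norm a" using E_bd(4)[OF that] by (intro mult_right_mono) auto
    finally show ?thesis by (simp add: power2_eq_square)
  qed
  have sec: "\<theta> * (X a \<bullet> a) - 2 * (p \<bullet> a)\<^sup>2 - 2 * (norm a)\<^sup>2 - Y b \<bullet> b
        \<le> \<eta> * (- C * A1\<^sup>2 * ((a - b) \<bullet> e)\<^sup>2 + A1 / s * (norm (perp e (a - b)))\<^sup>2)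
           + 2 * A1 * ((a - b) \<bullet> e) * (gE x \<bullet> a + gE y \<bullet> b) + A * (HE x a \<bullet> a + HE y b \<bullet> b)" for a b
  proof -
    have "HP a \<bullet> a = \<theta> * (X a \<bullet> a) - 2 * (p \<bullet> a)\<^sup>2 - 2 * (norm a)\<^sup>2"
      by (simp add: HP_def inner_add_left inner_diff_left dot_square_norm power2_eq_square)
    then show ?thesis using D(3)[of a b] by simp
  qed
  have As: "A \<le> (1 + C * a0) * (s * A1)"
  proof -
    have "A \<le> (1 + C * A) * (s * A1)" unfolding A_def A1_def using profile_le_profile'[OF Cp Kp] s by simp
    also have "\<dots> \<le> (1 + C * a0) * (s * A1)" using A_le(2) Cp s A1(3) by (intro mult_right_mono add_left_mono mult_left_mono) auto
    finally show ?thesis .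
  qed
  have A1big: "120000 * real DIM('a) * \<beta>\<^sup>2 * c1\<^sup>2 * a0 * (1 + C * a0) \<le> A1\<^sup>2"
    using Kmin(4) power_mono[OF A1(1), of 2] Kmin(1) by linarith
  have \<beta>A1: "2 * \<beta> \<le> A1" using Kmin(2) A1(1) by linarith
  have fb: "\<bar>f (x, u x)\<bar> \<le> L" "\<bar>f (y, u y)\<bar> \<le> L" using f_bd x_interior y_interior ux by auto
  have \<Lambda>0: "0 \<le> \<Lambda>" using \<Lambda> by simp
  note concavity_bound[OF e(1) linX linY sec \<eta> A1(2) s(1,3) A1(5) s_A(3) A_le(2) C1
     E_bd(3)[OF x] E_bd(3)[OF y] HEb[OF x] HEb[OF y] \<beta>(2) \<beta>A1 pb[unfolded k_def] qb[unfolded k_def] pq c1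
     fb f12 \<theta>1 \<Lambda>0 eqs As A1big]
  then show False using C_big by linarith
qed

end

section \<open>Lowering the scale and reading off the gradient bound\<close>

lemma Phi_continuous:
  assumes "K > 0"
  shows "continuous_on ((closure \<Omega> \<times> closure \<Omega>) \<times> (closure \<Omega> \<times> {-M0..M0}))
    (\<lambda>w. Phi K (fst (fst w)) (snd (fst w)) (fst (snd w)) (snd (snd w)))"
proof -
  have cu: "continuous_on (closure \<Omega>) u" using u by (rule Ck_continuous_on)
  have cE: "continuous_on UNIV E"
    using E(1) by (intro continuous_at_imp_continuous_on ballI has_derivative_continuous)
  have cp: "continuous_on {0..} (profile C K)"
    using profile_DERIV[of C K] C1 assms by (intro continuous_at_imp_continuous_on ballI DERIV_isCont) auto
  show ?thesis unfolding Phi_def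
    by (intro continuous_intros continuous_on_compose2[OF cu] continuous_on_compose2[OF cE]
        continuous_on_compose2[OF cp] continuous_on_compose2[OF Psi_cont, of _ "\<lambda>w. (fst (snd w), snd (snd w))", unfolded fst_conv snd_conv]) auto
qed

lemma Phi_nonpos_step:
  assumes K: "K \<ge> K0" and np: "Phi_nonpos (2 * K)"
  shows "Phi_nonpos K"
proof (rule ccontr)
  assume "\<not> Phi_nonpos K"
  then obtain x0 y0 \<xi>0 z0 where w0: "x0 \<in> closure \<Omega>" "y0 \<in> closure \<Omega>" "\<xi>0 \<in> closure \<Omega>" "z0 \<in> {-M0..M0}"
    "norm (x0 - y0) \<le> s1" "Phi K x0 y0 \<xi>0 z0 > 0" unfolding Phi_nonpos_def by force
  define S where "S = ((closure \<Omega> \<times> closure \<Omega>) \<times> (closure \<Omega> \<times> {-M0..M0})) \<inter> {w. norm (fst (fst w) - snd (fst w)) \<le> s1}"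
  have Kp: "K > 0" using K K0_pos by simp
  have "compact (closure \<Omega>)" using bd by (simp add: compact_closure)
  then have cS: "compact S" unfolding S_def
    by (intro compact_Int_closed compact_Times closed_Collect_le continuous_intros) auto
  have "continuous_on S (\<lambda>w. Phi K (fst (fst w)) (snd (fst w)) (fst (snd w)) (snd (snd w)))"
    by (rule continuous_on_subset[OF Phi_continuous[OF Kp]]) (auto simp: S_def)
  moreover have w0S: "((x0, y0), (\<xi>0, z0)) \<in> S" using w0 by (auto simp: S_def)
  ultimately obtain w where w: "w \<in> S" "\<And>w'. w' \<in> S \<Longrightarrow>
      Phi K (fst (fst w')) (snd (fst w')) (fst (snd w')) (snd (snd w')) \<le> Phi K (fst (fst w)) (snd (fst w)) (fst (snd w)) (snd (snd w))"
    using continuous_attains_sup[OF cS] by (metis (no_types, lifting) empty_iff)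
  obtain x y \<xi> z where w_eq: "w = ((x, y), (\<xi>, z))" by (metis surj_pair)
  show False
  proof (rule no_positive_max[of K x y \<xi> z])
    show "K \<ge> K0" "Phi_nonpos (2 * K)" by (fact K np)+
    show "x \<in> closure \<Omega>" "y \<in> closure \<Omega>" "\<xi> \<in> closure \<Omega>" "z \<in> {-M0..M0}" "norm (x - y) \<le> s1"
      using w(1) by (auto simp: w_eq S_def)
    show "Phi K x y \<xi> z > 0" using w(2)[OF w0S] w0(6) by (simp add: w_eq)
    show "Phi K x' y' \<xi>' z' \<le> Phi K x y \<xi> z" if "x' \<in> closure \<Omega>" "y' \<in> closure \<Omega>" "\<xi>' \<in> closure \<Omega>" "z' \<in> {-M0..M0}"
       "norm (x' - y') \<le> s1" for x' y' \<xi>' z'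
      using w(2)[of "((x', y'), (\<xi>', z'))"] that by (simp add: w_eq S_def)
  qed
qed

text \<open>For large \<open>K\<close> the profile dominates \<open>(Lu + \<Lambda>) s\<close> up to
  distance \<open>s1\<close>, and \<open>E x + E y \<ge> 1\<close>. The threshold depends on the
  Lipschitz constant of \<open>u\<close>.\<close>

lemma Phi_nonpos_large: "\<exists>K1. \<forall>K\<ge>K1. Phi_nonpos K"
proof -
  obtain Lu where Lu: "\<And>x y. x \<in> closure \<Omega> \<Longrightarrow> y \<in> closure \<Omega> \<Longrightarrow> \<bar>u x - u y\<bar> \<le> Lu * norm (x - y)"
    using ulip by blast
  have Cp: "C > 0" using C1 by simp
  obtain K1 where K1: "K1 > 0" "\<And>K s. K \<ge> K1 \<Longrightarrow> 0 \<le> s \<Longrightarrow> s \<le> s1 \<Longrightarrow> (Lu + \<Lambda>) * s \<le> profile C K s"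
    using profile_dominates_linear[OF Cp s1(1), of "Lu + \<Lambda>"] by blast
  have "Phi_nonpos K" if K: "K \<ge> K1" for K
    unfolding Phi_nonpos_def
  proof (intro ballI impI)
    fix x y \<xi> z assume a: "x \<in> closure \<Omega>" "y \<in> closure \<Omega>" "\<xi> \<in> closure \<Omega>" "z \<in> {-M0..M0}" "norm (x - y) \<le> s1"
    have Kp: "K > 0" using K K1 by simp
    have "Psi \<xi> z \<bullet> (x - y) \<le> norm (Psi \<xi> z) * norm (x - y)" by (rule norm_cauchy_schwarz)
    also have "\<dots> \<le> \<Lambda> * norm (x - y)" using Psi_bd[OF a(3,4)] by (intro mult_right_mono) auto
    finally have 1: "Psi \<xi> z \<bullet> (x - y) \<le> \<Lambda> * norm (x - y)" .
    have 2: "u x - u y \<le> Lu * norm (x - y)" using Lu[OF a(1,2)] by simp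
    have 3: "(Lu + \<Lambda>) * norm (x - y) \<le> profile C K (norm (x - y))" using K1(2)[OF K _ a(5)] by simp
    have "profile C K (norm (x - y)) * 1 \<le> profile C K (norm (x - y)) * (E x + E y)"
      using E_bd(1)[OF a(1)] E_bd(1)[OF a(2)] profile_nonneg[OF Cp Kp, of "norm (x - y)"] by (intro mult_left_mono) auto
    moreover have "(norm (x - \<xi>))\<^sup>2 \<ge> 0" "(u x - z)\<^sup>2 \<ge> 0" by auto
    ultimately show "Phi K x y \<xi> z \<le> 0" using 1 2 3[unfolded distrib_right] unfolding Phi_def by linarith
  qed
  then show ?thesis by blast
qed

text \<open>Halving starts at some \<open>2^j K0\<close> beyond the unknown threshold. Every
  intermediate scale is at least \<open>K0\<close>, so each step is legitimate and the process ends
  at \<open>K0\<close> itself, whatever the threshold was.\<close>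

lemma Phi_nonpos_K0: "Phi_nonpos K0"
proof -
  obtain K1 where K1: "\<And>K. K \<ge> K1 \<Longrightarrow> Phi_nonpos K" using Phi_nonpos_large by blast
  obtain j :: nat where j: "K1 / K0 < 2 ^ j" using real_arch_pow[of 2 "K1 / K0"] by auto
  have "Phi_nonpos (2 ^ j * K0)" using j K0_pos by (intro K1) (simp add: divide_less_eq)
  then show ?thesis
  proof (induction j)
    case (Suc j)
    have "K0 \<le> 2 ^ j * K0" using K0_pos by simp
    from Phi_nonpos_step[OF this] Suc show ?case by (simp add: mult.assoc)
  qed simp
qed

text \<open>With \<open>\<xi> = x\<close> and \<open>z = u x\<close>, nonpositivity at
  \<open>K0\<close> is a Lipschitz bound for distances up to \<open>s1\<close>: the profile is at
  most \<open>K0 s\<close> and 3 bounds \<open>E x + E y\<close>. Differentiating in the direction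
  of the gradient gives the bound in \<open>\<Omega>\<close>, and continuity carries it to the
  closure.\<close>

theorem gradient_bound:
  assumes "x \<in> closure \<Omega>" shows "norm (grad \<Omega> u x) \<le> 3 * K0 + \<Lambda>"
proof (rule continuous_le_on_closure[of \<Omega> "\<lambda>x. norm (grad \<Omega> u x)" x "3 * K0 + \<Lambda>", OF _ assms])
  show "continuous_on (closure \<Omega>) (\<lambda>x. norm (grad \<Omega> u x))"
    by (intro continuous_on_norm Ck_grad_continuous_on[OF u])
  have Cp: "C > 0" using C1 by simp
  have lip: "u x - u y \<le> (3 * K0 + \<Lambda>) * norm (x - y)" if xy: "x \<in> closure \<Omega>" "y \<in> closure \<Omega>" "norm (x - y) \<le> s1" for x y
  proof -
    have ux: "u x \<in> {-M0..M0}" using uM[OF xy(1)] by auto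
    have "Phi K0 x y x (u x) \<le> 0" using Phi_nonpos_K0 xy ux unfolding Phi_nonpos_def by blast
    then have "u x - u y \<le> profile C K0 (norm (x - y)) * (E x + E y) - Psi x (u x) \<bullet> (x - y)" by (simp add: Phi_def)
    moreover have "profile C K0 (norm (x - y)) * (E x + E y) \<le> (K0 * norm (x - y)) * 3"
      using profile_le_linear[OF Cp K0_pos, of "norm (x - y)"] E_bd(1,2)[OF xy(1)] E_bd(1,2)[OF xy(2)] K0_pos
      by (intro mult_mono) auto
    moreover have "- (Psi x (u x) \<bullet> (x - y)) \<le> \<Lambda> * norm (x - y)"
      using Cauchy_Schwarz_ineq2[of "Psi x (u x)" "x - y"] mult_right_mono[OF Psi_bd[OF xy(1) ux], of "norm (x - y)"] by simp
    ultimately show ?thesis by (simp add: algebra_simps)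
  qed
  fix x assume x: "x \<in> \<Omega>"
  show "norm (grad \<Omega> u x) \<le> 3 * K0 + \<Lambda>"
  proof (rule ccontr)
    assume n: "\<not> norm (grad \<Omega> u x) \<le> 3 * K0 + \<Lambda>"
    define g where "g = grad \<Omega> u x"
    define v where "v = sgn g"
    have g0: "g \<noteq> 0" using n K0_pos \<Lambda> by (auto simp: g_def)
    have v: "norm v = 1" "g \<bullet> v = norm g"
      using g0 by (auto simp: v_def norm_sgn sgn_div_norm dot_square_norm power2_eq_square)
    have "((\<lambda>t. u (x + t *\<^sub>R v)) has_real_derivative g \<bullet> v) (at 0)"
      using has_derivative_line[of u g x 0 v] has_derivative_grad[OF Ck_Suc_differentiable[OF u x] x] by (simp add: g_def)
    then have "((\<lambda>t. u (x + t *\<^sub>R v) - (3 * K0 + \<Lambda>) * t) has_real_derivative norm g - (3 * K0 + \<Lambda>)) (at 0)"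
      by (auto intro!: derivative_eq_intros simp: v(2))
    moreover have "norm g - (3 * K0 + \<Lambda>) > 0" using n by (simp add: g_def)
    ultimately obtain d where d: "d > 0" "\<And>h. 0 < h \<Longrightarrow> h < d \<Longrightarrow>
        u (x + 0 *\<^sub>R v) - (3 * K0 + \<Lambda>) * 0 < u (x + (0 + h) *\<^sub>R v) - (3 * K0 + \<Lambda>) * (0 + h)"
      using DERIV_pos_inc_right by blast
    obtain r where r: "r > 0" "ball x r \<subseteq> \<Omega>" using op x open_contains_ball by blast
    define h where "h = min d (min r s1) / 2"
    have h: "0 < h" "h < d" "h < r" "h \<le> s1" using d r s1 by (auto simp: h_def)
    have "x + h *\<^sub>R v \<in> ball x r" using h v by (simp add: dist_norm)
    then have "x + h *\<^sub>R v \<in> closure \<Omega>" "x \<in> closure \<Omega>" using r x closure_subset by blast+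
    from lip[OF this] have "u (x + h *\<^sub>R v) - u x \<le> (3 * K0 + \<Lambda>) * h" using h v by simp
    then show False using d(2)[OF h(1,2)] by simp
  qed
qed

end

section \<open>Auxiliary functions and constants determined by the domain\<close>

lemma lipschitz_on_cball:
  fixes G :: "'a::euclidean_space \<Rightarrow> 'a"
  assumes G: "\<And>x. (G has_derivative H x) (at x)" and H: "\<And>x h. norm x \<le> B \<Longrightarrow> norm (H x h) \<le> M * norm h"
    and xy: "norm x \<le> B" "norm y \<le> B"
  shows "norm (G x - G y) \<le> M * norm (x - y)"
proof (rule differentiable_bound[of "cball 0 B" G H])
  show "(G has_derivative H z) (at z within cball 0 B)" if "z \<in> cball 0 B" for z
    using G has_derivative_at_withinI by blast
  show "onorm (H z) \<le> M" if "z \<in> cball 0 B" for z using H[of z] that by (intro onorm_le) auto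
qed (use xy in auto)

text \<open>Applied to the defining function, which vanishes at a frontier point and is nonnegative
  on the closure, this gives the uniform exterior ball condition.\<close>

lemma C2_with_taylor:
  fixes f :: "'a::euclidean_space \<Rightarrow> real"
  assumes f: "C2_with f G" and G: "\<And>x. (G has_derivative H x) (at x)"
    and H: "\<And>x h. norm x \<le> B \<Longrightarrow> norm (H x h) \<le> M * norm h" and M: "M \<ge> 0"
    and xy: "norm x \<le> B" "norm y \<le> B"
  shows "f y - f x \<le> G x \<bullet> (y - x) + M * (norm (y - x))\<^sup>2"
proof -
  have seg: "norm z \<le> B" if "z \<in> closed_segment y x" for z
    using closed_segment_subset[of y "cball 0 B" x] that xy by auto
  have "\<bar>(f y - G x \<bullet> y) - (f x - G x \<bullet> x)\<bar> \<le> (M * norm (y - x)) * norm (y - x)"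
  proof (rule lipschitz_on_segment[of y x "closed_segment y x"])
    show "((\<lambda>z. f z - G x \<bullet> z) has_derivative (\<lambda>v. (G z - G x) \<bullet> v)) (at z)" for z
      by (auto intro!: derivative_eq_intros C2_withD[OF f] simp: inner_diff_left)
    show "norm (G z - G x) \<le> M * norm (y - x)" if "z \<in> closed_segment y x" for z
    proof -
      have "norm (G z - G x) \<le> M * norm (z - x)"
        by (rule lipschitz_on_cball[OF G H seg[OF that] xy(1)])
      also have "\<dots> \<le> M * norm (y - x)"
        using segment_bound1[of z y x] segment_bound(2)[of z y x] that M
        by (intro mult_left_mono) (auto simp: norm_minus_commute)
      finally show ?thesis .
    qed
  qed auto
  then show ?thesis by (simp add: inner_diff_right power2_eq_square)
qed

text \<open>Truncating the norm from below keeps the normalization Lipschitz where the vector is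
  short or zero. With \<open>c = c0\<close> the resulting field agrees with the unit normal on the
  frontier and extends it to the closure.\<close>

lemma norm_normalize_diff:
  fixes a b :: "'a::euclidean_space"
  assumes c: "c > 0"
  shows "norm (a /\<^sub>R max c (norm a) - b /\<^sub>R max c (norm b)) \<le> 2 / c * norm (a - b)"
proof -
  define m n where "m = max c (norm a)" and "n = max c (norm b)"
  have m: "m \<ge> c" "m > 0" and n: "n \<ge> c" "n \<ge> norm b" "n > 0" using c by (auto simp: m_def n_def)
  have mn: "\<bar>n - m\<bar> \<le> norm (a - b)"
    using norm_triangle_ineq2[of a b] norm_triangle_ineq2[of b a] unfolding m_def n_def
    by (auto simp: norm_minus_commute max_def)
  have "a /\<^sub>R m - b /\<^sub>R n = (a - b) /\<^sub>R m + ((n - m) / (m * n)) *\<^sub>R b"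
    using m n by (simp add: scaleR_diff_right diff_divide_distrib scaleR_diff_left inverse_eq_divide)
  then have "norm (a /\<^sub>R m - b /\<^sub>R n) \<le> norm (a - b) / m + \<bar>n - m\<bar> / (m * n) * norm b"
    using norm_triangle_ineq[of "(a - b) /\<^sub>R m" "((n - m) / (m * n)) *\<^sub>R b"] m n
    by (simp add: abs_mult divide_inverse mult.commute)
  also have "\<dots> = norm (a - b) / m + \<bar>n - m\<bar> / m * (norm b / n)" by simp
  also have "\<dots> \<le> norm (a - b) / c + norm (a - b) / c * 1"
    using m n c mn by (intro add_mono mult_mono frac_le) auto
  also have "\<dots> = 2 / c * norm (a - b)" by simp
  finally show ?thesis by (simp add: m_def n_def)
qed

lemma neumann_gradient_bound:
  fixes \<Omega> :: "'a::euclidean_space set"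
  assumes dom: "bounded_domain \<Omega>" and C3: "C3_boundary \<Omega>" and M0: "M0 > 0" and L1: "L1 > 0" and L3: "L3 > 0"
  obtains M2 where "M2 > 0"
    "\<And>\<gamma> f \<psi> u x. \<lbrakk>\<And>p. p \<in> frontier \<Omega> \<Longrightarrow> inward_unit_normal \<Omega> p (\<gamma> p); rhs_conditions \<Omega> M0 L1 f;
      Ck 1 (open_cyl \<Omega> M0) (closed_cyl \<Omega> M0) \<psi>; C1_norm (open_cyl \<Omega> M0) (closed_cyl \<Omega> M0) \<psi> \<le> L3;
      Ck 2 \<Omega> (closure \<Omega>) u; \<And>x. x \<in> closure \<Omega> \<Longrightarrow> \<bar>u x\<bar> \<le> M0;
      \<And>x. x \<in> \<Omega> \<Longrightarrow> mean_curvature_op \<Omega> u x = f (x, u x);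
      \<And>x. x \<in> frontier \<Omega> \<Longrightarrow> grad \<Omega> u x \<bullet> \<gamma> x + \<psi> (x, u x) = 0; x \<in> closure \<Omega>\<rbrakk>
      \<Longrightarrow> norm (grad \<Omega> u x) \<le> M2"
proof -
  have op: "open \<Omega>" and bd: "bounded \<Omega>" using dom by (auto simp: bounded_domain_def)
  obtain \<rho> R where \<rho>: "C2_with \<rho> R" "\<And>x. x \<in> closure \<Omega> \<Longrightarrow> \<rho> x \<ge> 0"
    "\<And>x. x \<in> frontier \<Omega> \<Longrightarrow> \<rho> x = 0" "\<And>x. \<rho> x > 0 \<Longrightarrow> x \<in> \<Omega>"
    "\<And>x. x \<in> frontier \<Omega> \<Longrightarrow> R x \<noteq> 0"
    "\<And>x v. x \<in> frontier \<Omega> \<Longrightarrow> inward_unit_normal \<Omega> x v \<Longrightarrow> v = sgn (R x)"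
    using defining_function[OF dom C3] by blast
  obtain \<Lambda>q where \<Lambda>q: "\<Lambda>q \<ge> 1" "quasi_lipschitz_constant \<Omega> \<Lambda>q"
    using quasiconvex_lipschitz[OF dom C3] .
  obtain B where B: "\<And>x. x \<in> closure \<Omega> \<Longrightarrow> norm x \<le> B"
    using bounded_closure[OF bd] unfolding bounded_iff by blast
  have Bf: "norm x \<le> B" "x \<in> closure \<Omega>" if "x \<in> frontier \<Omega>" for x
    using B that by (auto simp: frontier_def)
  obtain M H where M: "M \<ge> 0" "\<And>x. (R has_derivative H x) (at x)" "\<And>x h. norm x \<le> B \<Longrightarrow> norm (H x h) \<le> M * norm h"
    by (rule C2_with_bounds[OF \<rho>(1), of B]) blast
  have "\<exists>c0>0. \<forall>x\<in>frontier \<Omega>. c0 \<le> norm (R x)"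
  proof (cases "frontier \<Omega> = {}")
    case False
    have "continuous_on (frontier \<Omega>) (\<lambda>x. norm (R x))"
      by (intro continuous_on_norm C2_with_continuous(2)[OF \<rho>(1)])
    then obtain x where "x \<in> frontier \<Omega>" "\<forall>y\<in>frontier \<Omega>. norm (R x) \<le> norm (R y)"
      using continuous_attains_inf[OF compact_frontier_bounded[OF bd] False] by blast
    then show ?thesis using \<rho>(5) by (intro exI[of _ "norm (R x)"]) auto
  qed (auto intro: exI[of _ 1])
  then obtain c0 where c0: "c0 > 0" "\<And>x. x \<in> frontier \<Omega> \<Longrightarrow> c0 \<le> norm (R x)" by blast
  define cO where "cO = M / c0"
  \<comment> \<open>A common bound: \<open>\<Lambda>q L1\<close> for \<open>f\<close> in
    \<open>x\<close>, \<open>\<Lambda>q L3 + 2 L3 M / c0\<close> for \<open>\<psi> G\<close> in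
    \<open>x\<close>, and \<open>L3\<close> both for \<open>\<psi> G\<close> in \<open>z\<close> and
    for its size.\<close>
  define \<Lambda> where "\<Lambda> = 1 + \<Lambda>q * L1 + \<Lambda>q * L3 + 2 * L3 * M / c0 + L3"
  have parts: "\<Lambda>q * L1 > 0" "\<Lambda>q * L3 > 0" "2 * L3 * M / c0 \<ge> 0" using \<Lambda>q(1) L1 L3 M(1) c0(1) by auto
  have \<Lambda>: "\<Lambda> \<ge> 1" "\<Lambda> \<ge> \<Lambda>q * L1" "\<Lambda> \<ge> \<Lambda>q * L3 + 2 * L3 * M / c0" "\<Lambda> \<ge> L3"
    unfolding \<Lambda>_def using parts L3 by linarith+
  have cO: "cO \<ge> 0" using M c0 by (simp add: cO_def)
  define \<kappa> where "\<kappa> = 8 * \<Lambda> + 4 * \<Lambda>\<^sup>2 + 3 * cO + 1"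
  have \<kappa>: "\<kappa> > 0" unfolding \<kappa>_def using \<Lambda> cO by (intro add_nonneg_pos add_nonneg_nonneg) auto
  define k where "k = \<kappa> / c0"
  have k: "k > 0" using \<kappa> c0 by (simp add: k_def)
  \<comment> \<open>On the frontier \<open>\<rho> = 0\<close>, so the inward slope of
    \<open>E\<close> is \<open>- k |R|\<close>, at most \<open>- k c0 = - \<kappa>\<close>. Since
    \<open>\<rho> \<ge> 0\<close> on the closure, \<open>E\<close> stays between 1/2 and 3/2 there
    however large \<open>k\<close> is.\<close>
  define E where "E x = 1 / 2 + exp (- k * \<rho> x)" for x
  define gE where "gE x = (- k * exp (- k * \<rho> x)) *\<^sub>R R x" for x
  have E: "C2_with E gE"
    unfolding E_def[abs_def] gE_def[abs_def]
    by (rule C2_with_compose[OF \<rho>(1), of "\<lambda>t. 1 / 2 + exp (- k * t)" "\<lambda>t. - k * exp (- k * t)" "\<lambda>t. k\<^sup>2 * exp (- k * t)"])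
       (auto intro!: derivative_eq_intros continuous_intros simp: power2_eq_square)
  obtain ME HE where ME: "ME \<ge> 0" "\<And>x. (gE has_derivative HE x) (at x)"
     "\<And>x. norm x \<le> B \<Longrightarrow> norm (gE x) \<le> ME" "\<And>x h. norm x \<le> B \<Longrightarrow> norm (HE x h) \<le> ME * norm h"
    by (rule C2_with_bounds[OF E, of B]) blast
  define G where "G x = R x /\<^sub>R max c0 (norm (R x))" for x
  define a0 where "a0 = 2 * M0 + \<Lambda>"
  define \<beta> where "\<beta> = 2 * (a0 * ME + 3 * \<Lambda>) + 12 * \<Lambda>"
  define c1 where "c1 = 2 * ME + 2 * \<Lambda> + 2 * \<Lambda> * (3 + \<beta>)"
  define C where "C = 1 + \<bar>3 * ((\<Lambda> + 2 * \<Lambda> * L1) * (4 + \<beta>) + L1 * c1 * a0 + 3 + 2 * real DIM('a)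
      + 4 * real DIM('a) * real DIM('a) * (4 * \<beta> + 4) * ME + 2 * a0 * ME * real DIM('a))\<bar>"
  define Kmin where "Kmin = 1 + 2 * \<beta> + 120000 * real DIM('a) * \<beta>\<^sup>2 * c1\<^sup>2 * a0 * (1 + C * a0)"
  define s1 where "s1 = min (1 / (4 * \<Lambda>)) (1 / (2 * C * Kmin))"
  define K0 where "K0 = 2 * Kmin + exp (C * a0) / (C * s1)"
  have C: "C \<ge> 1" by (simp add: C_def)
  have a0: "a0 > 0" using M0 \<Lambda> by (simp add: a0_def)
  have "a0 * ME \<ge> 0" using a0 ME by simp
  then have \<beta>: "\<beta> \<ge> 0" using \<Lambda> by (simp add: \<beta>_def)
  have Kmin: "Kmin \<ge> 1"
  proof -
    have "120000 * real DIM('a) * \<beta>\<^sup>2 * c1\<^sup>2 * a0 * (1 + C * a0) \<ge> 0"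
      using a0 C by (intro mult_nonneg_nonneg add_nonneg_nonneg) auto
    then show ?thesis using \<beta> unfolding Kmin_def by linarith
  qed
  have s1: "s1 > 0" "s1 \<le> 1 / (4 * \<Lambda>)" "s1 \<le> 1 / (2 * C * Kmin)"
    using \<Lambda> C Kmin by (auto simp: s1_def)
  have ex: "exp (C * a0) / (C * s1) > 0" using C s1 by simp
  have K0: "K0 \<ge> 2 * Kmin" "K0 \<ge> exp (C * a0) / (C * s1)"
    unfolding K0_def using ex Kmin by linarith+
  show thesis
  proof (rule that[of "3 * K0 + \<Lambda>"])
    show "3 * K0 + \<Lambda> > 0" using K0 Kmin \<Lambda> by linarith
    fix \<gamma> f \<psi> u and x :: 'a
    assume \<gamma>: "\<And>p. p \<in> frontier \<Omega> \<Longrightarrow> inward_unit_normal \<Omega> p (\<gamma> p)" and f: "rhs_conditions \<Omega> M0 L1 f"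
      and \<psi>: "Ck 1 (open_cyl \<Omega> M0) (closed_cyl \<Omega> M0) \<psi>" and \<psi>n: "C1_norm (open_cyl \<Omega> M0) (closed_cyl \<Omega> M0) \<psi> \<le> L3"
      and u: "Ck 2 \<Omega> (closure \<Omega>) u" and uM: "\<And>x. x \<in> closure \<Omega> \<Longrightarrow> \<bar>u x\<bar> \<le> M0"
      and pde: "\<And>x. x \<in> \<Omega> \<Longrightarrow> mean_curvature_op \<Omega> u x = f (x, u x)"
      and bc: "\<And>x. x \<in> frontier \<Omega> \<Longrightarrow> grad \<Omega> u x \<bullet> \<gamma> x + \<psi> (x, u x) = 0" and x: "x \<in> closure \<Omega>"
    have \<gamma>_eq: "\<gamma> p = sgn (R p)" if "p \<in> frontier \<Omega>" for p using \<rho>(6)[OF that \<gamma>[OF that]] .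
    have u2: "Ck (Suc (Suc 0)) \<Omega> (closure \<Omega>) u" using u by (simp only: numeral_2_eq_2)
    have f1: "Ck 1 (open_cyl \<Omega> M0) (closed_cyl \<Omega> M0) f"
      and fz: "\<And>p. p \<in> closed_cyl \<Omega> M0 \<Longrightarrow> 0 \<le> deriv_z (open_cyl \<Omega> M0) f p"
      and fb: "\<And>p. p \<in> closed_cyl \<Omega> M0 \<Longrightarrow> \<bar>f p\<bar> + norm (grad_x (open_cyl \<Omega> M0) f p) \<le> L1"
      using f by (auto simp only: rhs_conditions_def)
    have fb': "\<bar>f p\<bar> \<le> L1" "norm (grad_x (open_cyl \<Omega> M0) f p) \<le> L1" if "p \<in> closed_cyl \<Omega> M0" for p
      using fb[OF that] norm_ge_zero[of "grad_x (open_cyl \<Omega> M0) f p"] abs_ge_zero[of "f p"] by linarith+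
    note \<psi>b = cyl_C1_norm_bounds[OF \<psi> M0 bd \<psi>n]
    define Psi where "Psi x z = \<psi> (x, z) *\<^sub>R G x" for x z
    have G1: "norm (G x) \<le> 1" for x
    proof -
      have "norm (R x) / max c0 (norm (R x)) \<le> 1" using c0(1) by (simp add: divide_le_eq)
      then show ?thesis using c0(1) by (simp add: G_def divide_inverse mult.commute)
    qed
    have Glip: "norm (G x - G y) \<le> 2 * M / c0 * norm (x - y)" if "x \<in> closure \<Omega>" "y \<in> closure \<Omega>" for x y
    proof -
      have "norm (G x - G y) \<le> 2 / c0 * norm (R x - R y)" unfolding G_def by (rule norm_normalize_diff[OF c0(1)])
      also have "\<dots> \<le> 2 / c0 * (M * norm (x - y))"
        using lipschitz_on_cball[OF M(2,3) B[OF that(1)] B[OF that(2)]] c0(1) by (intro mult_left_mono) auto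
      finally show ?thesis by simp
    qed
    have "doubled_neumann \<Omega> u f Psi E gE HE \<gamma> M0 L1 \<Lambda> ME \<kappa> cO a0 \<beta> c1 C Kmin s1 K0"
    proof
      show "open \<Omega>" "bounded \<Omega>" "Ck (Suc (Suc 0)) \<Omega> (closure \<Omega>) u" by (fact op bd u2)+
      show "\<bar>u x\<bar> \<le> M0" if "x \<in> closure \<Omega>" for x using uM[OF that] .
      show "\<exists>Lu. \<forall>x\<in>closure \<Omega>. \<forall>y\<in>closure \<Omega>. \<bar>u x - u y\<bar> \<le> Lu * norm (x - y)"
        using Ck_lipschitz_closure[OF u2 bd \<Lambda>q(2)] by metis
      show "mean_curvature_op \<Omega> u x = f (x, u x)" if "x \<in> \<Omega>" for x using pde[OF that] .
      show "\<bar>f (x, z)\<bar> \<le> L1" if "x \<in> \<Omega>" "z \<in> {-M0..M0}" for x z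
        using that closure_subset by (intro fb') auto
      show "\<bar>f (x, z) - f (y, z)\<bar> \<le> \<Lambda> * norm (x - y)" if "x \<in> \<Omega>" "y \<in> \<Omega>" "z \<in> {-M0..M0}" for x y z
      proof -
        have c: "x \<in> closure \<Omega>" "y \<in> closure \<Omega>" using that closure_subset by auto
        have "\<bar>f (x, z) - f (y, z)\<bar> \<le> \<Lambda>q * L1 * norm (x - y)"
          by (rule cyl_lipschitz_x[OF f1 M0 dom \<Lambda>q(2) fb' c that(3)])
        also have "\<dots> \<le> \<Lambda> * norm (x - y)" using \<Lambda>(2) by (intro mult_right_mono) auto
        finally show ?thesis .
      qed
      show "f (x, z) \<le> f (x, z')" if "x \<in> \<Omega>" "- M0 \<le> z" "z \<le> z'" "z' \<le> M0" for x z z'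
        by (rule cyl_mono_z[OF f1 M0 fz that])
      show "norm (Psi x z) \<le> \<Lambda>" if "x \<in> closure \<Omega>" "z \<in> {-M0..M0}" for x z
      proof -
        have "\<bar>\<psi> (x, z)\<bar> * norm (G x) \<le> L3 * 1" using \<psi>b(1)[of "(x, z)"] that G1[of x] L3 by (intro mult_mono) auto
        then show ?thesis using \<Lambda>(4) by (simp add: Psi_def)
      qed
      show "norm (Psi x z - Psi x' z') \<le> \<Lambda> * (norm (x - x') + \<bar>z - z'\<bar>)"
        if "x \<in> closure \<Omega>" "z \<in> {-M0..M0}" "x' \<in> closure \<Omega>" "z' \<in> {-M0..M0}" for x z x' z'
      proof -
        have 1: "\<bar>\<psi> (x, z) - \<psi> (x', z)\<bar> \<le> \<Lambda>q * L3 * norm (x - x')"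
          by (rule cyl_lipschitz_x[OF \<psi> M0 dom \<Lambda>q(2) \<psi>b(1,2) that(1,3,2)])
        have 2: "\<bar>\<psi> (x', z) - \<psi> (x', z')\<bar> \<le> L3 * \<bar>z - z'\<bar>"
          by (rule cyl_lipschitz_z[OF \<psi> M0 \<psi>b(3) that(3,2,4)])
        have "Psi x z - Psi x' z' = \<psi> (x, z) *\<^sub>R (G x - G x') + (\<psi> (x, z) - \<psi> (x', z')) *\<^sub>R G x'"
          by (simp add: Psi_def algebra_simps)
        then have "norm (Psi x z - Psi x' z') \<le> \<bar>\<psi> (x, z)\<bar> * norm (G x - G x') + \<bar>\<psi> (x, z) - \<psi> (x', z')\<bar> * norm (G x')"
          using norm_triangle_ineq[of "\<psi> (x, z) *\<^sub>R (G x - G x')" "(\<psi> (x, z) - \<psi> (x', z')) *\<^sub>R G x'"] by simp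
        also have "\<dots> \<le> L3 * (2 * M / c0 * norm (x - x')) + (\<Lambda>q * L3 * norm (x - x') + L3 * \<bar>z - z'\<bar>) * 1"
        proof (intro add_mono mult_mono)
          show "\<bar>\<psi> (x, z) - \<psi> (x', z')\<bar> \<le> \<Lambda>q * L3 * norm (x - x') + L3 * \<bar>z - z'\<bar>" using 1 2 by linarith
          show "0 \<le> \<Lambda>q * L3 * norm (x - x') + L3 * \<bar>z - z'\<bar>" using \<Lambda>q(1) L3 by simp
        qed (use \<psi>b(1)[of "(x, z)"] Glip[OF that(1,3)] G1[of x'] L3 that in auto)
        also have "\<dots> = (\<Lambda>q * L3 + 2 * L3 * M / c0) * norm (x - x') + L3 * \<bar>z - z'\<bar>" by (simp add: algebra_simps)
        also have "\<dots> \<le> \<Lambda> * norm (x - x') + \<Lambda> * \<bar>z - z'\<bar>"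
          using \<Lambda> by (intro add_mono mult_right_mono) auto
        finally show ?thesis by (simp add: algebra_simps)
      qed
      show "continuous_on (closure \<Omega> \<times> {-M0..M0}) (\<lambda>p. Psi (fst p) (snd p))"
      proof -
        have cR: "continuous_on UNIV R" by (rule C2_with_continuous(2)[OF \<rho>(1)])
        have "continuous_on UNIV G" unfolding G_def[abs_def] using c0(1)
          by (intro continuous_intros cR) auto
        then have "continuous_on (closure \<Omega> \<times> {-M0..M0}) (\<lambda>p. G (fst p))"
          by (rule continuous_on_compose2) (auto intro!: continuous_intros)
        then show ?thesis unfolding Psi_def using cyl_continuous[OF \<psi> M0]
          by (simp add: continuous_on_scaleR)
      qed
      show "(E has_derivative (\<lambda>h. gE x \<bullet> h)) (at x)" "(gE has_derivative HE x) (at x)" for x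
        using C2_withD[OF E] ME(2) by auto
      show "1 / 2 \<le> E x" "E x \<le> 3 / 2" if "x \<in> closure \<Omega>" for x
        using \<rho>(2)[OF that] k by (auto simp: E_def)
      show "norm (gE x) \<le> ME" "norm (HE x h) \<le> ME * norm h" if "x \<in> closure \<Omega>" for x h
        using ME(3,4) B[OF that] by auto
      fix p assume p: "p \<in> frontier \<Omega>"
      have Rp: "R p \<noteq> 0" "norm (R p) > 0" using \<rho>(5)[OF p] by auto
      have sg: "sgn (R p) = R p /\<^sub>R norm (R p)" by (simp add: sgn_div_norm)
      have Rg: "R p \<bullet> \<gamma> p = norm (R p)"
        using Rp by (simp add: \<gamma>_eq[OF p] sg dot_square_norm power2_eq_square)
      show "norm (\<gamma> p) = 1" using Rp by (simp add: \<gamma>_eq[OF p] norm_sgn)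
      show "\<exists>d>0. \<forall>t. 0 < t \<longrightarrow> t < d \<longrightarrow> p + t *\<^sub>R \<gamma> p \<in> \<Omega>"
        using pos_derivative_imp_pos[OF C2_withD[OF \<rho>(1)] \<rho>(3)[OF p], of "\<gamma> p"] Rg Rp \<rho>(4) by (metis)
      show "grad \<Omega> u p \<bullet> \<gamma> p = - (Psi p (u p) \<bullet> \<gamma> p)"
      proof -
        have "max c0 (norm (R p)) = norm (R p)" using c0(2)[OF p] by simp
        then have "G p \<bullet> \<gamma> p = 1" using Rg Rp by (simp add: G_def)
        then show ?thesis using bc[OF p] by (simp add: Psi_def)
      qed
      show "gE p \<bullet> \<gamma> p \<le> - \<kappa>"
      proof -
        have "gE p \<bullet> \<gamma> p = - (k * norm (R p))" using Rg by (simp add: gE_def \<rho>(3)[OF p])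
        moreover have "k * c0 \<le> k * norm (R p)" using c0(2)[OF p] k by (intro mult_left_mono) auto
        moreover have "k * c0 = \<kappa>" using c0(1) by (simp add: k_def)
        ultimately show ?thesis by simp
      qed
      fix y assume y: "y \<in> closure \<Omega>"
      show "(y - p) \<bullet> \<gamma> p \<ge> - cO * (norm (y - p))\<^sup>2"
      proof -
        have "\<rho> y - \<rho> p \<le> R p \<bullet> (y - p) + M * (norm (y - p))\<^sup>2"
          by (rule C2_with_taylor[OF \<rho>(1) M(2,3,1) Bf(1)[OF p] B[OF y]])
        then have 1: "- M * (norm (y - p))\<^sup>2 \<le> R p \<bullet> (y - p)" using \<rho>(2)[OF y] \<rho>(3)[OF p] by simp
        have "(y - p) \<bullet> \<gamma> p = (R p \<bullet> (y - p)) / norm (R p)"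
          by (simp add: \<gamma>_eq[OF p] sg inner_commute divide_inverse mult.commute)
        moreover have "(- M * (norm (y - p))\<^sup>2) / norm (R p) \<le> (R p \<bullet> (y - p)) / norm (R p)"
          using 1 by (intro divide_right_mono) auto
        moreover have "M * (norm (y - p))\<^sup>2 / norm (R p) \<le> M * (norm (y - p))\<^sup>2 / c0"
          using c0 c0(2)[OF p] M(1) Rp by (intro divide_left_mono) auto
        ultimately show ?thesis by (simp add: cO_def)
      qed
    next
      show "M0 > 0" "\<Lambda> \<ge> 1" "cO \<ge> 0" "ME \<ge> 0" "L1 \<ge> 0" using M0 \<Lambda> cO ME L1 by auto
      show "\<kappa> \<ge> 8 * \<Lambda> + 4 * \<Lambda>\<^sup>2 + 3 * cO + 1" by (simp add: \<kappa>_def)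
      show "C > 3 * ((\<Lambda> + 2 * \<Lambda> * L1) * (4 + \<beta>) + L1 * c1 * a0 + 3 + 2 * real DIM('a)
      + 4 * real DIM('a) * real DIM('a) * (4 * \<beta> + 4) * ME + 2 * a0 * ME * real DIM('a))"
        unfolding C_def by linarith
    qed (fact a0_def \<beta>_def c1_def C Kmin_def s1 K0)+
    then show "norm (grad \<Omega> u x) \<le> 3 * K0 + \<Lambda>" by (rule doubled_neumann.gradient_bound[OF _ x])
  qed
qed

section \<open>The interior gradient estimate\<close>

text \<open>The second difference over a parallelogram of side \<open>t\<close> is symmetric in its
  two directions. The mean value theorem in one direction shows that it equals \<open>t^2\<close>
  times the mixed derivative up to \<open>\<epsilon> t^2\<close>, using differentiability of
  \<open>g\<close> at \<open>x\<close> alone. The result is needed for \<open>u\<close> and for its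
  first partial derivatives.\<close>

lemma twice_diff_at_symmetric:
  fixes u :: "'a::euclidean_space \<Rightarrow> real"
  assumes u: "twice_diff_at u g H x"
  shows "H h \<bullet> k = H k \<bullet> h"
proof -
  obtain d where d: "d > 0" "\<And>y. y \<in> ball x d \<Longrightarrow> (u has_derivative (\<lambda>h. g y \<bullet> h)) (at y)"
    and g: "(g has_derivative H) (at x)" using u by (auto simp: twice_diff_at_def)
  have lin: "linear H" using has_derivative_linear[OF g] .
  define c where "c = (norm h + norm k) * (2 * (norm h + norm k))"
  have c: "c \<ge> 0" by (simp add: c_def)
  have "\<bar>H h \<bullet> k - H k \<bullet> h\<bar> \<le> 2 * c * \<epsilon>" if \<epsilon>: "\<epsilon> > 0" for \<epsilon>
  proof -
    obtain \<delta> where \<delta>: "\<delta> > 0" "\<And>y. norm (y - x) < \<delta> \<Longrightarrow> norm (g y - g x - H (y - x)) \<le> \<epsilon> * norm (y - x)"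
      using g \<epsilon> unfolding has_derivative_at_alt by blast
    define t where "t = min d \<delta> / (2 * (norm h + norm k + 1))"
    have nn: "norm h + norm k + 1 > 0" by (simp add: add_nonneg_pos)
    have t: "t > 0" using d \<delta> nn by (simp add: t_def)
    have small: "r * norm h + s * norm k < min d \<delta>" if "0 \<le> r" "r \<le> t" "0 \<le> s" "s \<le> t" for r s
    proof -
      have "r * norm h + s * norm k \<le> t * norm h + t * norm k" using that by (intro add_mono mult_right_mono) auto
      also have "\<dots> \<le> t * (norm h + norm k + 1)" using t by (simp add: algebra_simps)
      also have "\<dots> = min d \<delta> / 2" using nn by (simp add: t_def field_simps)
      also have "\<dots> < min d \<delta>"
      proof -
        have "min d \<delta> > 0" using d(1) \<delta>(1) by simp
        then show ?thesis by linarith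
      qed
      finally show ?thesis .
    qed
    \<comment> \<open>Stated for an abstract pair because it is used once in each order; the
      condition on the norms keeps the constant \<open>c\<close> common to both uses.\<close>
    have key: "\<bar>(u (x + t *\<^sub>R a + t *\<^sub>R b) - u (x + t *\<^sub>R a) - (u (x + t *\<^sub>R b) - u x)) - t * t * (H b \<bullet> a)\<bar> \<le> t * t * (c * \<epsilon>)"
      if ab: "norm a + norm b = norm h + norm k"
        "\<And>r s. 0 \<le> r \<Longrightarrow> r \<le> t \<Longrightarrow> 0 \<le> s \<Longrightarrow> s \<le> t \<Longrightarrow> r * norm a + s * norm b < min d \<delta>" for a b
    proof -
      have bnd: "norm (r *\<^sub>R a + s *\<^sub>R b) < min d \<delta>" if "0 \<le> r" "r \<le> t" "0 \<le> s" "s \<le> t" for r s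
        using norm_triangle_ineq[of "r *\<^sub>R a" "s *\<^sub>R b"] ab(2)[OF that] that by simp
      define F where "F r = u (x + t *\<^sub>R b + r *\<^sub>R a) - u (x + r *\<^sub>R a)" for r
      have D: "(F has_real_derivative (g (x + t *\<^sub>R b + r *\<^sub>R a) \<bullet> a - g (x + r *\<^sub>R a) \<bullet> a)) (at r)" if r: "0 \<le> r" "r \<le> t" for r
        unfolding F_def
      proof (intro DERIV_diff has_derivative_line d)
        show "x + t *\<^sub>R b + r *\<^sub>R a \<in> ball x d" 
        proof -
          have "dist x (x + t *\<^sub>R b + r *\<^sub>R a) = norm (- (r *\<^sub>R a + t *\<^sub>R b))"
            unfolding dist_norm by (rule arg_cong[of _ _ norm]) simp
          then have "dist x (x + t *\<^sub>R b + r *\<^sub>R a) = norm (r *\<^sub>R a + t *\<^sub>R b)" by (simp only: norm_minus_cancel)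
          then show ?thesis using bnd[of r t] r t by simp
        qed
        show "x + r *\<^sub>R a \<in> ball x d" using bnd[of r 0] r t by (simp add: dist_norm)
      qed
      obtain r where r: "0 < r" "r < t" "F t - F 0 = (t - 0) * (g (x + t *\<^sub>R b + r *\<^sub>R a) \<bullet> a - g (x + r *\<^sub>R a) \<bullet> a)"
        using MVT2[OF t D] by auto
      define y1 y2 where "y1 = x + t *\<^sub>R b + r *\<^sub>R a" and "y2 = x + r *\<^sub>R a"
      have y: "y1 - x = r *\<^sub>R a + t *\<^sub>R b" "y2 - x = r *\<^sub>R a" by (simp_all add: y1_def y2_def)
      have e1: "norm (g y1 - g x - H (y1 - x)) \<le> \<epsilon> * (t * (norm a + norm b))"
      proof -
        have "norm (y1 - x) \<le> r * norm a + t * norm b" unfolding y using norm_triangle_ineq[of "r *\<^sub>R a" "t *\<^sub>R b"] r t by simp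
        also have "\<dots> \<le> t * norm a + t * norm b" using r by (intro add_mono mult_right_mono) auto
        finally have "norm (y1 - x) \<le> t * (norm a + norm b)" by (simp add: algebra_simps)
        then have "\<epsilon> * norm (y1 - x) \<le> \<epsilon> * (t * (norm a + norm b))" using \<epsilon> by (intro mult_left_mono) auto
        moreover have "norm (y1 - x) < \<delta>" unfolding y using bnd[of r t] r t by simp
        ultimately show ?thesis using \<delta>(2)[of y1] by linarith
      qed
      have e2: "norm (g y2 - g x - H (y2 - x)) \<le> \<epsilon> * (t * (norm a + norm b))"
      proof -
        have "norm (y2 - x) \<le> t * norm a" unfolding y using r by (simp add: mult_right_mono)
        also have "\<dots> \<le> t * (norm a + norm b)" using t by (intro mult_left_mono) auto
        finally have "\<epsilon> * norm (y2 - x) \<le> \<epsilon> * (t * (norm a + norm b))" using \<epsilon> by (intro mult_left_mono) auto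
        moreover have "norm (y2 - x) < \<delta>" unfolding y using bnd[of r 0] r t by simp
        ultimately show ?thesis using \<delta>(2)[of y2] by linarith
      qed
      have "H (y1 - x) - H (y2 - x) = t *\<^sub>R H b" unfolding y using lin by (simp add: linear_add linear_cmul)
      then have "(g y1 \<bullet> a - g y2 \<bullet> a) - t * (H b \<bullet> a) = ((g y1 - g x - H (y1 - x)) - (g y2 - g x - H (y2 - x))) \<bullet> a"
        by (simp add: inner_diff_left algebra_simps flip: inner_scaleR_left)
      then have "\<bar>(g y1 \<bullet> a - g y2 \<bullet> a) - t * (H b \<bullet> a)\<bar> \<le> norm ((g y1 - g x - H (y1 - x)) - (g y2 - g x - H (y2 - x))) * norm a"
        using Cauchy_Schwarz_ineq2 by metis
      also have "\<dots> \<le> (2 * (\<epsilon> * (t * (norm a + norm b)))) * (norm a + norm b)"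
        using norm_triangle_ineq4[of "g y1 - g x - H (y1 - x)" "g y2 - g x - H (y2 - x)"] e1 e2
        \<epsilon> t by (intro mult_mono) (auto intro!: mult_nonneg_nonneg add_nonneg_nonneg)
      also have "\<dots> = t * (c * \<epsilon>)" by (simp add: c_def ab(1))
      finally have "t * \<bar>(g y1 \<bullet> a - g y2 \<bullet> a) - t * (H b \<bullet> a)\<bar> \<le> t * (t * (c * \<epsilon>))" using t by (intro mult_left_mono) auto
      moreover have "F t - F 0 - t * t * (H b \<bullet> a) = t * ((g y1 \<bullet> a - g y2 \<bullet> a) - t * (H b \<bullet> a))"
        unfolding r(3) y1_def y2_def by (simp add: algebra_simps)
      ultimately have "\<bar>F t - F 0 - t * t * (H b \<bullet> a)\<bar> \<le> t * t * (c * \<epsilon>)" using t by (simp add: abs_mult)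
      moreover have "F t - F 0 = u (x + t *\<^sub>R a + t *\<^sub>R b) - u (x + t *\<^sub>R a) - (u (x + t *\<^sub>R b) - u x)"
        by (simp add: F_def algebra_simps)
      ultimately show ?thesis by simp
    qed
    have k1: "\<bar>(u (x + t *\<^sub>R h + t *\<^sub>R k) - u (x + t *\<^sub>R h) - (u (x + t *\<^sub>R k) - u x)) - t * t * (H k \<bullet> h)\<bar> \<le> t * t * (c * \<epsilon>)"
      by (rule key) (use small in auto)
    have k2: "\<bar>(u (x + t *\<^sub>R k + t *\<^sub>R h) - u (x + t *\<^sub>R k) - (u (x + t *\<^sub>R h) - u x)) - t * t * (H h \<bullet> k)\<bar> \<le> t * t * (c * \<epsilon>)"
    proof (rule key)
      show "r * norm k + s * norm h < min d \<delta>" if "0 \<le> r" "r \<le> t" "0 \<le> s" "s \<le> t" for r s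
        using small[OF that(3,4,1,2)] by (simp only: add.commute)
    qed simp
    have comm: "x + t *\<^sub>R k + t *\<^sub>R h = x + t *\<^sub>R h + t *\<^sub>R k" by simp
    have "\<bar>t * t * (H h \<bullet> k) - t * t * (H k \<bullet> h)\<bar> \<le> 2 * (t * t * (c * \<epsilon>))" using k1 k2[unfolded comm] by linarith
    moreover have "t * t * (H h \<bullet> k) - t * t * (H k \<bullet> h) = (t * t) * (H h \<bullet> k - H k \<bullet> h)" by (simp add: algebra_simps)
    moreover have "2 * (t * t * (c * \<epsilon>)) = (t * t) * (2 * c * \<epsilon>)" by simp
    ultimately have "(t * t) * \<bar>H h \<bullet> k - H k \<bullet> h\<bar> \<le> (t * t) * (2 * c * \<epsilon>)" using t by (simp add: abs_mult)
    then show ?thesis using t by (simp only: mult_le_cancel_left_pos mult_pos_pos)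
  qed
  then have lim: "\<bar>H h \<bullet> k - H k \<bullet> h\<bar> \<le> \<epsilon>" if "\<epsilon> > 0" for \<epsilon>
  proof -
    have "\<bar>H h \<bullet> k - H k \<bullet> h\<bar> \<le> 2 * c * (\<epsilon> / (2 * c + 1))" using that c by (intro \<open>\<And>\<epsilon>. \<epsilon> > 0 \<Longrightarrow> _ \<le> 2 * c * \<epsilon>\<close>) auto
    also have "\<dots> \<le> \<epsilon>" using that c by (simp add: divide_le_eq)
    finally show ?thesis .
  qed
  have "\<bar>H h \<bullet> k - H k \<bullet> h\<bar> \<le> 0" by (rule field_le_epsilon) (use lim in simp)
  then show ?thesis by simp
qed

lemma product_second_order:
  assumes a: "twice_diff_at \<zeta> g\<zeta> H\<zeta> x" and w: "twice_diff_at w gw Hw x"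
    and max: "\<exists>d>0. \<forall>y\<in>ball x d. \<zeta> y * w y \<le> \<zeta> x * w x"
  shows "w x *\<^sub>R g\<zeta> x + \<zeta> x *\<^sub>R gw x = 0"
    and "w x * (H\<zeta> \<sigma> \<bullet> \<sigma>) + 2 * (g\<zeta> x \<bullet> \<sigma>) * (gw x \<bullet> \<sigma>) + \<zeta> x * (Hw \<sigma> \<bullet> \<sigma>) \<le> 0"
proof -
  have main: "w x * (g\<zeta> x \<bullet> \<sigma>) + \<zeta> x * (gw x \<bullet> \<sigma>) = 0 \<and>
     w x * (H\<zeta> \<sigma> \<bullet> \<sigma>) + 2 * (g\<zeta> x \<bullet> \<sigma>) * (gw x \<bullet> \<sigma>) + \<zeta> x * (Hw \<sigma> \<bullet> \<sigma>) \<le> 0" for \<sigma>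
  proof -
    obtain d1 where d1: "d1 > 0"
      "\<And>t. \<bar>t\<bar> < d1 \<Longrightarrow> ((\<lambda>t. \<zeta> (x + t *\<^sub>R \<sigma>)) has_real_derivative g\<zeta> (x + t *\<^sub>R \<sigma>) \<bullet> \<sigma>) (at t)"
      "((\<lambda>t. g\<zeta> (x + t *\<^sub>R \<sigma>) \<bullet> \<sigma>) has_real_derivative H\<zeta> \<sigma> \<bullet> \<sigma>) (at 0)"
      using twice_diff_at_line[OF a] by blast
    obtain d2 where d2: "d2 > 0"
      "\<And>t. \<bar>t\<bar> < d2 \<Longrightarrow> ((\<lambda>t. w (x + t *\<^sub>R \<sigma>)) has_real_derivative gw (x + t *\<^sub>R \<sigma>) \<bullet> \<sigma>) (at t)"
      "((\<lambda>t. gw (x + t *\<^sub>R \<sigma>) \<bullet> \<sigma>) has_real_derivative Hw \<sigma> \<bullet> \<sigma>) (at 0)"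
      using twice_diff_at_line[OF w] by blast
    obtain d3 where d3: "d3 > 0" "\<And>y. y \<in> ball x d3 \<Longrightarrow> \<zeta> y * w y \<le> \<zeta> x * w x" using max by blast
    define d4 where "d4 = d3 / (norm \<sigma> + 1)"
    have ns: "norm \<sigma> + 1 > 0" by (simp add: add_nonneg_pos)
    have d4: "d4 > 0" using d3 ns by (simp add: d4_def)
    define d where "d = min d1 (min d2 d4)"
    have d: "d > 0" "d \<le> d1" "d \<le> d2" "d \<le> d4" using d1 d2 d4 by (auto simp: d_def)
    define f where "f t = \<zeta> (x + t *\<^sub>R \<sigma>) * w (x + t *\<^sub>R \<sigma>)" for t
    define f' where "f' t = (g\<zeta> (x + t *\<^sub>R \<sigma>) \<bullet> \<sigma>) * w (x + t *\<^sub>R \<sigma>) + (gw (x + t *\<^sub>R \<sigma>) \<bullet> \<sigma>) * \<zeta> (x + t *\<^sub>R \<sigma>)" for t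
    have D: "(f has_real_derivative f' t) (at t)" if "\<bar>t\<bar> < d" for t
      unfolding f_def f'_def using that d by (intro DERIV_mult d1 d2) auto
    have mx: "f t \<le> f 0" if "\<bar>t\<bar> < d" for t
    proof -
      have "\<bar>t\<bar> * norm \<sigma> \<le> \<bar>t\<bar> * (norm \<sigma> + 1)" by (intro mult_left_mono) auto
      also have "\<dots> < d3"
      proof -
        have "\<bar>t\<bar> < d3 / (norm \<sigma> + 1)" using that d unfolding d4_def by simp
        then show ?thesis using ns by (simp add: pos_less_divide_eq)
      qed
      finally show ?thesis using d3(2)[of "x + t *\<^sub>R \<sigma>"] by (simp add: f_def dist_norm)
    qed
    have "(f' has_real_derivative ((H\<zeta> \<sigma> \<bullet> \<sigma>) * w (x + 0 *\<^sub>R \<sigma>) + (gw (x + 0 *\<^sub>R \<sigma>) \<bullet> \<sigma>) * (g\<zeta> (x + 0 *\<^sub>R \<sigma>) \<bullet> \<sigma>))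
        + ((Hw \<sigma> \<bullet> \<sigma>) * \<zeta> (x + 0 *\<^sub>R \<sigma>) + (g\<zeta> (x + 0 *\<^sub>R \<sigma>) \<bullet> \<sigma>) * (gw (x + 0 *\<^sub>R \<sigma>) \<bullet> \<sigma>))) (at 0)"
      unfolding f'_def using d1(1) d2(1) by (intro DERIV_add DERIV_mult d1(3) d2(3) d1(2) d2(2)) auto
    from second_derivative_at_max[OF d(1) D this mx] show ?thesis
      by (simp add: f'_def algebra_simps)
  qed
  show "w x *\<^sub>R g\<zeta> x + \<zeta> x *\<^sub>R gw x = 0"
  proof (rule vector_eq_rdot[THEN iffD1], rule allI)
    fix \<sigma> show "(w x *\<^sub>R g\<zeta> x + \<zeta> x *\<^sub>R gw x) \<bullet> \<sigma> = 0 \<bullet> \<sigma>"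
      using conjunct1[OF main[of \<sigma>]] by (simp add: inner_add_left)
  qed
  show "w x * (H\<zeta> \<sigma> \<bullet> \<sigma>) + 2 * (g\<zeta> x \<bullet> \<sigma>) * (gw x \<bullet> \<sigma>) + \<zeta> x * (Hw \<sigma> \<bullet> \<sigma>) \<le> 0"
    using main by blast
qed

text \<open>The pointwise content of the interior estimate: \<open>K e\<close> is the gradient at
  the maximum, \<open>H\<close> the Hessian of \<open>u\<close>, \<open>W\<close> that of
  \<open>Du \<bullet> e\<close>, \<open>Z\<close> the cutoff, \<open>r\<close> the gradient of its
  exponent \<open>\<phi>\<close>, and \<open>Q\<close>, \<open>Q1\<close> the right-hand side and
  its derivative along \<open>e\<close>. Summing over a root of the coefficient matrix and replacing
  \<open>H e\<close> by a multiple of \<open>r\<close> leaves \<open>C1 N\<close> as leading term,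
  with \<open>N\<close> the quadratic form of that matrix at \<open>r\<close>. It does not
  degenerate because \<open>r\<close> contains \<open>c K e\<close>, whose square offsets the weight
  \<open>1 / v^2\<close> in direction \<open>e\<close>.\<close>

lemma bernstein_algebra:
  fixes e b r :: "'a::euclidean_space" and H W :: "'a \<Rightarrow> 'a" and K Z C1 c m L1 Q Q1 R :: real
  assumes e: "norm e = 1" and K: "K > 0" and H: "linear H" and W: "linear W"
    and Z: "Z > 0" "Z * K \<ge> 1" "Z + 1 \<le> exp C1" and C1: "C1 \<ge> 1" and c: "c > 0" and m: "m \<ge> 0" and R: "R > 0"
    and r: "r = b + (c * K) *\<^sub>R e" and b: "norm b \<le> 2 / R"
    and fst_order: "(K * (C1 * (Z + 1))) *\<^sub>R r + Z *\<^sub>R H e = 0"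
    and snd_order: "\<And>\<sigma>. K * (C1\<^sup>2 * (Z + 1) * (r \<bullet> \<sigma>)\<^sup>2 + C1 * (Z + 1) * (- m * (norm \<sigma>)\<^sup>2 + c * (H \<sigma> \<bullet> \<sigma>)))
        + 2 * (C1 * (Z + 1) * (r \<bullet> \<sigma>)) * (H e \<bullet> \<sigma>) + Z * (W \<sigma> \<bullet> \<sigma>) \<le> 0"
    and pde: "mc_trace (K *\<^sub>R e) H = Q * mc_speed (K *\<^sub>R e)" and Q: "\<bar>Q\<bar> \<le> L1"
    and dpde: "trace_form W - K\<^sup>2 * (W e \<bullet> e) / (1 + K\<^sup>2) - 2 * K * (norm (H e))\<^sup>2 / (1 + K\<^sup>2)
        + 2 * K ^ 3 * (H e \<bullet> e)\<^sup>2 / (1 + K\<^sup>2)\<^sup>2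
      = Q1 * mc_speed (K *\<^sub>R e) + Q * (K * (H e \<bullet> e) / mc_speed (K *\<^sub>R e))" and Q1: "Q1 \<ge> - L1"
    and Kbig: "K \<ge> 1" "K \<ge> 4 * exp C1" "K \<ge> 4 / (R * c)"
  shows "C1 * c\<^sup>2 / 16 \<le> m * DIM('a) + L1 * c + 2 * L1 / R + 2 * L1"
proof -
  define p where "p = K *\<^sub>R e"
  define v where "v = mc_speed p"
  define S where "S = C1 * (Z + 1)"
  define N where "N = (norm r)\<^sup>2 - K\<^sup>2 * (r \<bullet> e)\<^sup>2 / v\<^sup>2"
  define h where "h = H e \<bullet> e"
  have ee: "e \<bullet> e = 1" using e by (simp add: dot_square_norm)
  have np: "norm p = K" using e K by (simp add: p_def)
  have v2: "v\<^sup>2 = 1 + K\<^sup>2" by (simp add: v_def np)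
  have v: "v > 0" "v \<ge> K" using mc_speed_ge_norm[of p] by (auto simp: v_def np)
  have v2K: "v \<le> 2 * K" using mc_speed_le[of p] Kbig(1) by (simp add: v_def np)
  have L1: "L1 \<ge> 0" using Q by linarith
  have S: "S > 0" using C1 Z by (simp add: S_def)
  define \<sigma> where "\<sigma> = mc_root e p (1 / sqrt (1 + (p \<bullet> e)\<^sup>2))"
  have tr: "(\<Sum>i\<in>Basis. X (\<sigma> i) \<bullet> \<sigma> i) = mc_trace p X" if "linear X" for X
    unfolding \<sigma>_def by (rule mc_root_trace[OF that e]) (simp add: power_divide add_pos_nonneg)
  have tr_r: "(\<Sum>i\<in>Basis. (r \<bullet> \<sigma> i)\<^sup>2) = N"
  proof -
    have "linear (\<lambda>h. (r \<bullet> h) *\<^sub>R r)" by (auto intro!: linearI simp: inner_add_right algebra_simps)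
    from tr[OF this] have "(\<Sum>i\<in>Basis. (r \<bullet> \<sigma> i)\<^sup>2) = mc_trace p (\<lambda>h. (r \<bullet> h) *\<^sub>R r)" by (simp add: power2_eq_square)
    also have "\<dots> = N"
      by (simp add: mc_trace_def trace_form_def sum_Basis_inner_mult N_def v2 np)
         (simp add: p_def dot_square_norm power2_eq_square)
    finally show ?thesis .
  qed
  have tr_id: "(\<Sum>i\<in>Basis. (norm (\<sigma> i))\<^sup>2) \<le> DIM('a)"
  proof -
    have "(\<Sum>i\<in>Basis. (norm (\<sigma> i))\<^sup>2) = mc_trace p (\<lambda>h. h)"
      using tr[OF linear_id[unfolded id_def]] by (simp add: power2_norm_eq_inner)
    also have "\<dots> \<le> DIM('a)" by (simp add: mc_trace_def trace_form_def inner_Basis)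
    finally show ?thesis .
  qed
  have trH: "(\<Sum>i\<in>Basis. H (\<sigma> i) \<bullet> \<sigma> i) = Q * v" using tr[OF H] pde by (simp add: v_def p_def)
  have He: "Z *\<^sub>R H e = - ((K * S) *\<^sub>R r)" using fst_order by (simp add: S_def eq_neg_iff_add_eq_0 add.commute)
  have He': "Z * (H e \<bullet> a) = - (K * S * (r \<bullet> a))" for a
    using arg_cong[OF He, of "\<lambda>w. w \<bullet> a"] by simp
  have W_tr: "(\<Sum>i\<in>Basis. W (\<sigma> i) \<bullet> \<sigma> i) = trace_form W - K\<^sup>2 * (W e \<bullet> e) / v\<^sup>2"
  proof -
    have "W p \<bullet> p = K\<^sup>2 * (W e \<bullet> e)"
      using linear_cmul[OF W, of K e] by (simp add: p_def power2_eq_square)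
    then show ?thesis using tr[OF W] by (simp add: mc_trace_def np v2)
  qed
  define n' where "n' = (\<Sum>i\<in>Basis. (norm (\<sigma> i))\<^sup>2)"
  have "(\<Sum>i\<in>Basis. K * (C1 * S * (r \<bullet> \<sigma> i)\<^sup>2 + S * (- m * (norm (\<sigma> i))\<^sup>2 + c * (H (\<sigma> i) \<bullet> \<sigma> i)))
        + 2 * (S * (r \<bullet> \<sigma> i)) * (H e \<bullet> \<sigma> i) + Z * (W (\<sigma> i) \<bullet> \<sigma> i)) \<le> 0"
  proof (rule sum_nonpos)
    fix i
    show "K * (C1 * S * (r \<bullet> \<sigma> i)\<^sup>2 + S * (- m * (norm (\<sigma> i))\<^sup>2 + c * (H (\<sigma> i) \<bullet> \<sigma> i)))
        + 2 * (S * (r \<bullet> \<sigma> i)) * (H e \<bullet> \<sigma> i) + Z * (W (\<sigma> i) \<bullet> \<sigma> i) \<le> 0"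
      using snd_order[of "\<sigma> i"] by (simp add: S_def power2_eq_square algebra_simps)
  qed
  also have "(\<Sum>i\<in>Basis. K * (C1 * S * (r \<bullet> \<sigma> i)\<^sup>2 + S * (- m * (norm (\<sigma> i))\<^sup>2 + c * (H (\<sigma> i) \<bullet> \<sigma> i)))
        + 2 * (S * (r \<bullet> \<sigma> i)) * (H e \<bullet> \<sigma> i) + Z * (W (\<sigma> i) \<bullet> \<sigma> i))
     = (\<Sum>i\<in>Basis. (K * C1 * S - 2 * S * (K * S) / Z) * (r \<bullet> \<sigma> i)\<^sup>2 + (- K * S * m) * (norm (\<sigma> i))\<^sup>2
        + (K * S * c) * (H (\<sigma> i) \<bullet> \<sigma> i) + Z * (W (\<sigma> i) \<bullet> \<sigma> i))"
  proof (intro sum.cong refl)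
    fix i
    have "H e \<bullet> \<sigma> i = - (K * S * (r \<bullet> \<sigma> i)) / Z" using He'[of "\<sigma> i"] Z(1) by (simp add: field_simps)
    then show "K * (C1 * S * (r \<bullet> \<sigma> i)\<^sup>2 + S * (- m * (norm (\<sigma> i))\<^sup>2 + c * (H (\<sigma> i) \<bullet> \<sigma> i)))
        + 2 * (S * (r \<bullet> \<sigma> i)) * (H e \<bullet> \<sigma> i) + Z * (W (\<sigma> i) \<bullet> \<sigma> i)
      = (K * C1 * S - 2 * S * (K * S) / Z) * (r \<bullet> \<sigma> i)\<^sup>2 + (- K * S * m) * (norm (\<sigma> i))\<^sup>2
        + (K * S * c) * (H (\<sigma> i) \<bullet> \<sigma> i) + Z * (W (\<sigma> i) \<bullet> \<sigma> i)"
      by (simp add: algebra_simps power2_eq_square)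
  qed
  also have "\<dots> = (K * C1 * S - 2 * S * (K * S) / Z) * N + (- K * S * m) * n' + (K * S * c) * (Q * v)
      + Z * (trace_form W - K\<^sup>2 * (W e \<bullet> e) / v\<^sup>2)"
    unfolding sum.distrib sum_distrib_left[symmetric] tr_r trH W_tr n'_def ..
  finally have 1: "(K * C1 * S - 2 * S * (K * S) / Z) * N + (- K * S * m) * n' + (K * S * c) * (Q * v)
      + Z * (trace_form W - K\<^sup>2 * (W e \<bullet> e) / v\<^sup>2) \<le> 0" .
  \<comment> \<open>The differentiated equation expresses the trace of \<open>W\<close> through
    lower order data and a quadratic term in \<open>H e\<close>; by the first order condition the
    latter is again a multiple of \<open>N\<close>.\<close>
  have ZW: "Z * (trace_form W - K\<^sup>2 * (W e \<bullet> e) / v\<^sup>2)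
      = Z * Q1 * v + Q * K * (Z * h) / v + 2 * K / v\<^sup>2 * ((K * S)\<^sup>2 * N / Z)"
  proof -
    have Heq: "H e = - ((K * S / Z) *\<^sub>R r)"
    proof -
      have "H e = (1 / Z) *\<^sub>R (Z *\<^sub>R H e)" using Z by simp
      then show ?thesis unfolding He by simp
    qed
    have nH: "(norm (H e))\<^sup>2 = (K * S / Z)\<^sup>2 * (norm r)\<^sup>2" unfolding Heq norm_minus_cancel norm_scaleR power_mult_distrib power2_abs ..
    have hh: "h = - (K * S / Z * (r \<bullet> e))" unfolding h_def Heq by simp
    have "trace_form W - K\<^sup>2 * (W e \<bullet> e) / v\<^sup>2 = Q1 * v + Q * (K * h / v) + (2 * K * (norm (H e))\<^sup>2 / v\<^sup>2 - 2 * K ^ 3 * h\<^sup>2 / (v\<^sup>2)\<^sup>2)"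
      using dpde unfolding p_def[symmetric] v_def[symmetric] v2[symmetric] h_def[symmetric] by simp
    also have "2 * K * (norm (H e))\<^sup>2 / v\<^sup>2 - 2 * K ^ 3 * h\<^sup>2 / (v\<^sup>2)\<^sup>2 = 2 * K / v\<^sup>2 * ((K * S / Z)\<^sup>2 * N)"
    proof -
      have "2 * K * (X * n) / V - 2 * K ^ 3 * (X * q) / V\<^sup>2 = 2 * K / V * (X * (n - K\<^sup>2 * q / V))" if "V > 0" for X n q V
        using that by (simp add: field_simps power2_eq_square power3_eq_cube)
      from this[of "v\<^sup>2" "(K * S / Z)\<^sup>2" "(norm r)\<^sup>2" "(r \<bullet> e)\<^sup>2"] show ?thesis
        unfolding nH hh N_def using v by (simp only: power2_minus power_mult_distrib) simp
    qed
    finally show ?thesis using Z by (simp add: field_simps power2_eq_square)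
  qed
  have Zh: "Z * h = - (K * S * (b \<bullet> e + c * K))" unfolding h_def He' by (simp add: r inner_add_left ee)
  \<comment> \<open>Two cancellations keep the error terms from growing with \<open>K\<close>: the
    cross term and the quadratic term of \<open>ZW\<close> leave the factor
    \<open>1 - K^2 / v^2 = 1 / v^2\<close>, and the two contributions of \<open>c Q\<close> leave
    \<open>v - K^2 / v = 1 / v\<close>.\<close>
  have key: "C1 * N - m * n' + Q * c / v - Q * K * (b \<bullet> e) / v - 2 * S * N / (Z * v\<^sup>2) + Z * Q1 * v / (K * S) \<le> 0"
  proof -
    have "(K * C1 * S - 2 * S * (K * S) / Z) * N + (- K * S * m) * n' + (K * S * c) * (Q * v)
      + (Z * Q1 * v + Q * K * (Z * h) / v + 2 * K / v\<^sup>2 * ((K * S)\<^sup>2 * N / Z))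
      = K * S * (C1 * N - m * n' + c * Q * (v - K\<^sup>2 / v) - Q * K * (b \<bullet> e) / v - 2 * S * N / Z * (1 - K\<^sup>2 / v\<^sup>2) + Z * Q1 * v / (K * S))"
      unfolding Zh using K S Z v by (simp add: field_simps power2_eq_square)
    moreover have "v - K\<^sup>2 / v = 1 / v" using v v2 by (simp add: field_simps power2_eq_square)
    moreover have "1 - K\<^sup>2 / v\<^sup>2 = 1 / v\<^sup>2"
    proof -
      have "1 - K\<^sup>2 / v\<^sup>2 = (v\<^sup>2 - K\<^sup>2) / v\<^sup>2" using v by (simp add: diff_divide_distrib)
      then show ?thesis by (simp add: v2)
    qed
    ultimately have "K * S * (C1 * N - m * n' + c * Q * (1 / v) - Q * K * (b \<bullet> e) / v - 2 * S * N / Z * (1 / v\<^sup>2) + Z * Q1 * v / (K * S)) \<le> 0"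
      using 1 unfolding ZW by simp
    moreover have "K * S > 0" using K S by simp
    ultimately have "C1 * N - m * n' + c * Q * (1 / v) - Q * K * (b \<bullet> e) / v - 2 * S * N / Z * (1 / v\<^sup>2) + Z * Q1 * v / (K * S) \<le> 0"
      by (meson mult_pos_pos not_le)
    then show ?thesis by (simp add: mult.commute)
  qed
  have be: "\<bar>b \<bullet> e\<bar> \<le> 2 / R" using Cauchy_Schwarz_ineq2[of b e] e b by simp
  \<comment> \<open>The hypothesis \<open>K \<ge> 4 / (R c)\<close> makes the part \<open>b\<close>
    coming from the paraboloid at most half of \<open>c K\<close>.\<close>
  have re: "r \<bullet> e \<ge> c * K / 2"
  proof -
    have "c * K \<ge> c * (4 / (R * c))" using Kbig(3) c by (intro mult_left_mono) auto
    then have "c * K / 2 \<ge> 2 / R" using c R by simp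
    moreover have "r \<bullet> e = b \<bullet> e + c * K" by (simp add: r inner_add_left ee)
    ultimately show ?thesis using abs_le_D2[OF be] by linarith
  qed
  have N: "N \<ge> c\<^sup>2 / 8"
  proof -
    have "(r \<bullet> e)\<^sup>2 \<le> (norm r)\<^sup>2" using norm_perp_decomp(1)[OF e, of r] by simp
    then have "N \<ge> (r \<bullet> e)\<^sup>2 - K\<^sup>2 * (r \<bullet> e)\<^sup>2 / v\<^sup>2" by (simp add: N_def)
    also have "(r \<bullet> e)\<^sup>2 - K\<^sup>2 * (r \<bullet> e)\<^sup>2 / v\<^sup>2 = (r \<bullet> e)\<^sup>2 * (v\<^sup>2 - K\<^sup>2) / v\<^sup>2" using v by (simp add: field_simps)
    also have "\<dots> = (r \<bullet> e)\<^sup>2 / v\<^sup>2" by (simp add: v2)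
    also have "\<dots> \<ge> (c * K / 2)\<^sup>2 / (2 * K\<^sup>2)"
    proof (intro frac_le power_mono re)
      show "v\<^sup>2 \<le> 2 * K\<^sup>2" using Kbig(1) by (simp add: v2)
    qed (use c K v in auto)
    also have "(c * K / 2)\<^sup>2 / (2 * K\<^sup>2) = c\<^sup>2 / 8" using K by (simp add: power_mult_distrib power_divide)
    finally show ?thesis by simp
  qed
  have N0: "N \<ge> 0" using N by (smt (verit) divide_nonneg_pos zero_le_power2)
  \<comment> \<open>\<open>K \<ge> 4 exp C1\<close> pays for the exponential factor
    \<open>Z + 1\<close>, while \<open>Z K \<ge> 1\<close> prevents \<open>Z\<close> in the
    denominator from being too small.\<close>
  have t1: "2 * S * N / (Z * v\<^sup>2) \<le> C1 * N / 2"
  proof -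
    have "4 * (Z + 1) \<le> 4 * exp C1" using Z(3) by simp
    also have "\<dots> \<le> K" by (rule Kbig(2))
    also have "\<dots> \<le> K * (Z * K)" using Z(2) K by simp
    also have "\<dots> = Z * K\<^sup>2" by (simp add: power2_eq_square)
    also have "\<dots> \<le> Z * v\<^sup>2" using Z(1) by (intro mult_left_mono) (auto simp: v2)
    finally have "4 * (Z + 1) \<le> Z * v\<^sup>2" .
    then have "(C1 * N) * (4 * (Z + 1)) \<le> (C1 * N) * (Z * v\<^sup>2)" using C1 N0 by (intro mult_left_mono) auto
    then show ?thesis using Z v by (simp add: S_def divide_le_eq algebra_simps)
  qed
  have t2: "\<bar>Q * c / v\<bar> \<le> L1 * c"
  proof -
    have "\<bar>Q * c / v\<bar> = \<bar>Q\<bar> * (c / v)" using c v by (simp add: abs_mult)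
    also have "\<dots> \<le> L1 * (c / 1)" using Q L1 c v Kbig(1) by (intro mult_mono divide_left_mono) auto
    finally show ?thesis by simp
  qed
  have t3: "\<bar>Q * K * (b \<bullet> e) / v\<bar> \<le> 2 * L1 / R"
  proof -
    have "\<bar>Q * K * (b \<bullet> e) / v\<bar> = (\<bar>Q\<bar> * \<bar>b \<bullet> e\<bar>) * (K / v)" using K v by (simp add: abs_mult)
    also have "\<dots> \<le> (L1 * (2 / R)) * 1" using Q be L1 K v R by (intro mult_mono) auto
    finally show ?thesis by (simp add: mult.commute)
  qed
  have t4: "Z * Q1 * v / (K * S) \<ge> - 2 * L1"
  proof -
    have f: "Z * v / (K * S) \<le> 2"
    proof -
      have "Z \<le> S" using C1 Z mult_mono[of 1 C1 Z "Z + 1"] by (simp add: S_def)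
      then have "Z * v \<le> S * (2 * K)" using v v2K Z S by (intro mult_mono) auto
      then show ?thesis using K S by (simp add: divide_le_eq mult_ac)
    qed
    have "Z * v / (K * S) \<ge> 0" using Z v K S by simp
    then have "(Z * v / (K * S)) * Q1 \<ge> (Z * v / (K * S)) * (- L1)" using Q1 by (intro mult_left_mono)
    moreover have "(Z * v / (K * S)) * L1 \<le> 2 * L1" using f L1 by (intro mult_right_mono)
    ultimately show ?thesis by (simp add: mult_ac)
  qed
  have t5: "m * n' \<le> m * DIM('a)" using tr_id m unfolding n'_def by (intro mult_left_mono)
  have "C1 * N / 2 \<ge> C1 * (c\<^sup>2 / 8) / 2" using N C1 by (intro divide_right_mono mult_left_mono) auto
  moreover have "C1 * (c\<^sup>2 / 8) / 2 = C1 * c\<^sup>2 / 16" by simp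
  ultimately show ?thesis
    using key t1 abs_le_D2[OF t2] abs_le_D1[OF t3] t4 t5 by linarith
qed

text \<open>The nondivergence expression is differentiated along a fixed direction at a point where
  the gradient is parallel to it, so the derivative of the coefficient matrix involves only
  \<open>HH x e\<close>. Third derivatives occur as Hessians \<open>KK b\<close> of the first
  partials; two commutations turn the derivative of the Laplacian into the trace of
  \<open>W\<close>, the Hessian of \<open>Du \<bullet> e\<close>.\<close>

lemma Ck3_line_derivative:
  fixes u :: "'a::euclidean_space \<Rightarrow> real"
  assumes u: "Ck (Suc (Suc (Suc k))) \<Omega> \<Omega> u" and op: "open \<Omega>" and x: "x \<in> \<Omega>"
    and p: "grad \<Omega> u x = K *\<^sub>R e"
  obtains gw W HH where
    "\<And>y. y \<in> \<Omega> \<Longrightarrow> (grad \<Omega> u has_derivative HH y) (at y)"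
    "twice_diff_at (\<lambda>y. grad \<Omega> u y \<bullet> e) gw W x" "gw x = HH x e"
    "((\<lambda>t. mc_trace (grad \<Omega> u (x + t *\<^sub>R e)) (HH (x + t *\<^sub>R e))) has_real_derivative
       (trace_form W - K\<^sup>2 * (W e \<bullet> e) / (1 + (norm (K *\<^sub>R e))\<^sup>2) - 2 * K * (norm (HH x e))\<^sup>2 / (1 + (norm (K *\<^sub>R e))\<^sup>2)
        + 2 * K ^ 3 * (HH x e \<bullet> e)\<^sup>2 / (1 + (norm (K *\<^sub>R e))\<^sup>2)\<^sup>2)) (at 0)"
proof -
  define g where "g = grad \<Omega> u"
  define h where "h b = grad \<Omega> (dir_deriv \<Omega> b u)" for b
  define HH where "HH y v = (\<Sum>b\<in>Basis. (h b y \<bullet> v) *\<^sub>R b)" for y v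
  have HH: "(g has_derivative HH y) (at y)" if "y \<in> \<Omega>" for y
    unfolding g_def HH_def[abs_def] h_def using Ck_grad_has_derivative[OF u that] .
  have HHb: "HH y v \<bullet> b = h b y \<bullet> v" if "b \<in> Basis" for y v b
    unfolding HH_def using that by (simp add: inner_sum_left inner_Basis if_distrib cong: if_cong)
  have sym: "HH y v \<bullet> w = HH y w \<bullet> v" if y: "y \<in> \<Omega>" for y v w
  proof -
    obtain d where "d > 0" "ball y d \<subseteq> \<Omega>" using op y open_contains_ball by blast
    then have "twice_diff_at u g (HH y) y" unfolding twice_diff_at_def g_def[symmetric]
      using HH[OF y] has_derivative_grad[OF Ck_Suc_differentiable[OF u], of _ ] unfolding g_def by blast
    then show ?thesis by (rule twice_diff_at_symmetric)
  qed
  have "\<exists>Kb. twice_diff_at (dir_deriv \<Omega> b u) (h b) Kb x" if "b \<in> Basis" for b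
    using Ck_twice_diff_at[OF Ck_dir_deriv[OF u that] op x] unfolding h_def by metis
  then obtain KK where KK: "\<And>b. b \<in> Basis \<Longrightarrow> twice_diff_at (dir_deriv \<Omega> b u) (h b) (KK b) x" by metis
  have KD: "(h b has_derivative KK b) (at x)" if "b \<in> Basis" for b using KK[OF that] by (simp add: twice_diff_at_def)
  have Ksym: "KK b v \<bullet> w = KK b w \<bullet> v" if "b \<in> Basis" for b v w
    by (rule twice_diff_at_symmetric[OF KK[OF that]])
  have hbc: "h b y \<bullet> c = h c y \<bullet> b" if "b \<in> Basis" "c \<in> Basis" "y \<in> \<Omega>" for b c y
    using sym[OF that(3), of c b] HHb[OF that(1), of y c] HHb[OF that(2), of y b] by simp
  \<comment> \<open>The symmetry \<open>hbc\<close> of the second partials holds in all of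
    \<open>\<Omega>\<close>, so both sides may be differentiated at \<open>x\<close>.\<close>
  have Kbc: "KK b v \<bullet> c = KK c v \<bullet> b" if b: "b \<in> Basis" and c: "c \<in> Basis" for b c v
  proof -
    have 1: "((\<lambda>y. h b y \<bullet> c) has_derivative (\<lambda>v. KK b v \<bullet> c)) (at x)"
      by (rule has_derivative_inner_left[OF KD[OF b]])
    have 2: "((\<lambda>y. h c y \<bullet> b) has_derivative (\<lambda>v. KK c v \<bullet> b)) (at x)"
      by (rule has_derivative_inner_left[OF KD[OF c]])
    have "((\<lambda>y. h b y \<bullet> c) has_derivative (\<lambda>v. KK c v \<bullet> b)) (at x)"
      by (rule has_derivative_transform_within_open[OF 2 op x]) (simp add: hbc b c)
    from has_derivative_unique[OF 1 this] show ?thesis by metis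
  qed
  define gw where "gw y = (\<Sum>b\<in>Basis. (e \<bullet> b) *\<^sub>R h b y)" for y
  define W where "W v = (\<Sum>b\<in>Basis. (e \<bullet> b) *\<^sub>R KK b v)" for v
  have w_eq: "(\<lambda>y. g y \<bullet> e) = (\<lambda>y. \<Sum>b\<in>Basis. (e \<bullet> b) * dir_deriv \<Omega> b u y)"
    by (simp add: g_def grad_def inner_sum_left inner_sum_right inner_commute mult.commute fun_eq_iff)
  have w: "twice_diff_at (\<lambda>y. g y \<bullet> e) gw W x"
  proof -
    obtain d where d: "d > 0" "ball x d \<subseteq> \<Omega>" using op x open_contains_ball by blast
    have "((\<lambda>y. g y \<bullet> e) has_derivative (\<lambda>v. gw y \<bullet> v)) (at y)" if "y \<in> ball x d" for y
    proof -
      have y: "y \<in> \<Omega>" using that d by auto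
      have "((\<lambda>y. \<Sum>b\<in>Basis. (e \<bullet> b) * dir_deriv \<Omega> b u y) has_derivative (\<lambda>v. \<Sum>b\<in>Basis. (e \<bullet> b) * (h b y \<bullet> v))) (at y)"
        unfolding h_def
        by (intro has_derivative_sum has_derivative_mult_right has_derivative_grad
            Ck_Suc_differentiable[OF Ck_dir_deriv[OF u]] y)
      then show ?thesis unfolding w_eq gw_def by (simp add: inner_sum_left)
    qed
    moreover have "(gw has_derivative W) (at x)" unfolding gw_def[abs_def] W_def[abs_def]
      by (intro has_derivative_sum has_derivative_scaleR_right KD)
    ultimately show ?thesis unfolding twice_diff_at_def using d(1) by blast
  qed
  have gwx: "gw x = HH x e"
  proof (rule euclidean_eqI)
    fix c :: 'a assume c: "c \<in> Basis"
    have "gw x \<bullet> c = (\<Sum>b\<in>Basis. (e \<bullet> b) * (h c x \<bullet> b))"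
      unfolding gw_def inner_sum_left using hbc[OF _ c x] by (intro sum.cong refl) simp
    also have "\<dots> = h c x \<bullet> e" by (subst sum_Basis_inner_mult) (rule inner_commute)
    finally show "gw x \<bullet> c = HH x e \<bullet> c" using HHb[OF c] by simp
  qed
  have We: "(\<Sum>b\<in>Basis. KK b e \<bullet> b) = trace_form W"
  proof -
    have "KK b e \<bullet> b = (\<Sum>c\<in>Basis. (e \<bullet> c) * (KK c b \<bullet> b))" if b: "b \<in> Basis" for b
    proof -
      have "KK b e \<bullet> b = KK b b \<bullet> e" by (rule Ksym[OF b])
      also have "\<dots> = (\<Sum>c\<in>Basis. (e \<bullet> c) * (KK b b \<bullet> c))" by (subst sum_Basis_inner_mult) (rule inner_commute)
      also have "\<dots> = (\<Sum>c\<in>Basis. (e \<bullet> c) * (KK c b \<bullet> b))" using Kbc[OF b] by (intro sum.cong refl) simp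
      finally show ?thesis .
    qed
    then show ?thesis unfolding trace_form_def W_def inner_sum_left by simp
  qed
  define x' where "x' t = x + t *\<^sub>R e" for t
  have gx: "g x = K *\<^sub>R e" using p by (simp add: g_def)
  have line: "((\<lambda>t. F (x' t)) has_derivative (\<lambda>s. s *\<^sub>R F' e)) (at 0)"
    if F: "(F has_derivative F') (at x)" for F :: "'a \<Rightarrow> 'b::real_normed_vector" and F'
  proof -
    have 1: "(x' has_derivative (\<lambda>s. s *\<^sub>R e)) (at 0)" unfolding x'_def[abs_def] by (auto intro!: derivative_eq_intros)
    have "((\<lambda>t. F (x' t)) has_derivative (\<lambda>s. F' (s *\<^sub>R e))) (at 0)"
      using has_derivative_compose[OF 1, of F F'] F by (simp add: x'_def)
    then show ?thesis using has_derivative_linear[OF F] by (simp add: linear_cmul)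
  qed
  have lineD: "((\<lambda>t. F (x' t)) has_real_derivative F' e) (at 0)"
    if F: "(F has_derivative F') (at x)" for F :: "'a \<Rightarrow> real" and F'
  proof -
    have "(\<lambda>s. s *\<^sub>R F' e) = (*) (F' e)" by (simp add: fun_eq_iff mult.commute)
    then show ?thesis using line[OF F] by (simp only: has_field_derivative_def)
  qed
  have hD: "((\<lambda>t. h b (x' t) \<bullet> b) has_real_derivative KK b e \<bullet> b) (at 0)" if "b \<in> Basis" for b
    using lineD[OF has_derivative_inner_left[OF KD[OF that]]] .
  have hgD: "((\<lambda>t. h b (x' t) \<bullet> g (x' t)) has_real_derivative h b x \<bullet> HH x e + KK b e \<bullet> g x) (at 0)" if "b \<in> Basis" for b
    using lineD[OF has_derivative_inner[OF KD[OF that] HH[OF x]]] .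
  have gD: "((\<lambda>t. g (x' t) \<bullet> c) has_real_derivative HH x e \<bullet> c) (at 0)" for c
    using lineD[OF has_derivative_inner_left[OF HH[OF x]]] .
  have ggD: "((\<lambda>t. 1 + (norm (g (x' t)))\<^sup>2) has_real_derivative 2 * (HH x e \<bullet> g x)) (at 0)"
  proof -
    have "((\<lambda>y. 1 + g y \<bullet> g y) has_derivative (\<lambda>v. 2 * (HH x v \<bullet> g x))) (at x)"
      by (auto intro!: derivative_eq_intros HH[OF x] simp: inner_commute)
    from lineD[OF this] show ?thesis by (simp add: power2_norm_eq_inner)
  qed
  define V where "V = 1 + (norm (g x))\<^sup>2"
  have V: "V > 0" by (simp add: V_def add_pos_nonneg)
  define q where "q = HH x e"
  have mc: "mc_trace (g y) (HH y) = (\<Sum>b\<in>Basis. h b y \<bullet> b) - (\<Sum>b\<in>Basis. (h b y \<bullet> g y) * (g y \<bullet> b)) / (1 + (norm (g y))\<^sup>2)" for y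
  proof -
    have "trace_form (HH y) = (\<Sum>b\<in>Basis. h b y \<bullet> b)" unfolding trace_form_def using HHb by simp
    moreover have "HH y (g y) \<bullet> g y = (\<Sum>b\<in>Basis. (h b y \<bullet> g y) * (g y \<bullet> b))"
      unfolding HH_def inner_sum_left by (intro sum.cong refl) (simp add: inner_commute mult_ac)
    ultimately show ?thesis by (simp add: mc_trace_def)
  qed
  have "((\<lambda>t. mc_trace (g (x' t)) (HH (x' t))) has_real_derivative
     ((\<Sum>b\<in>Basis. KK b e \<bullet> b) - ((\<Sum>b\<in>Basis. (h b x \<bullet> q + KK b e \<bullet> g x) * (g x \<bullet> b) + (q \<bullet> b) * (h b x \<bullet> g x)) * V
        - (\<Sum>b\<in>Basis. (h b x \<bullet> g x) * (g x \<bullet> b)) * (2 * (q \<bullet> g x))) / (V * V))) (at 0)"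
  proof -
    have x0: "x' 0 = x" by (simp add: x'_def)
    have "((\<lambda>t. \<Sum>b\<in>Basis. (h b (x' t) \<bullet> g (x' t)) * (g (x' t) \<bullet> b)) has_real_derivative
        (\<Sum>b\<in>Basis. (h b x \<bullet> q + KK b e \<bullet> g x) * (g x \<bullet> b) + (q \<bullet> b) * (h b x \<bullet> g x))) (at 0)"
      using DERIV_mult[OF hgD gD] by (intro DERIV_sum) (simp add: x0 q_def)
    from DERIV_divide[OF this ggD] V
    have "((\<lambda>t. (\<Sum>b\<in>Basis. (h b (x' t) \<bullet> g (x' t)) * (g (x' t) \<bullet> b)) / (1 + (norm (g (x' t)))\<^sup>2)) has_real_derivative
        (((\<Sum>b\<in>Basis. (h b x \<bullet> q + KK b e \<bullet> g x) * (g x \<bullet> b) + (q \<bullet> b) * (h b x \<bullet> g x)) * V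
        - (\<Sum>b\<in>Basis. (h b x \<bullet> g x) * (g x \<bullet> b)) * (2 * (q \<bullet> g x))) / (V * V))) (at 0)"
      by (simp add: x0 V_def q_def)
    moreover have "((\<lambda>t. \<Sum>b\<in>Basis. h b (x' t) \<bullet> b) has_real_derivative (\<Sum>b\<in>Basis. KK b e \<bullet> b)) (at 0)"
      by (intro DERIV_sum hD)
    ultimately show ?thesis unfolding mc by (intro DERIV_diff)
  qed
  moreover have "(\<Sum>b\<in>Basis. KK b e \<bullet> b) - ((\<Sum>b\<in>Basis. (h b x \<bullet> q + KK b e \<bullet> g x) * (g x \<bullet> b) + (q \<bullet> b) * (h b x \<bullet> g x)) * V
        - (\<Sum>b\<in>Basis. (h b x \<bullet> g x) * (g x \<bullet> b)) * (2 * (q \<bullet> g x))) / (V * V)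
     = trace_form W - K\<^sup>2 * (W e \<bullet> e) / V - 2 * K * (norm q)\<^sup>2 / V + 2 * K ^ 3 * (q \<bullet> e)\<^sup>2 / V\<^sup>2"
  proof -
    have s1: "(\<Sum>b\<in>Basis. (h b x \<bullet> q) * (g x \<bullet> b)) = HH x q \<bullet> g x" unfolding HH_def inner_sum_left by (intro sum.cong refl) (simp add: inner_commute mult_ac)
    have s2: "(\<Sum>b\<in>Basis. (q \<bullet> b) * (h b x \<bullet> g x)) = HH x (g x) \<bullet> q" unfolding HH_def inner_sum_left by (intro sum.cong refl) (simp add: inner_commute mult_ac)
    have s3: "(\<Sum>b\<in>Basis. (h b x \<bullet> g x) * (g x \<bullet> b)) = HH x (g x) \<bullet> g x" unfolding HH_def inner_sum_left by (intro sum.cong refl) (simp add: inner_commute mult_ac)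
    have s4: "(\<Sum>b\<in>Basis. (KK b e \<bullet> g x) * (g x \<bullet> b)) = K\<^sup>2 * (W e \<bullet> e)"
      unfolding gx W_def inner_sum_left sum_distrib_left
      by (intro sum.cong refl) (simp add: power2_eq_square)
    have lin: "linear (HH x)" using has_derivative_linear[OF HH[OF x]] .
    have Hg: "HH x (g x) = K *\<^sub>R q" unfolding gx q_def using lin by (simp add: linear_cmul)
    have "(\<Sum>b\<in>Basis. (h b x \<bullet> q + KK b e \<bullet> g x) * (g x \<bullet> b) + (q \<bullet> b) * (h b x \<bullet> g x))
       = (\<Sum>b\<in>Basis. (h b x \<bullet> q) * (g x \<bullet> b)) + (\<Sum>b\<in>Basis. (KK b e \<bullet> g x) * (g x \<bullet> b)) + (\<Sum>b\<in>Basis. (q \<bullet> b) * (h b x \<bullet> g x))"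
      by (simp add: sum.distrib algebra_simps)
    also have "\<dots> = 2 * K * (norm q)\<^sup>2 + K\<^sup>2 * (W e \<bullet> e)"
      unfolding s1 s2 s4 sym[OF x, of q "g x"] Hg by (simp add: dot_square_norm)
    finally have S: "(\<Sum>b\<in>Basis. (h b x \<bullet> q + KK b e \<bullet> g x) * (g x \<bullet> b) + (q \<bullet> b) * (h b x \<bullet> g x)) = 2 * K * (norm q)\<^sup>2 + K\<^sup>2 * (W e \<bullet> e)" .
    have T: "(\<Sum>b\<in>Basis. (h b x \<bullet> g x) * (g x \<bullet> b)) * (2 * (q \<bullet> g x)) = 2 * K ^ 3 * (q \<bullet> e)\<^sup>2"
      unfolding s3 Hg unfolding gx by (simp add: power2_eq_square power3_eq_cube)
    show ?thesis unfolding S T We using V by (simp add: field_simps power2_eq_square)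
  qed
  ultimately have D: "((\<lambda>t. mc_trace (g (x + t *\<^sub>R e)) (HH (x + t *\<^sub>R e))) has_real_derivative
      (trace_form W - K\<^sup>2 * (W e \<bullet> e) / V - 2 * K * (norm q)\<^sup>2 / V + 2 * K ^ 3 * (q \<bullet> e)\<^sup>2 / V\<^sup>2)) (at 0)"
    by (simp add: x'_def)
  show thesis
    by (rule that[of HH gw W]) (use HH w gwx D in \<open>simp_all add: g_def V_def q_def p\<close>)
qed

text \<open>The exponent \<open>\<phi>\<close> combines a paraboloid of radius
  \<open>\<delta>\<close> with \<open>c (u - M0)\<close>. For \<open>c = 1 / (4 M0)\<close> the
  latter lies between -1/2 and 0, so \<open>\<phi>\<close> is at least 1/2 at the centre, while
  \<open>\<phi> > 0\<close> forces distance below \<open>\<delta>\<close>; a positive maximum is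
  thus interior. \<open>C1\<close> is chosen to violate the conclusion of
  \<open>bernstein_algebra\<close>, \<open>K1\<close> to meet its size conditions.\<close>

lemma interior_gradient_bound:
  fixes \<delta> M0 L1 :: real
  assumes \<delta>: "\<delta> > 0" and M0: "M0 > 0" and L1: "L1 > 0"
  obtains M1 where "M1 > 0"
    "\<And>(\<Omega> :: 'a::euclidean_space set) f u x0. \<lbrakk>open \<Omega>; rhs_conditions \<Omega> M0 L1 f; Ck 3 \<Omega> \<Omega> u;
       \<And>x. x \<in> \<Omega> \<Longrightarrow> \<bar>u x\<bar> \<le> M0; \<And>x. x \<in> \<Omega> \<Longrightarrow> mean_curvature_op \<Omega> u x = f (x, u x);
       cball x0 \<delta> \<subseteq> \<Omega>\<rbrakk> \<Longrightarrow> norm (grad \<Omega> u x0) \<le> M1"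
proof -
  define c where "c = 1 / (4 * M0)"
  define m where "m = 2 / \<delta>\<^sup>2"
  define B where "B = m * DIM('a) + L1 * c + 2 * L1 / \<delta> + 2 * L1"
  define C1 where "C1 = 1 + 16 / c\<^sup>2 * B"
  define K1 where "K1 = 1 + 4 * exp C1 + 4 / (\<delta> * c)"
  have c: "c > 0" using M0 by (simp add: c_def)
  have m: "m > 0" using \<delta> by (simp add: m_def)
  have B: "B > 0" unfolding B_def using m L1 c \<delta> by (intro add_pos_pos add_nonneg_pos) auto
  have C1: "C1 \<ge> 1" using B c by (simp add: C1_def)
  have C1B: "C1 * c\<^sup>2 / 16 > B"
  proof -
    have "C1 * c\<^sup>2 / 16 = c\<^sup>2 / 16 + B" using c by (simp add: C1_def field_simps)
    then show ?thesis using c by simp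
  qed
  have q: "4 / (\<delta> * c) > 0" using \<delta> c by simp
  have K1: "K1 \<ge> 1" "K1 \<ge> 4 * exp C1" "K1 \<ge> 4 / (\<delta> * c)"
    unfolding K1_def using q exp_gt_zero[of C1] by linarith+
  have E: "exp (C1 / 2) - 1 > 0" using C1 by simp
  show thesis
  \<comment> \<open>The denominator bounds \<open>\<zeta>\<close> at the centre from below. In the
    numerator, \<open>exp C1\<close> bounds \<open>\<zeta>\<close>, so a larger product forces
    \<open>|Du| \<ge> K1\<close>; the added 1 secures \<open>Z K \<ge> 1\<close>.\<close>
  proof (rule that[of "(exp C1 * K1 + 1) / (exp (C1 / 2) - 1)"])
    show "(exp C1 * K1 + 1) / (exp (C1 / 2) - 1) > 0"
      using E K1 by (intro divide_pos_pos add_nonneg_pos) auto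
    fix \<Omega> :: "'a set" and f u x0
    assume op: "open \<Omega>" and f: "rhs_conditions \<Omega> M0 L1 f" and u3: "Ck 3 \<Omega> \<Omega> u"
      and uM: "\<And>x. x \<in> \<Omega> \<Longrightarrow> \<bar>u x\<bar> \<le> M0" and pde: "\<And>x. x \<in> \<Omega> \<Longrightarrow> mean_curvature_op \<Omega> u x = f (x, u x)"
      and cb: "cball x0 \<delta> \<subseteq> \<Omega>"
    have u: "Ck (Suc (Suc (Suc 0))) \<Omega> \<Omega> u" using u3 by (simp only: numeral_3_eq_3)
    have f1: "Ck 1 (open_cyl \<Omega> M0) (closed_cyl \<Omega> M0) f"
      and fz: "\<And>p. p \<in> closed_cyl \<Omega> M0 \<Longrightarrow> 0 \<le> deriv_z (open_cyl \<Omega> M0) f p"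
      and fb: "\<And>p. p \<in> closed_cyl \<Omega> M0 \<Longrightarrow> \<bar>f p\<bar> + norm (grad_x (open_cyl \<Omega> M0) f p) \<le> L1"
      using f by (auto simp only: rhs_conditions_def)
    have fb': "\<bar>f p\<bar> \<le> L1" "norm (grad_x (open_cyl \<Omega> M0) f p) \<le> L1" if "p \<in> closed_cyl \<Omega> M0" for p
      using fb[OF that] norm_ge_zero[of "grad_x (open_cyl \<Omega> M0) f p"] abs_ge_zero[of "f p"] by linarith+
    define g where "g = grad \<Omega> u"
    define \<phi> where "\<phi> y = 1 - (norm (y - x0))\<^sup>2 / \<delta>\<^sup>2 + c * (u y - M0)" for y
    define \<zeta> where "\<zeta> y = exp (C1 * \<phi> y) - 1" for y
    have cu: "continuous_on \<Omega> u" using u by (rule Ck_continuous_on)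
    have cg: "continuous_on \<Omega> g" unfolding g_def by (rule Ck_grad_continuous_on[OF u])
    have c\<phi>: "continuous_on \<Omega> \<phi>" unfolding \<phi>_def by (intro continuous_intros cu) (use \<delta> in auto)
    have c\<zeta>: "continuous_on \<Omega> \<zeta>" unfolding \<zeta>_def by (intro continuous_intros c\<phi>)
    have cM: "c * (u y - M0) \<le> 0" "c * (u y - M0) \<ge> - 1 / 2" if "y \<in> \<Omega>" for y
    proof -
      have "u y - M0 \<le> 0" "u y - M0 \<ge> - (2 * M0)" using uM[OF that] by auto
      then have "c * (u y - M0) \<le> c * 0" "c * (u y - M0) \<ge> c * (- (2 * M0))"
        using c by (intro mult_left_mono; simp)+
      then show "c * (u y - M0) \<le> 0" "c * (u y - M0) \<ge> - 1 / 2" using M0 by (auto simp: c_def)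
    qed
    have \<phi>1: "\<phi> y \<le> 1" if "y \<in> \<Omega>" for y
    proof -
      have "(norm (y - x0))\<^sup>2 / \<delta>\<^sup>2 \<ge> 0" by simp
      then show ?thesis using cM(1)[OF that] unfolding \<phi>_def by linarith
    qed
    have \<zeta>1: "\<zeta> y + 1 \<le> exp C1" if "y \<in> \<Omega>" for y
      using \<phi>1[OF that] C1 by (simp add: \<zeta>_def)
    have x0: "x0 \<in> \<Omega>" using cb \<delta> by auto
    have \<phi>0: "\<phi> x0 \<ge> 1 / 2" using cM(2)[OF x0] by (simp add: \<phi>_def)
    define S where "S = {y \<in> cball x0 \<delta>. 0 \<le> \<phi> y}"
    have S\<Omega>: "S \<subseteq> \<Omega>" using cb by (auto simp: S_def)
    have "closed S" unfolding S_def
      using continuous_closed_preimage[OF continuous_on_subset[OF c\<phi> cb] closed_cball, of "{0..}"]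
      by (simp add: vimage_def Int_def)
    moreover have "bounded S" unfolding S_def by (rule bounded_subset[OF bounded_cball]) auto
    ultimately have cS: "compact S" by (simp add: compact_eq_bounded_closed)
    have x0S: "x0 \<in> S" using \<phi>0 \<delta> by (simp add: S_def)
    have "continuous_on S (\<lambda>y. \<zeta> y * norm (g y))"
      by (intro continuous_intros continuous_on_subset[OF c\<zeta> S\<Omega>] continuous_on_subset[OF cg S\<Omega>])
    then obtain x where x: "x \<in> S" "\<And>y. y \<in> S \<Longrightarrow> \<zeta> y * norm (g y) \<le> \<zeta> x * norm (g x)"
      using continuous_attains_sup[OF cS] x0S by blast
    have x\<Omega>: "x \<in> \<Omega>" using x S\<Omega> by auto
    have bound: "\<zeta> x * norm (g x) \<le> exp C1 * K1 + 1"
    proof (rule ccontr)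
      assume big: "\<not> \<zeta> x * norm (g x) \<le> exp C1 * K1 + 1"
      define K where "K = norm (g x)"
      define Z where "Z = \<zeta> x"
      define e where "e = sgn (g x)"
      have eK: "exp C1 * K1 \<ge> 0" using K1 by simp
      have ZK: "Z * K > exp C1 * K1" "Z * K \<ge> 1" using big eK unfolding Z_def K_def by linarith+
      have K0: "K \<ge> 0" by (simp add: K_def)
      have "0 < Z * K" using ZK(2) by linarith
      then have Zp: "Z > 0" "K > 0" using K0 by (auto simp: zero_less_mult_iff)
      have KK1: "K \<ge> K1"
      proof -
        have "Z * K \<le> exp C1 * K" using \<zeta>1[OF x\<Omega>] K0 by (intro mult_right_mono) (auto simp: Z_def)
        then have "exp C1 * K1 \<le> exp C1 * K" using ZK(1) by linarith
        then show ?thesis by simp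
      qed
      have e: "norm e = 1" "g x = K *\<^sub>R e" using Zp(2) by (auto simp: e_def K_def norm_sgn sgn_div_norm)
      have wx: "g x \<bullet> e = K" by (subst e(2)) (use e(1) in \<open>simp add: dot_square_norm\<close>)
      have \<phi>p: "\<phi> x > 0"
      proof -
        have "exp 0 < exp (C1 * \<phi> x)" using Zp(1) by (simp add: Z_def \<zeta>_def)
        then have "0 < C1 * \<phi> x" by (simp only: exp_less_cancel_iff)
        then show ?thesis using C1 by (simp add: zero_less_mult_iff)
      qed
      have xball: "norm (x - x0) < \<delta>"
      proof -
        have "(norm (x - x0))\<^sup>2 / \<delta>\<^sup>2 < 1" using \<phi>p cM(1)[OF x\<Omega>] unfolding \<phi>_def by linarith
        then have "(norm (x - x0))\<^sup>2 < \<delta>\<^sup>2" using \<delta> by (simp add: divide_less_eq)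
        then show ?thesis using \<delta> by (simp add: power2_less_imp_less)
      qed
      obtain gw W HH where HH: "\<And>y. y \<in> \<Omega> \<Longrightarrow> (grad \<Omega> u has_derivative HH y) (at y)"
        and w: "twice_diff_at (\<lambda>y. grad \<Omega> u y \<bullet> e) gw W x" and gwx: "gw x = HH x e"
        and D: "((\<lambda>t. mc_trace (grad \<Omega> u (x + t *\<^sub>R e)) (HH (x + t *\<^sub>R e))) has_real_derivative
       (trace_form W - K\<^sup>2 * (W e \<bullet> e) / (1 + (norm (K *\<^sub>R e))\<^sup>2) - 2 * K * (norm (HH x e))\<^sup>2 / (1 + (norm (K *\<^sub>R e))\<^sup>2)
        + 2 * K ^ 3 * (HH x e \<bullet> e)\<^sup>2 / (1 + (norm (K *\<^sub>R e))\<^sup>2)\<^sup>2)) (at 0)"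
        by (rule Ck3_line_derivative[OF u op x\<Omega> e(2)[unfolded g_def]]) (rule that, assumption+)
      have H: "(g has_derivative HH x) (at x)" using HH[OF x\<Omega>] by (simp add: g_def)
      have linH: "linear (HH x)" using has_derivative_linear[OF H] .
      have linW: "linear W" using w has_derivative_linear by (auto simp: twice_diff_at_def)
      have uD: "(u has_derivative (\<lambda>v. g y \<bullet> v)) (at y)" if "y \<in> \<Omega>" for y
        unfolding g_def by (rule has_derivative_grad[OF Ck_Suc_differentiable[OF u that] that])
      define g\<phi> where "g\<phi> y = (- m) *\<^sub>R (y - x0) + c *\<^sub>R g y" for y
      define r where "r = g\<phi> x"
      define b where "b = (- m) *\<^sub>R (x - x0)"
      have \<phi>D: "(\<phi> has_derivative (\<lambda>v. g\<phi> y \<bullet> v)) (at y)" if "y \<in> \<Omega>" for y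
      proof -
        have "\<phi> = (\<lambda>y. 1 - 1 / \<delta>\<^sup>2 * (norm (y - x0))\<^sup>2 + c * (u y - M0))" by (simp add: fun_eq_iff \<phi>_def)
        moreover have "((\<lambda>y. 1 - 1 / \<delta>\<^sup>2 * (norm (y - x0))\<^sup>2 + c * (u y - M0)) has_derivative
            (\<lambda>v. 0 - 1 / \<delta>\<^sup>2 * ((2 *\<^sub>R (y - x0)) \<bullet> v) + c * (g y \<bullet> v - 0))) (at y)"
          by (intro has_derivative_add has_derivative_diff has_derivative_const has_derivative_mult_right
              C2_withD[OF C2_with_normsq] uD[OF that])
        moreover have "(\<lambda>v. 0 - 1 / \<delta>\<^sup>2 * ((2 *\<^sub>R (y - x0)) \<bullet> v) + c * (g y \<bullet> v - 0)) = (\<lambda>v. g\<phi> y \<bullet> v)"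
          unfolding g\<phi>_def m_def inner_add_left inner_scaleR_left by (simp add: fun_eq_iff)
        ultimately show ?thesis by (simp only:)
      qed
      have g\<phi>D: "(g\<phi> has_derivative (\<lambda>v. (- m) *\<^sub>R v + c *\<^sub>R HH x v)) (at x)"
        unfolding g\<phi>_def[abs_def] by (auto intro!: derivative_eq_intros H)
      define g\<zeta> where "g\<zeta> y = (C1 * exp (C1 * \<phi> y)) *\<^sub>R g\<phi> y" for y
      define H\<zeta> where "H\<zeta> v = (C1 * exp (C1 * \<phi> x)) *\<^sub>R ((- m) *\<^sub>R v + c *\<^sub>R HH x v) + (C1\<^sup>2 * exp (C1 * \<phi> x) * (r \<bullet> v)) *\<^sub>R r" for v
      obtain d0 where d0: "d0 > 0" "ball x d0 \<subseteq> \<Omega>" using op x\<Omega> open_contains_ball by blast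
      have \<zeta>2: "twice_diff_at \<zeta> g\<zeta> H\<zeta> x"
      proof -
        have "(\<zeta> has_derivative (\<lambda>v. g\<zeta> y \<bullet> v)) (at y)" if "y \<in> ball x d0" for y
        proof -
          have y: "y \<in> \<Omega>" using that d0 by auto
          show ?thesis unfolding \<zeta>_def[abs_def] g\<zeta>_def
            by (auto intro!: derivative_eq_intros \<phi>D[OF y] simp: mult_ac)
        qed
        moreover have "(g\<zeta> has_derivative H\<zeta>) (at x)"
        proof -
          have "((\<lambda>y. C1 * exp (C1 * \<phi> y)) has_derivative (\<lambda>v. C1\<^sup>2 * exp (C1 * \<phi> x) * (r \<bullet> v))) (at x)"
            by (auto intro!: derivative_eq_intros \<phi>D[OF x\<Omega>] simp: r_def power2_eq_square mult_ac)
          from has_derivative_scaleR[OF this g\<phi>D] show ?thesis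
            unfolding g\<zeta>_def[abs_def] H\<zeta>_def[abs_def] r_def .
        qed
        ultimately show ?thesis unfolding twice_diff_at_def using d0(1) by blast
      qed
      \<comment> \<open>The norm of the gradient is replaced by its component along the fixed
        direction \<open>e\<close>: this is nowhere larger and agrees at \<open>x\<close>, so the
        maximum persists, and it is twice differentiable as a combination of first partials.\<close>
      have mx: "\<exists>d>0. \<forall>y\<in>ball x d. \<zeta> y * (grad \<Omega> u y \<bullet> e) \<le> \<zeta> x * (grad \<Omega> u x \<bullet> e)"
      proof -
        have "open {y \<in> \<Omega>. \<phi> y > 0}"
          using continuous_open_preimage[OF c\<phi> op, of "{0<..}"] by (simp add: vimage_def Int_def)
        then have "open ({y \<in> \<Omega>. \<phi> y > 0} \<inter> ball x0 \<delta>)" by (intro open_Int) auto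
        moreover have "x \<in> {y \<in> \<Omega>. \<phi> y > 0} \<inter> ball x0 \<delta>" using x\<Omega> \<phi>p xball by (simp add: dist_norm norm_minus_commute)
        ultimately obtain d where d: "d > 0" "ball x d \<subseteq> {y \<in> \<Omega>. \<phi> y > 0} \<inter> ball x0 \<delta>"
          using open_contains_ball_eq by blast
        have "\<zeta> y * (g y \<bullet> e) \<le> \<zeta> x * (g x \<bullet> e)" if "y \<in> ball x d" for y
        proof -
          have y: "y \<in> S" "\<phi> y > 0" using d that by (auto simp: S_def)
          have "g y \<bullet> e \<le> norm (g y)" using norm_cauchy_schwarz[of "g y" e] e(1) by simp
          moreover have "\<zeta> y \<ge> 0" using y(2) C1 by (simp add: \<zeta>_def)
          ultimately have "\<zeta> y * (g y \<bullet> e) \<le> \<zeta> y * norm (g y)" by (intro mult_left_mono)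
          also have "\<dots> \<le> \<zeta> x * norm (g x)" by (rule x(2)[OF y(1)])
          also have "norm (g x) = g x \<bullet> e" unfolding wx K_def ..
          finally show ?thesis .
        qed
        then show ?thesis using d(1) by (auto simp: g_def)
      qed
      note ord = product_second_order[OF \<zeta>2 w mx, folded g_def]
      have ex: "exp (C1 * \<phi> x) = Z + 1" by (simp add: Z_def \<zeta>_def)
      have fst_order: "(K * (C1 * (Z + 1))) *\<^sub>R r + Z *\<^sub>R HH x e = 0"
        using ord(1) unfolding wx gwx g\<zeta>_def ex r_def[symmetric] Z_def[symmetric] by simp
      have snd_order: "K * (C1\<^sup>2 * (Z + 1) * (r \<bullet> \<sigma>)\<^sup>2 + C1 * (Z + 1) * (- m * (norm \<sigma>)\<^sup>2 + c * (HH x \<sigma> \<bullet> \<sigma>)))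
        + 2 * (C1 * (Z + 1) * (r \<bullet> \<sigma>)) * (HH x e \<bullet> \<sigma>) + Z * (W \<sigma> \<bullet> \<sigma>) \<le> 0" for \<sigma>
      proof -
        have "H\<zeta> \<sigma> \<bullet> \<sigma> = C1\<^sup>2 * (Z + 1) * (r \<bullet> \<sigma>)\<^sup>2 + C1 * (Z + 1) * (- m * (norm \<sigma>)\<^sup>2 + c * (HH x \<sigma> \<bullet> \<sigma>))"
          unfolding H\<zeta>_def ex by (simp add: inner_add_left inner_diff_left dot_square_norm power2_eq_square)
        moreover have "g\<zeta> x \<bullet> \<sigma> = C1 * (Z + 1) * (r \<bullet> \<sigma>)" unfolding g\<zeta>_def ex r_def by simp
        ultimately show ?thesis using ord(2)[of \<sigma>] unfolding wx gwx Z_def[symmetric] by simp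
      qed
      define Q where "Q = f (x, u x)"
      define v where "v = mc_speed (K *\<^sub>R e)"
      have v: "v > 0" by (simp add: v_def)
      have pdey: "mc_trace (g y) (HH y) = f (y, u y) * mc_speed (g y)" if "y \<in> \<Omega>" for y
      proof -
        have nz: "mc_speed (g y) \<noteq> 0" using mc_speed_pos[of "g y"] by linarith
        then show ?thesis using pde[OF that] mean_curvature_op_eq[OF HH[OF that]]
          by (simp add: g_def divide_eq_eq)
      qed
      have pde0: "mc_trace (K *\<^sub>R e) (HH x) = Q * mc_speed (K *\<^sub>R e)"
        using pdey[OF x\<Omega>] by (simp add: e(2) Q_def)
      have ux: "u y \<in> {-M0..M0}" if "y \<in> \<Omega>" for y using uM[OF that] by auto
      have cl: "(y, z) \<in> closed_cyl \<Omega> M0" if "y \<in> \<Omega>" "z \<in> {-M0..M0}" for y z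
        using that closure_subset by auto
      have QL: "\<bar>Q\<bar> \<le> L1" unfolding Q_def by (rule fb'(1)[OF cl[OF x\<Omega> ux[OF x\<Omega>]]])
      define D0 where "D0 = trace_form W - K\<^sup>2 * (W e \<bullet> e) / (1 + K\<^sup>2) - 2 * K * (norm (HH x e))\<^sup>2 / (1 + K\<^sup>2)
        + 2 * K ^ 3 * (HH x e \<bullet> e)\<^sup>2 / (1 + K\<^sup>2)\<^sup>2"
      have nK: "(norm (K *\<^sub>R e))\<^sup>2 = K\<^sup>2" using e(1) by simp
      have D: "((\<lambda>t. mc_trace (g (x + t *\<^sub>R e)) (HH (x + t *\<^sub>R e))) has_real_derivative D0) (at 0)"
        using D unfolding nK D0_def[symmetric] by (simp add: g_def)
      have Vd: "((\<lambda>t. mc_speed (g (x + t *\<^sub>R e))) has_real_derivative K * (HH x e \<bullet> e) / v) (at 0)"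
      proof -
        have "((\<lambda>t. x + t *\<^sub>R e) has_derivative (\<lambda>s. s *\<^sub>R e)) (at 0)" by (auto intro!: derivative_eq_intros)
        moreover have "((\<lambda>y. 1 + g y \<bullet> g y) has_derivative (\<lambda>h. 2 * (HH x h \<bullet> g x))) (at (x + 0 *\<^sub>R e))"
          using H by (auto intro!: derivative_eq_intros simp: inner_commute)
        ultimately have "((\<lambda>t. 1 + g (x + t *\<^sub>R e) \<bullet> g (x + t *\<^sub>R e)) has_derivative (\<lambda>s. 2 * (HH x (s *\<^sub>R e) \<bullet> g x))) (at 0)"
          using has_derivative_compose by blast
        moreover have "(\<lambda>s. 2 * (HH x (s *\<^sub>R e) \<bullet> g x)) = (*) (2 * K * (HH x e \<bullet> e))"
          using linH e(2) by (auto simp: linear_cmul)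
        ultimately have "((\<lambda>t. 1 + g (x + t *\<^sub>R e) \<bullet> g (x + t *\<^sub>R e)) has_real_derivative 2 * K * (HH x e \<bullet> e)) (at 0)"
          by (simp add: has_field_derivative_def)
        moreover have "1 + g x \<bullet> g x > 0" by (simp add: add_pos_nonneg)
        ultimately have "((\<lambda>t. sqrt (1 + g (x + t *\<^sub>R e) \<bullet> g (x + t *\<^sub>R e))) has_real_derivative
             (inverse (sqrt (1 + g (x + 0 *\<^sub>R e) \<bullet> g (x + 0 *\<^sub>R e))) / 2) * (2 * K * (HH x e \<bullet> e))) (at 0)"
          by (intro DERIV_chain2[OF DERIV_real_sqrt]) auto
        moreover have "inverse (sqrt (1 + g (x + 0 *\<^sub>R e) \<bullet> g (x + 0 *\<^sub>R e))) / 2 * (2 * K * (HH x e \<bullet> e)) = K * (HH x e \<bullet> e) / v"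
        proof -
          have "sqrt (1 + g x \<bullet> g x) = v" by (simp add: v_def mc_speed_def power2_norm_eq_inner flip: e(2))
          moreover have "inverse w / 2 * (2 * K * a) = K * a / w" for w a :: real by (cases "w = 0") (simp_all add: field_simps)
          ultimately show ?thesis by (simp only: scaleR_zero_left add_0_right)
        qed
        moreover have "(\<lambda>t. mc_speed (g (x + t *\<^sub>R e))) = (\<lambda>t. sqrt (1 + g (x + t *\<^sub>R e) \<bullet> g (x + t *\<^sub>R e)))"
          by (simp only: mc_speed_def power2_norm_eq_inner)
        ultimately show ?thesis by (simp only:)
      qed
      \<comment> \<open>\<open>f\<close> need not be differentiable at \<open>(x, u x)\<close> if
        \<open>u x\<close> is an endpoint of \<open>[- M0, M0]\<close>. The derivative of the
        right-hand side along \<open>e\<close> is therefore taken from the left-hand side of the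
        equation, and only bounded from below.\<close>
      define Q1 where "Q1 = (D0 * v - K * (HH x e \<bullet> e) / v * (Q * v)) / (v * v)"
      have Qd: "((\<lambda>t. mc_trace (g (x + t *\<^sub>R e)) (HH (x + t *\<^sub>R e)) / mc_speed (g (x + t *\<^sub>R e))) has_real_derivative Q1) (at 0)"
        using DERIV_divide[OF D Vd] v pde0 unfolding Q1_def by (simp add: e(2) v_def[symmetric] mult_ac)
      have dpde: "D0 = Q1 * mc_speed (K *\<^sub>R e) + Q * (K * (HH x e \<bullet> e) / mc_speed (K *\<^sub>R e))"
        unfolding Q1_def v_def[symmetric] using v by (simp add: field_simps)
      \<comment> \<open>Along \<open>e\<close> the solution increases, so monotonicity of
        \<open>f\<close> in \<open>z\<close> can only help; the remaining variation in
        \<open>x\<close> has rate at most \<open>L1\<close>.\<close>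
      have Q1: "Q1 \<ge> - L1"
      proof (rule ccontr)
        assume "\<not> Q1 \<ge> - L1"
        then have neg: "Q1 + L1 < 0" by simp
        have "((\<lambda>t. mc_trace (g (x + t *\<^sub>R e)) (HH (x + t *\<^sub>R e)) / mc_speed (g (x + t *\<^sub>R e)) + L1 * t) has_real_derivative Q1 + L1) (at 0)"
          using DERIV_add[OF Qd DERIV_cmult[OF DERIV_ident, of L1]] by simp
        from DERIV_neg_dec_right[OF this neg] obtain d1 where d1: "d1 > 0" "\<And>h. 0 < h \<Longrightarrow> h < d1 \<Longrightarrow>
            mc_trace (g (x + h *\<^sub>R e)) (HH (x + h *\<^sub>R e)) / mc_speed (g (x + h *\<^sub>R e)) + L1 * h
            < mc_trace (g x) (HH x) / mc_speed (g x)" by auto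
        have "((\<lambda>t. u (x + t *\<^sub>R e)) has_real_derivative K) (at 0)"
          using has_derivative_line[of u "g x" x 0 e] uD[OF x\<Omega>] wx by simp
        from DERIV_pos_inc_right[OF this Zp(2)] obtain d2 where d2: "d2 > 0" "\<And>h. 0 < h \<Longrightarrow> h < d2 \<Longrightarrow> u x < u (x + h *\<^sub>R e)" by auto
        define h where "h = min d0 (min d1 d2) / 2"
        have h: "0 < h" "h < d0" "h < d1" "h < d2" using d0 d1 d2 by (auto simp: h_def)
        define y where "y = x + h *\<^sub>R e"
        have yb: "y \<in> ball x d0" using h e by (simp add: y_def dist_norm)
        then have y\<Omega>: "y \<in> \<Omega>" using d0 by auto
        have seg: "closed_segment y x \<subseteq> \<Omega>"
          using closed_segment_subset[of y "ball x d0" x] yb d0 by auto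
        have quot: "mc_trace (g z) (HH z) / mc_speed (g z) = f (z, u z)" if "z \<in> \<Omega>" for z
          using pdey[OF that] by (simp add: less_imp_neq[OF mc_speed_pos, symmetric])
        have "f (y, u y) + L1 * h < f (x, u x)" using d1(2)[OF h(1,3)] quot[OF y\<Omega>] quot[OF x\<Omega>] by (simp add: y_def)
        moreover have "f (y, u x) \<le> f (y, u y)"
          using ux[OF x\<Omega>] ux[OF y\<Omega>] d2(2)[OF h(1,4)] by (intro cyl_mono_z[OF f1 M0 fz y\<Omega>]) (auto simp: y_def)
        moreover have "\<bar>f (y, u x) - f (x, u x)\<bar> \<le> L1 * norm (y - x)"
        proof (rule le_on_closed_interval[OF M0 _ ux[OF x\<Omega>]])
          show "continuous_on {-M0..M0} (\<lambda>z. \<bar>f (y, z) - f (x, z)\<bar>)"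
            by (intro continuous_intros continuous_on_compose2[OF cyl_continuous[OF f1 M0]]) (use x\<Omega> y\<Omega> closure_subset in auto)
          fix z assume z: "\<bar>z\<bar> < M0"
          show "\<bar>f (y, z) - f (x, z)\<bar> \<le> L1 * norm (y - x)"
          proof (rule lipschitz_on_segment[OF seg cyl_has_derivative(1)[OF f1 M0 _ z]])
            show "norm (grad_x (open_cyl \<Omega> M0) f (w, z)) \<le> L1" if "w \<in> \<Omega>" for w
              using z by (intro fb'(2) cl that) auto
          qed
        qed
        moreover have "norm (y - x) = h" using h e by (simp add: y_def)
        ultimately show False by (simp add: abs_le_iff)
      qed
      have rb: "r = b + (c * K) *\<^sub>R e" by (simp add: r_def g\<phi>_def b_def e(2))
      have nb: "norm b \<le> 2 / \<delta>"
      proof -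
        have "norm b = m * norm (x - x0)" using m by (simp add: b_def)
        also have "\<dots> \<le> m * \<delta>" using m xball by (intro mult_left_mono) auto
        also have "\<dots> = 2 / \<delta>" using \<delta> by (simp add: m_def power2_eq_square)
        finally show ?thesis .
      qed
      have Kb: "K \<ge> 1" "K \<ge> 4 * exp C1" "K \<ge> 4 / (\<delta> * c)" using K1 KK1 by linarith+
      have "C1 * c\<^sup>2 / 16 \<le> m * DIM('a) + L1 * c + 2 * L1 / \<delta> + 2 * L1"
        by (rule bernstein_algebra[OF e(1) Zp(2) linH linW Zp(1) ZK(2) _ C1 c less_imp_le[OF m] \<delta> rb nb
              fst_order snd_order pde0 QL dpde[unfolded D0_def] Q1 Kb])
           (use \<zeta>1[OF x\<Omega>] in \<open>simp add: Z_def\<close>)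
      then show False using C1B unfolding B_def by linarith
    qed
    have "exp (C1 / 2) \<le> exp (C1 * \<phi> x0)" using \<phi>0 C1 mult_left_mono[of "1/2" "\<phi> x0" C1] by simp
    then have "(exp (C1 / 2) - 1) * norm (g x0) \<le> \<zeta> x0 * norm (g x0)" by (intro mult_right_mono) (auto simp: \<zeta>_def)
    also have "\<dots> \<le> exp C1 * K1 + 1" using x(2)[OF x0S] bound by linarith
    finally show "norm (grad \<Omega> u x0) \<le> (exp C1 * K1 + 1) / (exp (C1 / 2) - 1)"
      using E by (simp add: g_def pos_le_divide_eq mult.commute)
  qed
qed

section \<open>Assembly of the two estimates\<close>

lemma cball_subset_of_setdist:
  fixes \<Omega> :: "'a::euclidean_space set"
  assumes "x \<in> \<Omega>'" "\<Omega>' \<subseteq> \<Omega>" "setdist \<Omega>' (frontier \<Omega>) = \<delta>" "r < \<delta>"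
  shows "cball x r \<subseteq> \<Omega>"
proof (rule ccontr)
  assume "\<not> cball x r \<subseteq> \<Omega>"
  then obtain y where "y \<in> cball x r" and y2: "y \<notin> \<Omega>" by blast
  then have y: "dist x y \<le> r" "y \<notin> \<Omega>" by auto
  have "closed_segment x y \<inter> frontier \<Omega> \<noteq> {}"
    using assms y by (intro connected_Int_frontier) auto
  then obtain z where z: "z \<in> closed_segment x y" "z \<in> frontier \<Omega>" by auto
  have "setdist \<Omega>' (frontier \<Omega>) \<le> dist x z" using assms(1) z(2) by (rule setdist_le_dist)
  moreover have "dist x z \<le> dist x y" using segment_bound(1)[OF z(1)] by (simp add: dist_norm norm_minus_commute)
  ultimately show False using assms y by linarith
qed

theorem theorem1p3:
  assumes "CARD('n::finite) = 2 \<or> CARD('n) = 3"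
  shows "\<exists>M1 :: real \<Rightarrow> real \<Rightarrow> real \<Rightarrow> real.
    interior_gradient_constant TYPE('n) M1 \<and>
    (\<forall>\<Omega> :: (real^'n) set. bounded_domain \<Omega> \<and> C3_boundary \<Omega> \<longrightarrow>
      (\<forall>M0>0. \<forall>L1>0. \<forall>L3>0. \<exists>\<mu>0>0. \<exists>M2>0.
        \<forall>\<gamma> f \<psi> u.
          (\<forall>p\<in>frontier \<Omega>. inward_unit_normal \<Omega> p (\<gamma> p)) \<and>
          rhs_conditions \<Omega> M0 L1 f \<and>
          Ck 1 (open_cyl \<Omega> M0) (closed_cyl \<Omega> M0) \<psi> \<and>
          C1_norm (open_cyl \<Omega> M0) (closed_cyl \<Omega> M0) \<psi> \<le> L3 \<and>
          Ck 2 \<Omega> (closure \<Omega>) u \<and> Ck 3 \<Omega> \<Omega> u \<and>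
          (\<forall>x\<in>closure \<Omega>. \<bar>u x\<bar> \<le> M0) \<and>
          (\<forall>x\<in>\<Omega>. mean_curvature_op \<Omega> u x = f (x, u x)) \<and>
          (\<forall>x\<in>frontier \<Omega>. grad \<Omega> u x \<bullet> \<gamma> x + \<psi> (x, u x) = 0)
          \<longrightarrow> (\<forall>x\<in>closure (boundary_strip \<Omega> \<mu>0).
                 norm (grad \<Omega> u x) \<le> max (M1 \<mu>0 M0 L1) M2)))"
proof -
  \<comment> \<open>The bound is made uniform in the domain and the data for each triple of numbers,
    so that a function \<open>M1\<close> of these numbers alone can be chosen. The radius is
    \<open>\<delta> / 2\<close> because a closed ball of radius \<open>\<delta>\<close> may touch
    the frontier.\<close>
  have "\<exists>m>0. \<forall>(\<Omega> :: (real^'n) set) f u x0. open \<Omega> \<and> rhs_conditions \<Omega> M0 L1 f \<and> Ck 3 \<Omega> \<Omega> u \<and>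
       (\<forall>x\<in>\<Omega>. \<bar>u x\<bar> \<le> M0) \<and> (\<forall>x\<in>\<Omega>. mean_curvature_op \<Omega> u x = f (x, u x)) \<and> cball x0 (\<delta> / 2) \<subseteq> \<Omega>
       \<longrightarrow> norm (grad \<Omega> u x0) \<le> m"
    if pos: "\<delta> > 0" "M0 > 0" "L1 > 0" for \<delta> M0 L1 :: real
  proof (rule interior_gradient_bound[OF _ pos(2,3), of "\<delta> / 2", where 'a = "real^'n"])
    fix m :: real
    assume m: "m > 0" "\<And>(\<Omega> :: (real^'n) set) f u x0. \<lbrakk>open \<Omega>; rhs_conditions \<Omega> M0 L1 f; Ck 3 \<Omega> \<Omega> u;
       \<And>x. x \<in> \<Omega> \<Longrightarrow> \<bar>u x\<bar> \<le> M0; \<And>x. x \<in> \<Omega> \<Longrightarrow> mean_curvature_op \<Omega> u x = f (x, u x);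
       cball x0 (\<delta> / 2) \<subseteq> \<Omega>\<rbrakk> \<Longrightarrow> norm (grad \<Omega> u x0) \<le> m"
    show ?thesis by (intro exI[of _ m] conjI m(1) allI impI m(2)) auto
  qed (use pos in simp)
  then obtain M1 where M1: "\<And>\<delta> M0 L1. \<delta> > 0 \<Longrightarrow> M0 > 0 \<Longrightarrow> L1 > 0 \<Longrightarrow> M1 \<delta> M0 L1 > (0::real)"
    "\<And>\<delta> M0 L1 (\<Omega> :: (real^'n) set) f u x0. \<delta> > 0 \<Longrightarrow> M0 > 0 \<Longrightarrow> L1 > 0 \<Longrightarrow> open \<Omega> \<and> rhs_conditions \<Omega> M0 L1 f \<and> Ck 3 \<Omega> \<Omega> u \<and>
       (\<forall>x\<in>\<Omega>. \<bar>u x\<bar> \<le> M0) \<and> (\<forall>x\<in>\<Omega>. mean_curvature_op \<Omega> u x = f (x, u x)) \<and> cball x0 (\<delta> / 2) \<subseteq> \<Omega>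
       \<Longrightarrow> norm (grad \<Omega> u x0) \<le> M1 \<delta> M0 L1"
    by metis
  have int: "interior_gradient_constant TYPE('n) M1"
    unfolding interior_gradient_constant_def
  proof (intro allI impI conjI ballI)
    fix \<delta> M0 L1 :: real assume pos: "0 < \<delta>" "0 < M0" "0 < L1"
    then show "0 < M1 \<delta> M0 L1" by (rule M1(1))
    fix \<Omega> \<Omega>' :: "(real^'n) set" and f u x
    assume a: "bounded_domain \<Omega> \<and> rhs_conditions \<Omega> M0 L1 f \<and> Ck 3 \<Omega> \<Omega> u \<and> (\<forall>x\<in>\<Omega>. \<bar>u x\<bar> \<le> M0) \<and>
           (\<forall>x\<in>\<Omega>. mean_curvature_op \<Omega> u x = f (x, u x)) \<and>
           bounded_domain \<Omega>' \<and> compact (closure \<Omega>') \<and> closure \<Omega>' \<subseteq> \<Omega> \<and> setdist \<Omega>' (frontier \<Omega>) = \<delta>"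
      and x: "x \<in> \<Omega>'"
    have "cball x (\<delta> / 2) \<subseteq> \<Omega>"
      using a pos closure_subset[of \<Omega>'] by (intro cball_subset_of_setdist[OF x]) auto
    then show "norm (grad \<Omega> u x) \<le> M1 \<delta> M0 L1"
      using a by (intro M1(2)[OF pos]) (auto simp: bounded_domain_def)
  qed
  have "\<exists>\<mu>0>0. \<exists>M2>0. \<forall>\<gamma> f \<psi> u.
          (\<forall>p\<in>frontier \<Omega>. inward_unit_normal \<Omega> p (\<gamma> p)) \<and>
          rhs_conditions \<Omega> M0 L1 f \<and>
          Ck 1 (open_cyl \<Omega> M0) (closed_cyl \<Omega> M0) \<psi> \<and>
          C1_norm (open_cyl \<Omega> M0) (closed_cyl \<Omega> M0) \<psi> \<le> L3 \<and>
          Ck 2 \<Omega> (closure \<Omega>) u \<and> Ck 3 \<Omega> \<Omega> u \<and>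
          (\<forall>x\<in>closure \<Omega>. \<bar>u x\<bar> \<le> M0) \<and>
          (\<forall>x\<in>\<Omega>. mean_curvature_op \<Omega> u x = f (x, u x)) \<and>
          (\<forall>x\<in>frontier \<Omega>. grad \<Omega> u x \<bullet> \<gamma> x + \<psi> (x, u x) = 0)
          \<longrightarrow> (\<forall>x\<in>closure (boundary_strip \<Omega> \<mu>0). norm (grad \<Omega> u x) \<le> max (M1 \<mu>0 M0 L1) M2)"
    if dom: "bounded_domain \<Omega>" "C3_boundary \<Omega>" and pos: "M0 > 0" "L1 > 0" "L3 > 0" for \<Omega> :: "(real^'n) set" and M0 L1 L3
  proof (rule neumann_gradient_bound[OF dom pos])
    fix M2 :: real
    assume M2: "M2 > 0" "\<And>\<gamma> f \<psi> u x. \<lbrakk>\<And>p. p \<in> frontier \<Omega> \<Longrightarrow> inward_unit_normal \<Omega> p (\<gamma> p); rhs_conditions \<Omega> M0 L1 f;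
      Ck 1 (open_cyl \<Omega> M0) (closed_cyl \<Omega> M0) \<psi>; C1_norm (open_cyl \<Omega> M0) (closed_cyl \<Omega> M0) \<psi> \<le> L3;
      Ck 2 \<Omega> (closure \<Omega>) u; \<And>x. x \<in> closure \<Omega> \<Longrightarrow> \<bar>u x\<bar> \<le> M0;
      \<And>x. x \<in> \<Omega> \<Longrightarrow> mean_curvature_op \<Omega> u x = f (x, u x);
      \<And>x. x \<in> frontier \<Omega> \<Longrightarrow> grad \<Omega> u x \<bullet> \<gamma> x + \<psi> (x, u x) = 0; x \<in> closure \<Omega>\<rbrakk>
      \<Longrightarrow> norm (grad \<Omega> u x) \<le> M2"
    have strip: "closure (boundary_strip \<Omega> 1) \<subseteq> closure \<Omega>"
      by (rule closure_mono) (auto simp: boundary_strip_def)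
    show ?thesis
    \<comment> \<open>The Neumann estimate holds on all of \<open>closure \<Omega>\<close>, hence on
      the closure of a strip of any width; width 1 is taken for all data.\<close>
    proof (rule exI[of _ 1], rule conjI, simp, rule exI[of _ M2], intro conjI M2(1) allI impI ballI)
      fix \<gamma> f \<psi> u x
      assume a: "(\<forall>p\<in>frontier \<Omega>. inward_unit_normal \<Omega> p (\<gamma> p)) \<and>
          rhs_conditions \<Omega> M0 L1 f \<and>
          Ck 1 (open_cyl \<Omega> M0) (closed_cyl \<Omega> M0) \<psi> \<and>
          C1_norm (open_cyl \<Omega> M0) (closed_cyl \<Omega> M0) \<psi> \<le> L3 \<and>
          Ck 2 \<Omega> (closure \<Omega>) u \<and> Ck 3 \<Omega> \<Omega> u \<and>
          (\<forall>x\<in>closure \<Omega>. \<bar>u x\<bar> \<le> M0) \<and>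
          (\<forall>x\<in>\<Omega>. mean_curvature_op \<Omega> u x = f (x, u x)) \<and>
          (\<forall>x\<in>frontier \<Omega>. grad \<Omega> u x \<bullet> \<gamma> x + \<psi> (x, u x) = 0)"
        and x: "x \<in> closure (boundary_strip \<Omega> 1)"
      have "norm (grad \<Omega> u x) \<le> M2"
        by (rule M2(2)[of \<gamma> f \<psi> u x]) (use a x strip in blast)+
      then show "norm (grad \<Omega> u x) \<le> max (M1 1 M0 L1) M2" by simp
    qed
  qed
  with int show ?thesis by blast
qed

end
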